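(* Let $w(z;\rho)$ be a regular semi-classical weight with singularities $z_0=0,z_1,\dots,z_M$ and exponents $\rho=(\rho_0,\dots,\rho_M)$, and let $j$ be such that $z_j\neq0$. Let $Y_n(z;\rho_j\pm1)$ be the matrix $Y_n$ of the weight $(z-z_j)^{\pm1}w(z;\rho)$, i.e. with $\rho_j\mapsto\rho_j\pm1$ and the other exponents fixed, and let $\kappa^{\pm}_n$ be its leading coefficient. Unmarked quantities refer to $w(z;\rho)$. (i) If $\phi_n(z_j)\neq0$ for all $n\ge0$, then $Y_n(z;\rho_j+1)=R^{j+}_n(z;\rho_j)\,Y_n(z;\rho_j)$ for $n\ge0$ with $$R^{j+}_n(z;\rho_j)=\frac{1}{z-z_j}\frac{\kappa^+_n}{\kappa_n}\begin{pmatrix} z-\dfrac{\kappa_n\phi_{n+1}(z_j)}{\kappa_{n+1}\phi_n(z_j)} & \dfrac{\phi_{n+1}(0)}{\kappa_{n+1}}\\[2mm] \dfrac{\phi^*_n(z_j)}{\phi_n(z_j)}\,z & -z_j\end{pmatrix}.$$ (ii) If $\xi^*_n(z_j)\neq0$ for all $n\ge0$, then $Y_n(z;\rho_j-1)=R^{j-}_n(z;\rho_j)\,Y_n(z;\rho_j)$ for $n\ge1$ with $$R^{j-}_n(z;\rho_j)=\frac{\kappa^-_n}{\kappa_n}\begin{pmatrix}\dfrac{\kappa_n\xi^*_n(z_j)}{\kappa_{n-1}\xi^*_{n-1}(z_j)} & \dfrac{\kappa_n\xi_n(z_j)}{\kappa_{n-1}\xi^*_{n-1}(z_j)}\\[2mm]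 \dfrac{\bar\phi_n(0)\xi^*_n(z_j)}{\kappa_{n-1}\xi^*_{n-1}(z_j)}\dfrac{z}{z_j} & 1-\dfrac{\kappa_n\xi^*_n(z_j)}{\kappa_{n-1}\xi^*_{n-1}(z_j)}\dfrac{z}{z_j}\end{pmatrix}.$$
   Context: $\mathbb T$ is the unit circle. For a complex-valued weight $w$ on $\mathbb T$ put $w_k=\int_{\mathbb T}\frac{d\zeta}{2\pi i\zeta}w(\zeta)\zeta^{-k}$ and $I_n[w]=\det[w_{j-k}]_{j,k=0,\dots,n-1}$, $I_0=1$. If $I_n[w]\ne0$ for all $n\ge0$, the bi-orthogonal system of $w$ is: polynomials $\phi_n,\bar\phi_n$ of degree $n$ with the same leading coefficient $\kappa_n$ satisfying $\int_{\mathbb T}\frac{d\zeta}{2\pi i\zeta}w(\zeta)\phi_m(\zeta)\bar\phi_n(\bar\zeta)=\delta_{m,n}$ with $\bar\zeta=1/\zeta$ ($\bar\phi_n$ is a separate polynomial, not in general the complex conjugate of $\phi_n$; $\kappa_n^2=I_n/I_{n+1}$, with a choice of square root $\kappa_n$ fixed for each weight); $\phi^*_n(z)=z^n\bar\phi_n(1/z)$; and the associated functions, for $z\notin\mathbb T$ and $n>0$, $\xi_n(z)=\int_{\mathbb T}\frac{d\zeta}{2\pi i\zeta}\frac{\zeta+z}{\zeta-z}w(\zeta)\phi_n(\zeta)$, $\ \xi^*_n(z)=-z^n\int_{\mathbb T}\frac{d\zeta}{2\pi i\zeta}\frac{\zeta+z}{\zeta-z}w(\zeta)\bar\phi_n(\bar\zeta)$,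 and $\xi_0(z)=\kappa_0[w_0+F(z)]$, $\xi^*_0(z)=\kappa_0[w_0-F(z)]$ with $F(z)=\int_{\mathbb T}\frac{d\zeta}{2\pi i\zeta}\frac{\zeta+z}{\zeta-z}w(\zeta)$. Put $$Y_n(z)=\begin{pmatrix}\phi_n(z)&\xi_n(z)/w(z)\\ \phi^*_n(z)&-\xi^*_n(z)/w(z)\end{pmatrix}.$$ Regular semi-classical weights: $M\ge1$, $z_0=0,z_1,\dots,z_M$ are distinct points of $\mathbb C$, and $\frac{w'(z)}{w(z)}=\frac{2V(z)}{W(z)}=\sum_{j=0}^M\frac{\rho_j}{z-z_j}$ with $W(z)=\prod_{j=0}^M(z-z_j)$, $\deg V<M+1$, $\rho_j\in\mathbb C\setminus\mathbb Z_{\ge0}$; e.g. $w(z)=\prod_{j=0}^M(z-z_j)^{\rho_j}$, possibly with different constant factors on different arcs of $\mathbb T$. Exponents are restricted so that the trigonometric moments of all weights considered exist. Values $\xi_n(z_j),\xi^*_n(z_j)$ at a singular point on $\mathbb T$ are understood as limits. The bi-orthogonal systems of $w$ and of all shifted weights considered are assumed to exist, with $r_n\bar r_n\ne0,1$ for $n\ge1$, where $r_n=\phi_n(0)/\kappa_n$, $\bar r_n=\bar\phi_n(0)/\kappa_n$. *)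

theory Defs
  imports
    "HOL-Analysis.Analysis"
    "HOL-Computational_Algebra.Polynomial"
    "Jordan_Normal_Form.Determinant"
begin

text \<open>
  The normalised integral of f over the unit circle against d zeta / (2 pi i zeta), which is
  d theta / (2 pi) under zeta = cis theta. It is a Lebesgue integral.
\<close>

definition circle_mean :: "(complex \<Rightarrow> complex) \<Rightarrow> complex" where
  "circle_mean f = (LINT \<theta>:{0..2*pi}|lborel. f (cis \<theta>)) / (2 * of_real pi)"

definition moments_exist :: "(complex \<Rightarrow> complex) \<Rightarrow> bool" where
  "moments_exist w \<longleftrightarrow>
     (\<forall>k::int. set_integrable lborel {0..2*pi} (\<lambda>\<theta>. w (cis \<theta>) * cis \<theta> powi (- k)))"

definition moment :: "(complex \<Rightarrow> complex) \<Rightarrow> int \<Rightarrow> complex" where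
  "moment w k = circle_mean (\<lambda>\<zeta>. w \<zeta> * \<zeta> powi (- k))"

definition toeplitz_det :: "(complex \<Rightarrow> complex) \<Rightarrow> nat \<Rightarrow> complex" where
  "toeplitz_det w n =
     Determinant.det (Matrix.mat n n (\<lambda>(j, k). moment w (int j - int k)))"

text \<open>
  The sequence kappa is an arbitrary one satisfying the conditions, so that every choice of the
  square roots of I_n / I_(n+1) is covered. The value I_0 = 1 is that of the empty determinant.
  On the circle the argument conj zeta is 1 / zeta.
\<close>

definition biorthogonal_system ::
  "(complex \<Rightarrow> complex) \<Rightarrow> (nat \<Rightarrow> complex) \<Rightarrow> (nat \<Rightarrow> complex poly) \<Rightarrow> (nat \<Rightarrow> complex poly) \<Rightarrow> bool"
where
  "biorthogonal_system w \<kappa> \<phi> \<phi>b \<longleftrightarrow>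
     (\<forall>n. toeplitz_det w n \<noteq> 0) \<and>
     (\<forall>n. degree (\<phi> n) = n \<and> degree (\<phi>b n) = n \<and>
          lead_coeff (\<phi> n) = \<kappa> n \<and> lead_coeff (\<phi>b n) = \<kappa> n) \<and>
     (\<forall>m n. circle_mean (\<lambda>\<zeta>. w \<zeta> * poly (\<phi> m) \<zeta> * poly (\<phi>b n) (1 / \<zeta>))
              = (if m = n then 1 else 0))"

definition regular_system ::
  "(complex \<Rightarrow> complex) \<Rightarrow> (nat \<Rightarrow> complex) \<Rightarrow> (nat \<Rightarrow> complex poly) \<Rightarrow> (nat \<Rightarrow> complex poly) \<Rightarrow> bool"
where
  "regular_system w \<kappa> \<phi> \<phi>b \<longleftrightarrow>
     biorthogonal_system w \<kappa> \<phi> \<phi>b \<and>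
     (\<forall>n\<ge>1. (poly (\<phi> n) 0 / \<kappa> n) * (poly (\<phi>b n) 0 / \<kappa> n) \<noteq> 0 \<and>
            (poly (\<phi> n) 0 / \<kappa> n) * (poly (\<phi>b n) 0 / \<kappa> n) \<noteq> 1)"

text \<open>
  phi*_n(z) = z^n phibar_n(1/z). As phibar_n has degree n, this is the reflected polynomial, which
  also has the right value at z = 0.
\<close>

definition phi_star :: "(nat \<Rightarrow> complex poly) \<Rightarrow> nat \<Rightarrow> complex \<Rightarrow> complex" where
  "phi_star \<phi>b n z = poly (reflect_poly (\<phi>b n)) z"

definition caratheodory :: "(complex \<Rightarrow> complex) \<Rightarrow> complex \<Rightarrow> complex" where
  "caratheodory w z = circle_mean (\<lambda>\<zeta>. (\<zeta> + z) / (\<zeta> - z) * w \<zeta>)"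

definition xi ::
  "(complex \<Rightarrow> complex) \<Rightarrow> (nat \<Rightarrow> complex) \<Rightarrow> (nat \<Rightarrow> complex poly) \<Rightarrow> nat \<Rightarrow> complex \<Rightarrow> complex"
where
  "xi w \<kappa> \<phi> n z =
     (if n = 0 then \<kappa> 0 * (moment w 0 + caratheodory w z)
      else circle_mean (\<lambda>\<zeta>. (\<zeta> + z) / (\<zeta> - z) * w \<zeta> * poly (\<phi> n) \<zeta>))"

definition xi_star ::
  "(complex \<Rightarrow> complex) \<Rightarrow> (nat \<Rightarrow> complex) \<Rightarrow> (nat \<Rightarrow> complex poly) \<Rightarrow> nat \<Rightarrow> complex \<Rightarrow> complex"
where
  "xi_star w \<kappa> \<phi>b n z =
     (if n = 0 then \<kappa> 0 * (moment w 0 - caratheodory w z)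
      else - (z ^ n) * circle_mean (\<lambda>\<zeta>. (\<zeta> + z) / (\<zeta> - z) * w \<zeta> * poly (\<phi>b n) (1 / \<zeta>)))"

text \<open>
  The value at a of a function f given off the unit circle: on the circle it is the limit along all
  approaches to a off the circle, from either side.
\<close>

definition off_circle_value :: "(complex \<Rightarrow> complex) \<Rightarrow> complex \<Rightarrow> complex" where
  "off_circle_value f a =
     (if a \<in> sphere 0 1 then Lim (at a within - sphere 0 1) f else f a)"

definition Y_matrix ::
  "(complex \<Rightarrow> complex) \<Rightarrow> (nat \<Rightarrow> complex) \<Rightarrow> (nat \<Rightarrow> complex poly) \<Rightarrow> (nat \<Rightarrow> complex poly)
    \<Rightarrow> nat \<Rightarrow> complex \<Rightarrow> complex Matrix.mat"
where
  "Y_matrix w \<kappa> \<phi> \<phi>b n z =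
     mat_of_rows_list 2
       [[poly (\<phi> n) z, xi w \<kappa> \<phi> n z / w z],
        [phi_star \<phi>b n z, - xi_star w \<kappa> \<phi>b n z / w z]]"

text \<open>
  The set D is a domain (open, not necessarily connected) on which a branch of the weight is chosen,
  for instance the plane with cuts from the points z_j and from the endpoints of the arcs. It covers
  the circle up to finitely many points, among them the z_j of modulus 1 and the points where the
  circle meets a cut. Between these points the constant factors are independent of each other. The
  last clause also admits arcs on which the constant factor is 0, where w'/w has no meaning.
\<close>

definition regular_semiclassical ::
  "nat \<Rightarrow> (nat \<Rightarrow> complex) \<Rightarrow> (nat \<Rightarrow> complex) \<Rightarrow> complex set \<Rightarrow> (complex \<Rightarrow> complex) \<Rightarrow> bool"
where
  "regular_semiclassical M z \<rho> D w \<longleftrightarrow>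
     M \<ge> 1 \<and> z 0 = 0 \<and> inj_on z {..M} \<and> (\<forall>j\<le>M. \<rho> j \<notin> \<nat>) \<and>
     open D \<and> D \<inter> z ` {..M} = {} \<and> w holomorphic_on D \<and> (\<forall>x\<in>D. w x \<noteq> 0) \<and>
     (\<exists>V. degree V < M + 1 \<and>
        (let W = (\<Prod>j\<le>M. [:- z j, 1:]) in
           (\<forall>x. x \<notin> z ` {..M} \<longrightarrow> 2 * poly V x / poly W x = (\<Sum>j\<le>M. \<rho> j / (x - z j))) \<and>
           (\<forall>x\<in>D. deriv w x / w x = 2 * poly V x / poly W x))) \<and>
     (\<exists>S. finite S \<and>
        (\<forall>\<zeta>\<in>sphere 0 1 - S. \<zeta> \<in> D \<or> (\<forall>\<^sub>F x in nhds \<zeta>. x \<in> sphere 0 1 \<longrightarrow> w x = 0)))"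

end

theory Submission
  imports Defs "HOL-Complex_Analysis.Complex_Analysis"
begin

text \<open>
  Put \<open>a = z\<^sub>j\<close> and let \<open>L f\<close> be the mean of \<open>w f\<close> over the circle. The shift of \<open>\<rho>\<^sub>j\<close> by 1
  replaces \<open>L\<close> by \<open>f \<mapsto> L ((x - a) f)\<close>. Hence \<open>(x - a) \<phi>\<^sup>+\<^sub>n\<close> and \<open>(x - a) \<phi>\<^sup>+\<^sup>*\<^sub>n\<close> have degree at
  most \<open>n + 1\<close> and are orthogonal to \<open>n\<close> monomials, so that each is a combination of two polynomials
  built from the original system; the coefficients are read off from the leading or constant
  coefficient and the zero at \<open>a\<close>. For the shift by \<open>-1\<close> the same argument runs backwards, the zero
  at \<open>a\<close> being replaced by one more orthogonality relation, which involves \<open>\<xi>\<^sub>n(a)\<close> and \<open>\<xi>\<^sup>*\<^sub>n(a)\<close>.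
  As \<open>\<xi>\<^sub>n\<close>, \<open>\<xi>\<^sup>*\<^sub>n\<close> are Cauchy transforms of \<open>\<phi>\<^sub>n\<close>, \<open>\<phi>\<^sup>*\<^sub>n\<close> under \<open>L\<close>, the second columns follow
  from the first ones.

  For \<open>a\<close> on the circle the values at \<open>a\<close> are limits along arbitrary, possibly tangential,
  approaches. Integrability of \<open>w / (x - a)\<close> forces \<open>Re \<rho>\<^sub>j > 0\<close> unless \<open>w\<close> vanishes on both arcs
  at \<open>a\<close>; hence \<open>w\<close> is Hoelder continuous near \<open>a\<close> with value 0 there, and the Cauchy integral
  converges to its value at \<open>a\<close>.
\<close>

section \<open>Biorthogonal systems of a linear functional\<close>

text \<open>The algebra is done for an abstract functional tested on continuous functions only, and
  the shift enters it solely as \<open>L' f = L ((x - a) f)\<close>, never as a division. One locale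
  thus serves both directions: \<open>L\<close> is the mean for \<open>w\<close> when the exponent
  goes up and the mean for \<open>w / (x - a)\<close> when it goes down. This covers
  \<open>a\<close> on the circle, where \<open>1 / (x - a)\<close> is no admissible test function
  for \<open>L'\<close>: there \<xi>_n(a) is replaced by \<open>L\<close> of a polynomial, and the
  analytic task is to identify this number with the limit. That limit is a Cauchy integral
  approached at its own singular point from both sides. By the jump relation the inner and outer
  limits differ by the density at \<open>a\<close>, so the value 0 there is what lets a two-sided
  limit exist; Hoelder continuity is what admits approaches outside every Stolz angle. The two arcs
  at \<open>a\<close> may carry unrelated constants, one of them 0, but they share the exponent and
  the value 0, so the estimates on them can be glued.\<close>

locale circle_functional =
  fixes L :: "(complex \<Rightarrow> complex) \<Rightarrow> complex"
  assumes L_add: "continuous_on (sphere 0 1) f \<Longrightarrow> continuous_on (sphere 0 1) g \<Longrightarrow>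
      L (\<lambda>x. f x + g x) = L f + L g"
    and L_scale: "continuous_on (sphere 0 1) f \<Longrightarrow> L (\<lambda>x. c * f x) = c * L f"
    and L_cong: "(\<And>x. x \<in> sphere 0 1 \<Longrightarrow> f x = g x) \<Longrightarrow> L f = L g"
begin

lemma L_zero: "L (\<lambda>x. 0) = 0"
  using L_scale[of "\<lambda>x. 0" 0] by simp

lemma L_lincomb:
  assumes "continuous_on (sphere 0 1) f" "continuous_on (sphere 0 1) g"
  shows "L (\<lambda>x. a * f x + b * g x) = a * L f + b * L g"
  using assms by (simp add: L_add L_scale continuous_intros)

lemma L_lincomb3:
  assumes "continuous_on (sphere 0 1) f" "continuous_on (sphere 0 1) g" "continuous_on
      (sphere 0 1) h"
  shows "L (\<lambda>x. a * f x + b * g x + c * h x) = a * L f + b * L g + c * L h"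
  using assms L_lincomb[of "\<lambda>x. a * f x + b * g x" h 1 c] by (simp add: L_lincomb continuous_intros)

end

lemma continuous_on_circle_inverse:
  assumes "continuous_on (sphere 0 1) f"
  shows "continuous_on (sphere 0 1) (\<lambda>x::complex. f (1 / x) :: complex)"
proof -
  have "continuous_on (sphere 0 1) (\<lambda>x::complex. 1 / x)"
    by (intro continuous_intros) auto
  then show ?thesis
    by (rule continuous_on_compose2[OF assms]) (auto simp: norm_divide)
qed

lemma continuous_on_circle_poly_inverse [continuous_intros]:
  "continuous_on (sphere 0 1) (\<lambda>x::complex. poly q (1 / x))"
  by (intro continuous_on_circle_inverse continuous_intros)

lemma sphere_nonzero: "(x::complex) \<in> sphere 0 1 \<Longrightarrow> x \<noteq> 0"
  by auto

lemma continuous_on_circle_monomials [continuous_intros]: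
  "continuous_on (sphere 0 1) (\<lambda>x::complex. 1 / x ^ k)"
  by (intro continuous_intros) auto

lemma continuous_on_circle_resolvent [continuous_intros]:
  assumes "norm z \<noteq> 1"
  shows "continuous_on (sphere 0 1) (\<lambda>x::complex. 1 / (x - z))"
  using assms by (intro continuous_intros) auto

locale biorthogonal = circle_functional L for L +
  fixes \<phi> \<psi> :: "nat \<Rightarrow> complex poly" and \<kappa> :: "nat \<Rightarrow> complex"
  assumes degree_phi: "degree (\<phi> n) = n" and degree_psi: "degree (\<psi> n) = n"
    and lead_phi: "coeff (\<phi> n) n = \<kappa> n" and lead_psi: "coeff (\<psi> n) n = \<kappa> n"
    and orth: "L (\<lambda>x. poly (\<phi> m) x * poly (\<psi> n) (1 / x)) = (if m = n then 1 else 0)"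
begin

text \<open>The substitution of \<open>1 / x\<close> for \<open>x\<close> preserves the circle and
  exchanges the two polynomial families, so every fact proved for \<open>\<phi>\<close> is available
  for \<open>\<psi>\<close> without a second proof.\<close>

lemma dual: "biorthogonal (\<lambda>f. L (\<lambda>x. f (1 / x))) \<psi> \<phi> \<kappa>"
proof
  show "L (\<lambda>x. f (1 / x) + g (1 / x)) = L (\<lambda>x. f (1 / x)) + L (\<lambda>x. g (1 / x))"
    if "continuous_on (sphere 0 1) f" "continuous_on (sphere 0 1) g" for f g
    using that by (intro L_add continuous_on_circle_inverse)
  show "L (\<lambda>x. c * f (1 / x)) = c * L (\<lambda>x. f (1 / x))"
    if "continuous_on (sphere 0 1) f" for f c
    using that by (intro L_scale continuous_on_circle_inverse)
  show "L (\<lambda>x. f (1 / x)) = L (\<lambda>x. g (1 / x))"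
    if "\<And>x. x \<in> sphere 0 1 \<Longrightarrow> f x = g x" for f g :: "complex \<Rightarrow> complex"
    using that by (intro L_cong) (auto simp: norm_divide)
  show "L (\<lambda>x. poly (\<psi> m) (1 / x) * poly (\<phi> n) (1 / (1 / x))) = (if m = n then 1 else 0)" for m n
    using orth[of n m] by (simp add: mult.commute eq_commute)
qed (simp_all add: degree_phi degree_psi lead_phi lead_psi)

lemma kappa_nonzero: "\<kappa> n \<noteq> 0"
proof
  assume "\<kappa> n = 0"
  then have "\<phi> n = 0"
    using lead_phi[of n] degree_phi[of n] leading_coeff_0_iff[of "\<phi> n"] by simp
  then show False
    using orth[of n n] by (simp add: L_zero)
qed

text \<open>The polynomials \<open>\<psi> k\<close> with \<open>k < n\<close> span everything of
  degree below \<open>n\<close>. The hypothesis is on coefficients, not on the degree, so that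
  \<open>n = 0\<close> makes sense and forces \<open>q = 0\<close>.\<close>

lemma orth_poly:
  assumes "\<And>i. i \<ge> n \<Longrightarrow> coeff q i = 0"
  shows "L (\<lambda>x. poly (\<phi> n) x * poly q (1 / x)) = 0"
proof -
  \<comment> \<open>The bound \<open>k\<close> is separated from \<open>n\<close> so that it can
    shrink while \<open>n\<close> stays fixed; each step removes the top coefficient by a multiple
    of \<open>\<psi> k\<close>.\<close>
  have "L (\<lambda>x. poly (\<phi> n) x * poly q (1 / x)) = 0" if "\<forall>i\<ge>k. coeff q i = 0" "k \<le> n" for k q
    using that
  proof (induction k arbitrary: q)
    case 0
    then have "q = 0" by (simp add: poly_eq_iff)
    then show ?case by (simp add: L_zero)
  next
    case (Suc k)
    define c where "c = coeff q k / \<kappa> k"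
    define r where "r = q - Polynomial.smult c (\<psi> k)"
    have "coeff r i = 0" if "i \<ge> k" for i
      using that Suc.prems
      by (cases "i = k") (auto simp: r_def c_def lead_psi kappa_nonzero coeff_eq_0 degree_psi)
    then have *: "L (\<lambda>x. poly (\<phi> n) x * poly r (1 / x)) = 0"
      using Suc by auto
    have "L (\<lambda>x. poly (\<phi> n) x * poly q (1 / x)) =
      L (\<lambda>x. 1 * (poly (\<phi> n) x * poly r (1 / x)) + c * (poly (\<phi> n) x * poly (\<psi> k) (1 / x)))"
      by (intro L_cong) (simp add: r_def algebra_simps)
    also have "\<dots> = 0"
      using * Suc.prems by (subst L_lincomb) (auto simp: orth intro!: continuous_intros)
    finally show ?case .
  qed
  from this[of n q] show ?thesis
    using assms by simp
qed

lemma orth_monom: "k < n \<Longrightarrow> L (\<lambda>x. poly (\<phi> n) x * (1 / x ^ k)) = 0"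
  using orth_poly[of n "monom 1 k"] by (simp add: poly_monom power_divide)

text \<open>After subtraction of the multiple of \<open>\<phi> n\<close> with the same top
  coefficient, the rest is annihilated by the dual form of \<open>orth_poly\<close>. Pairing with
  \<open>\<psi> n\<close> thus detects leading coefficients, which is what the uniqueness lemmas
  need.\<close>

lemma L_psi:
  assumes "degree p \<le> n"
  shows "L (\<lambda>x. poly p x * poly (\<psi> n) (1 / x)) = coeff p n / \<kappa> n"
proof -
  define q where "q = p - Polynomial.smult (coeff p n / \<kappa> n) (\<phi> n)"
  have "coeff q i = 0" if "i \<ge> n" for i
    using that assms
    by (cases "i = n") (auto simp: q_def lead_phi kappa_nonzero coeff_eq_0 degree_phi)
  then have *: "L (\<lambda>x. poly (\<psi> n) (1 / x) * poly q x) = 0"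
    using biorthogonal.orth_poly[OF dual, of n q] by simp
  have "L (\<lambda>x. poly p x * poly (\<psi> n) (1 / x)) =
      L (\<lambda>x. 1 * (poly (\<psi> n) (1 / x) * poly q x)
        + (coeff p n / \<kappa> n) * (poly (\<phi> n) x * poly (\<psi> n) (1 / x)))"
    by (intro L_cong) (simp add: q_def algebra_simps)
  also have "\<dots> = coeff p n / \<kappa> n"
    using * by (subst L_lincomb) (auto intro!: continuous_intros simp: orth)
  finally show ?thesis .
qed

text \<open>Induction on \<open>q\<close>: one factor \<open>1 / x\<close> is absorbed into
  \<open>f\<close>, at the price of one orthogonality relation.\<close>

lemma L_poly_inverse_eq_0:
  assumes "continuous_on (sphere 0 1) f" "\<And>k. k < n \<Longrightarrow> L (\<lambda>x. f x * (1 / x ^ k)) = 0" "degree q < n"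
  shows "L (\<lambda>x. f x * poly q (1 / x)) = 0"
  using assms
proof (induction q arbitrary: f n)
  case 0
  show ?case by (simp add: L_zero)
next
  case (pCons c q)
  have "L (\<lambda>x. f x * poly (pCons c q) (1 / x)) =
      L (\<lambda>x. c * f x + 1 * (f x * (1 / x) * poly q (1 / x)))"
    by (intro L_cong) (simp add: algebra_simps)
  also have "\<dots> = c * L f + L (\<lambda>x. f x * (1 / x) * poly q (1 / x))"
    using pCons.prems(1) by (subst L_lincomb) (auto intro!: continuous_intros)
  also have "L f = 0"
    using pCons.prems(2)[of 0] pCons.prems(3) by simp
  also have "L (\<lambda>x. f x * (1 / x) * poly q (1 / x)) = 0"
  \<comment> \<open>The zero tail is separate because its degree is 0, so the degree bound of the
    induction hypothesis can fail for it.\<close>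
  proof (cases "q = 0")
    case False
    show ?thesis
    proof (rule pCons.IH)
      show "L (\<lambda>x. f x * (1 / x) * (1 / x ^ k)) = 0" if "k < n - 1" for k
        using pCons.prems(2)[of "Suc k"] that by simp
    qed (use False pCons.prems in \<open>auto intro!: continuous_intros\<close>)
  qed (simp add: L_zero)
  finally show ?case by simp
qed

text \<open>The difference \<open>r\<close> of the two sides has degree \<open>m < n\<close> unless
  it is 0, and it is orthogonal to all powers up to \<open>m\<close>. Pairing it with
  \<open>\<psi> m\<close> then gives 0, while \<open>L_psi\<close> gives its nonzero leading
  coefficient over \<open>\<kappa> m\<close>.\<close>

lemma unique_phi:
  assumes deg: "degree p \<le> n" and o: "\<And>k. k < n \<Longrightarrow> L (\<lambda>x. poly p x * (1 / x ^ k)) = 0"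
  shows "p = Polynomial.smult (coeff p n / \<kappa> n) (\<phi> n)"
proof -
  define r where "r = p - Polynomial.smult (coeff p n / \<kappa> n) (\<phi> n)"
  have rk: "L (\<lambda>x. poly r x * (1 / x ^ k)) = 0" if "k < n" for k
  proof -
    have "L (\<lambda>x. poly r x * (1 / x ^ k)) =
        L (\<lambda>x. 1 * (poly p x * (1 / x ^ k)) + (- (coeff p n / \<kappa> n)) * (poly (\<phi> n) x * (1 / x ^ k)))"
      by (intro L_cong) (simp add: r_def algebra_simps)
    also have "\<dots> = 0"
      using o[OF that] orth_monom[OF that] by (subst L_lincomb) (auto intro!: continuous_intros)
    finally show ?thesis .
  qed
  have "r = 0"
  proof (rule ccontr)
    assume "r \<noteq> 0"
    define m where "m = degree r"
    have lc: "coeff r m \<noteq> 0" using \<open>r \<noteq> 0\<close> by (simp add: m_def)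
    have "coeff r i = 0" if "i \<ge> n" for i
      using that deg
      by (cases "i = n") (auto simp: r_def lead_phi kappa_nonzero coeff_eq_0 degree_phi)
    then have "m < n" using lc by (metis not_le)
    then have "L (\<lambda>x. poly r x * poly (\<psi> m) (1 / x)) = 0"
      by (intro L_poly_inverse_eq_0[of _ n] rk) (auto intro!: continuous_intros simp: degree_psi)
    then show False
      using L_psi[of r m] lc kappa_nonzero[of m] by (simp add: m_def)
  qed
  then show ?thesis by (simp add: r_def)
qed

section \<open>Reversed polynomials and the Szego recurrences\<close>

abbreviation star :: "nat \<Rightarrow> complex poly" where
  "star n \<equiv> reflect_poly (\<psi> n)"

lemma poly_star: "x \<noteq> 0 \<Longrightarrow> poly (star n) x = x ^ n * poly (\<psi> n) (1 / x)"
  by (simp add: poly_reflect_poly_nz degree_psi inverse_eq_divide)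

lemma star_0: "poly (star n) 0 = \<kappa> n"
  by (metis degree_psi lead_psi poly_reflect_poly_0)

lemma coeff_star: "coeff (star n) n = poly (\<psi> n) 0"
  by (simp add: coeff_reflect_poly degree_psi poly_0_coeff_0)

lemma degree_star: "degree (star n) \<le> n"
  using degree_reflect_poly_le[of "\<psi> n"] by (simp add: degree_psi)

text \<open>On the circle, \<open>x ^ (- k)\<close> times the reversed polynomial is
  \<open>\<psi> n\<close> at \<open>1 / x\<close> times \<open>x ^ (n - k)\<close>, so this is dual
  orthogonality at the exponent \<open>n - k < n\<close>. The exponent \<open>k = 0\<close> is
  excluded: there the value is that of \<open>L_star\<close>.\<close>

lemma orth_star:
  assumes "1 \<le> k" "k \<le> n"
  shows "L (\<lambda>x. poly (star n) x * (1 / x ^ k)) = 0"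
proof -
  have "poly (star n) x * (1 / x ^ k) = poly (\<psi> n) (1 / x) * (1 / (1 / x) ^ (n - k))"
    if "x \<in> sphere 0 1" for x
  proof -
    have "x ^ n = x ^ (n - k) * x ^ k" using assms by (simp flip: power_add)
    then show ?thesis using sphere_nonzero[OF that] by (simp add: poly_star power_divide)
  qed
  then have "L (\<lambda>x. poly (star n) x * (1 / x ^ k)) =
      L (\<lambda>x. poly (\<psi> n) (1 / x) * (1 / (1 / x) ^ (n - k)))"
    by (intro L_cong) auto
  then show ?thesis
    using biorthogonal.orth_monom[OF dual, of "n - k" n] assms by simp
qed

lemma L_star: "L (poly (star n)) = 1 / \<kappa> n"
proof -
  have "L (poly (star n)) = L (\<lambda>x. poly (monom 1 n) x * poly (\<psi> n) (1 / x))"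
    using sphere_nonzero by (intro L_cong) (simp add: poly_star poly_monom)
  then show ?thesis
    by (simp add: L_psi degree_monom_eq)
qed

text \<open>Removing the constant term leaves \<open>r = x * q\<close>, where \<open>q\<close> is
  orthogonal to the powers below \<open>n\<close>. So \<open>q\<close> is a multiple of
  \<open>\<phi> n\<close> by \<open>unique_phi\<close>, and the degree bound on \<open>r\<close>
  makes that multiple 0.\<close>

lemma unique_star:
  assumes deg: "degree p \<le> n"
    and o: "\<And>k. 1 \<le> k \<Longrightarrow> k \<le> n \<Longrightarrow> L (\<lambda>x. poly p x * (1 / x ^ k)) = 0"
  shows "p = Polynomial.smult (poly p 0 / \<kappa> n) (star n)"
proof -
  define r where "r = p - Polynomial.smult (poly p 0 / \<kappa> n) (star n)"
  have "poly r 0 = 0" using star_0[of n] by (simp add: r_def kappa_nonzero)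
  then obtain q where q: "r = pCons 0 q"
    by (cases r) auto
  have "q = Polynomial.smult (coeff q n / \<kappa> n) (\<phi> n)"
  proof (rule unique_phi)
    have "degree r \<le> n"
      using deg degree_star[of n] unfolding r_def
          by (intro degree_diff_le) (auto intro: order.trans[OF degree_smult_le])
    then show "degree q \<le> n" by (auto simp: q degree_pCons_eq_if split: if_splits)
    show "L (\<lambda>x. poly q x * (1 / x ^ k)) = 0" if "k < n" for k
    proof -
      have "L (\<lambda>x. poly q x * (1 / x ^ k)) = L (\<lambda>x. poly r x * (1 / x ^ Suc k))"
        by (intro L_cong) (auto dest!: sphere_nonzero simp: q)
      also have "\<dots> = L (\<lambda>x. 1 * (poly p x * (1 / x ^ Suc k))
          + (- (poly p 0 / \<kappa> n)) * (poly (star n) x * (1 / x ^ Suc k)))"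
        by (intro L_cong) (simp add: r_def algebra_simps)
      also have "\<dots> = 0"
        using o[of "Suc k"] orth_star[of "Suc k" n] that
        by (subst L_lincomb) (auto intro!: continuous_intros simp del: power_Suc)
      finally show ?thesis .
    qed
  qed
  moreover have "coeff q n = 0"
  proof -
    have "degree r \<le> n"
      using deg degree_star[of n] unfolding r_def
          by (intro degree_diff_le) (auto intro: order.trans[OF degree_smult_le])
    then have "coeff r (Suc n) = 0" by (simp add: coeff_eq_0)
    then show ?thesis by (simp add: q)
  qed
  ultimately have "r = 0" by (simp add: q)
  then show ?thesis by (simp add: r_def)
qed

text \<open>Multiplication by \<open>x\<close> shifts the orthogonality of \<open>\<phi> n\<close>
  to the exponents 1 to \<open>n\<close>, where that of \<open>\<phi> (Suc n)\<close> holds too.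
  Once the leading terms cancel, \<open>unique_star\<close> applies, and the factor is read off at
  0.\<close>

lemma szego:
  "Polynomial.smult (\<kappa> n) (\<phi> (Suc n)) = Polynomial.smult (\<kappa> (Suc n)) (pCons 0 (\<phi> n))
      + Polynomial.smult (poly (\<phi> (Suc n)) 0) (star n)"
proof -
  define p where "p = Polynomial.smult (\<kappa> n) (\<phi> (Suc n))
      - Polynomial.smult (\<kappa> (Suc n)) (pCons 0 (\<phi> n))"
  have "degree p \<le> n"
  proof (rule degree_le, intro allI impI)
    fix i assume "n < i"
    then show "coeff p i = 0"
      by (cases "i = Suc n") (auto simp: p_def lead_phi coeff_eq_0 degree_phi coeff_pCons split:
          nat.splits)
  qed
  moreover have "L (\<lambda>x. poly p x * (1 / x ^ k)) = 0" if "1 \<le> k" "k \<le> n" for k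
  proof -
    have "L (\<lambda>x. poly p x * (1 / x ^ k)) =
      L (\<lambda>x. \<kappa> n * (poly (\<phi> (Suc n)) x * (1 / x ^ k))
          + (- \<kappa> (Suc n)) * (poly (\<phi> n) x * (1 / x ^ (k - 1))))"
    proof (intro L_cong)
      fix x :: complex assume "x \<in> sphere 0 1"
      then have *: "x * (1 / x ^ k) = 1 / x ^ (k - 1)"
        using that sphere_nonzero by (cases k) auto
      show "poly p x * (1 / x ^ k) =
          \<kappa> n * (poly (\<phi> (Suc n)) x * (1 / x ^ k))
              + - \<kappa> (Suc n) * (poly (\<phi> n) x * (1 / x ^ (k - 1)))"
        by (simp add: p_def *[symmetric] algebra_simps diff_divide_distrib del: One_nat_def)
    qed
    also have "\<dots> = 0"
      using that orth_monom[of k "Suc n"] orth_monom[of "k - 1" n]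
      by (subst L_lincomb) (auto intro!: continuous_intros)
    finally show ?thesis .
  qed
  ultimately have "p = Polynomial.smult (poly p 0 / \<kappa> n) (star n)"
    by (rule unique_star)
  also have "poly p 0 / \<kappa> n = poly (\<phi> (Suc n)) 0"
    by (simp add: p_def kappa_nonzero)
  finally show ?thesis by (simp add: p_def algebra_simps)
qed

text \<open>Again leading terms cancel and \<open>unique_star\<close> applies. The factor is found
  by applying \<open>L\<close> and \<open>L_star\<close>; evaluation at 0 would give it as
  \<open>\<kappa> (Suc n) ^ 2\<close> minus a product of constant terms and require the relation
  between this and \<open>\<kappa> n ^ 2\<close>.\<close>

lemma szego_inverse:
  "Polynomial.smult (\<kappa> n) (star n) =
     Polynomial.smult (\<kappa> (Suc n)) (star (Suc n))
         - Polynomial.smult (poly (\<psi> (Suc n)) 0) (\<phi> (Suc n))"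
proof -
  define p where "p = Polynomial.smult (\<kappa> (Suc n)) (star (Suc n))
      - Polynomial.smult (poly (\<psi> (Suc n)) 0) (\<phi> (Suc n))"
  have "degree p \<le> n"
  proof (rule degree_le, intro allI impI)
    fix i assume "n < i"
    then show "coeff p i = 0"
      using degree_star[of "Suc n"]
      by (cases "i = Suc n") (auto simp: p_def lead_phi coeff_star coeff_eq_0 degree_phi)
  qed
  moreover have Lp: "L (\<lambda>x. poly p x * (1 / x ^ k)) =
      \<kappa> (Suc n) * L (\<lambda>x. poly (star (Suc n)) x * (1 / x ^ k))" if "k \<le> n" for k
  proof -
    have "L (\<lambda>x. poly p x * (1 / x ^ k)) =
      L (\<lambda>x. \<kappa> (Suc n) * (poly (star (Suc n)) x * (1 / x ^ k))
        + (- poly (\<psi> (Suc n)) 0) * (poly (\<phi> (Suc n)) x * (1 / x ^ k)))"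
      by (intro L_cong) (simp add: p_def algebra_simps)
    also have "\<dots> = \<kappa> (Suc n) * L (\<lambda>x. poly (star (Suc n)) x * (1 / x ^ k))"
      using that orth_monom[of k "Suc n"] by (subst L_lincomb) (auto intro!: continuous_intros)
    finally show ?thesis .
  qed
  ultimately have p: "p = Polynomial.smult (poly p 0 / \<kappa> n) (star n)"
    using orth_star[of _ "Suc n"] by (intro unique_star) auto
  have "L (poly p) = 1"
    using Lp[of 0] L_star[of "Suc n"] by (simp add: kappa_nonzero)
  moreover have "L (poly p) = poly p 0 / \<kappa> n * (1 / \<kappa> n)"
  proof -
    have "poly p x = poly p 0 / \<kappa> n * poly (star n) x" for x
      by (subst p) simp
    then have "L (poly p) = L (\<lambda>x. poly p 0 / \<kappa> n * poly (star n) x)"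
      by (intro L_cong)
    also have "\<dots> = poly p 0 / \<kappa> n * (1 / \<kappa> n)"
      by (subst L_scale) (auto intro!: continuous_intros simp: L_star)
    finally show ?thesis .
  qed
  ultimately have "poly p 0 / \<kappa> n = \<kappa> n"
    by (simp add: kappa_nonzero field_simps)
  then show ?thesis using p by (simp add: p_def)
qed

end

section \<open>Multiplication of the functional by a linear factor\<close>

context biorthogonal
begin

text \<open>This is \<xi>_n off the circle. The kernel comes from (x + z)/(x - z) = 2x/(x - z) - 1;
  the form with \<open>x\<close> in the numerator is correct for \<open>n = 0\<close> as
  well.\<close>

definition cauchy_phi :: "nat \<Rightarrow> complex \<Rightarrow> complex" where
  "cauchy_phi n z = 2 * L (\<lambda>x. poly (\<phi> n) x * (x / (x - z)))"

text \<open>The function \<open>xi*_n\<close> off the circle, from the other splitting (x + z)/(x -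
  z) = 2z/(x - z) + 1 and with the factor \<open>z ^ n\<close> absorbed into the reversed
  polynomial.\<close>

definition cauchy_star :: "nat \<Rightarrow> complex \<Rightarrow> complex" where
  "cauchy_star n z = - 2 * z * L (\<lambda>x. poly (star n) x * (1 / (x - z)))"

lemma L_phi_eq_0: "1 \<le> n \<Longrightarrow> L (poly (\<phi> n)) = 0"
  using orth_monom[of 0 n] by simp

text \<open>As x/(x - z) = 1 + z/(x - z), the two forms differ by twice
  \<open>L (poly (\<phi> n))\<close>. This is nonzero for \<open>n = 0\<close>, so a hypothesis that
  expresses \<open>\<xi> n\<close> by this kernel has to start at 1.\<close>

lemma cauchy_phi_altdef:
  assumes "norm z \<noteq> 1" "1 \<le> n"
  shows "cauchy_phi n z = 2 * z * L (\<lambda>x. poly (\<phi> n) x * (1 / (x - z)))"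
proof -
  have "L (\<lambda>x. poly (\<phi> n) x * (x / (x - z))) =
      L (\<lambda>x. 1 * poly (\<phi> n) x + z * (poly (\<phi> n) x * (1 / (x - z))))"
    using assms by (intro L_cong) (auto simp: divide_simps algebra_simps)
  also have "\<dots> = z * L (\<lambda>x. poly (\<phi> n) x * (1 / (x - z)))"
    using assms L_phi_eq_0 by (subst L_lincomb) (auto intro!: continuous_intros)
  finally show ?thesis by (simp add: cauchy_phi_def)
qed

lemma resolvent_shift:
  assumes "norm z \<noteq> 1" "continuous_on (sphere 0 1) f"
  shows "L (\<lambda>x. f x * (1 / x ^ k) * (1 / (x - z))) =
    L (\<lambda>x. f x * (1 / x ^ Suc k)) + z * L (\<lambda>x. f x * (1 / x ^ Suc k) * (1 / (x - z)))"
proof -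
  have "L (\<lambda>x. f x * (1 / x ^ k) * (1 / (x - z))) =
    L (\<lambda>x. 1 * (f x * (1 / x ^ Suc k)) + z * (f x * (1 / x ^ Suc k) * (1 / (x - z))))"
  proof (rule L_cong)
    fix x :: complex assume "x \<in> sphere 0 1"
    then have "x \<noteq> 0" "x - z \<noteq> 0" using assms by auto
    then have "1 / x ^ k * (1 / (x - z)) = 1 / x ^ Suc k + z * (1 / x ^ Suc k * (1 / (x - z)))"
      by (simp add: divide_simps)
    then show "f x * (1 / x ^ k) * (1 / (x - z)) =
        1 * (f x * (1 / x ^ Suc k)) + z * (f x * (1 / x ^ Suc k) * (1 / (x - z)))"
      by (metis (no_types, opaque_lifting) distrib_left mult.assoc mult.left_commute mult_1)
  qed
  also have "\<dots> = L (\<lambda>x. f x * (1 / x ^ Suc k)) + z * L (\<lambda>x. f x * (1 / x ^ Suc k) * (1 / (x - z)))"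
    using assms by (subst L_lincomb) (auto intro!: continuous_intros simp del: power_Suc)
  finally show ?thesis .
qed

text \<open>Each step of \<open>resolvent_shift\<close> produces one term with a pure power of
  \<open>1 / x\<close>, which orthogonality of the reversed polynomial kills. The case
  \<open>k = n\<close> absorbs the factor \<open>z ^ n\<close> of \<open>xi_star\<close>; the case
  \<open>k = 1\<close> is used in the shift by -1.\<close>

lemma resolvent_star:
  assumes "norm z \<noteq> 1" "k \<le> n"
  shows "L (\<lambda>x. poly (star n) x * (1 / (x - z))) =
    z ^ k * L (\<lambda>x. poly (star n) x * (1 / x ^ k) * (1 / (x - z)))"
  using assms(2)
proof (induction k)
  case (Suc k)
  then show ?case
    using resolvent_shift[OF assms(1), of "poly (star n)" k] orth_star[of "Suc k" n]
    by (simp add: continuous_intros mult.assoc mult.left_commute)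
qed simp

end

locale christoffel_step =
  S: biorthogonal L \<phi> \<psi> \<kappa> + S': biorthogonal L' \<phi>' \<psi>' \<kappa>'
  for L \<phi> \<psi> \<kappa> L' \<phi>' \<psi>' \<kappa>' +
  fixes a :: complex
  assumes a_nonzero: "a \<noteq> 0"
    and L'_eq: "continuous_on (sphere 0 1) f \<Longrightarrow> L' f = L (\<lambda>x. (x - a) * f x)"
begin

lemma L'_poly: "L' (\<lambda>x. poly p x * (1 / x ^ k)) = L (\<lambda>x. poly ([:- a, 1:] * p) x * (1 / x ^ k))"
  by (subst L'_eq) (auto intro!: continuous_intros S.L_cong simp: algebra_simps diff_divide_distrib)

text \<open>Christoffel's formula: \<open>(z - a) * \<phi>' n\<close> is a combination of
  \<open>\<phi> (Suc n)\<close> and \<open>\<phi> n\<close>, with the ratio forced by the zero at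
  \<open>a\<close>. The Szego recurrence then replaces \<open>\<phi> (Suc n)\<close>, which brings
  in the reversed polynomial and the entry with \<phi>_{n+1}(0).\<close>

lemma up_phi:
  assumes "poly (\<phi> n) a \<noteq> 0"
  shows "(z - a) * poly (\<phi>' n) z = \<kappa>' n / \<kappa> n *
    ((z - \<kappa> n * poly (\<phi> (Suc n)) a / (\<kappa> (Suc n) * poly (\<phi> n) a)) * poly (\<phi> n) z
      + poly (\<phi> (Suc n)) 0 / \<kappa> (Suc n) * poly (S.star n) z)"
proof -
  define A where "A = \<kappa>' n / \<kappa> (Suc n)"
  define p where "p = [:- a, 1:] * \<phi>' n - Polynomial.smult A (\<phi> (Suc n))"
  have "degree p \<le> n"
  proof (rule degree_le, intro allI impI)
    fix i assume "n < i"
    then show "coeff p i = 0"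
      by (cases "i = Suc n") (auto simp: p_def A_def S.lead_phi S'.lead_phi coeff_eq_0 S.degree_phi
          S'.degree_phi S.kappa_nonzero coeff_pCons split: nat.splits)
  qed
  moreover have "L (\<lambda>x. poly p x * (1 / x ^ k)) = 0" if "k < n" for k
  proof -
    have "L (\<lambda>x. poly p x * (1 / x ^ k)) =
        L (\<lambda>x. 1 * (poly ([:- a, 1:] * \<phi>' n) x * (1 / x ^ k))
            + (- A) * (poly (\<phi> (Suc n)) x * (1 / x ^ k)))"
      by (intro S.L_cong) (simp add: p_def algebra_simps)
    also have "\<dots> = 0"
      using that S'.orth_monom[of k n] S.orth_monom[of k "Suc n"] L'_poly[of "\<phi>' n" k]
      by (subst S.L_lincomb) (auto intro!: continuous_intros)
    finally show ?thesis .
  qed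
  ultimately obtain c where c: "p = Polynomial.smult c (\<phi> n)"
    using S.unique_phi by blast
  have "c = - A * poly (\<phi> (Suc n)) a / poly (\<phi> n) a"
    using arg_cong[OF c, of "\<lambda>p. poly p a"] assms by (simp add: p_def field_simps)
  then have 1: "(z - a) * poly (\<phi>' n) z =
      A * poly (\<phi> (Suc n)) z - A * poly (\<phi> (Suc n)) a / poly (\<phi> n) a * poly (\<phi> n) z"
    using arg_cong[OF c, of "\<lambda>p. poly p z"] by (simp add: p_def algebra_simps)
  have 2: "poly (\<phi> (Suc n)) z =
      (\<kappa> (Suc n) * (z * poly (\<phi> n) z) + poly (\<phi> (Suc n)) 0 * poly (S.star n) z) / \<kappa> n"
    using arg_cong[OF S.szego[of n], of "\<lambda>p. poly p z"] S.kappa_nonzero[of n]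
        by (simp add: field_simps)
  show ?thesis
    unfolding 1 2
    using S.kappa_nonzero[of n] S.kappa_nonzero[of "Suc n"] assms
    by (simp add: A_def field_simps)
qed

text \<open>Both \<open>(x - a) * S'.star n\<close> and \<open>x * \<phi> n\<close> are orthogonal
  to the powers 1 to \<open>n\<close>; a difference without term of degree \<open>n + 1\<close> is a
  multiple of \<open>S.star n\<close>. The factor \<open>e\<close> first contains the unknown
  \<open>\<psi>' n\<close> at 0, and the zero at \<open>a\<close> expresses it by the original
  system.\<close>

lemma up_star:
  assumes "poly (\<phi> n) a \<noteq> 0"
  shows "(z - a) * poly (S'.star n) z = \<kappa>' n / \<kappa> n *
    (poly (S.star n) a / poly (\<phi> n) a * z * poly (\<phi> n) z - a * poly (S.star n) z)"
proof -
  define e where "e = poly (\<psi>' n) 0 / \<kappa> n"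
  define p where "p = [:- a, 1:] * S'.star n - Polynomial.smult e (pCons 0 (\<phi> n))"
  have "degree p \<le> n"
  proof (rule degree_le, intro allI impI)
    fix i assume "n < i"
    then show "coeff p i = 0"
      using S'.degree_star[of n]
      by (cases "i = Suc n") (auto simp: p_def e_def S.lead_phi S'.coeff_star coeff_eq_0
          S.degree_phi
           S.kappa_nonzero coeff_pCons split: nat.splits)
  qed
  moreover have "L (\<lambda>x. poly p x * (1 / x ^ k)) = 0" if "1 \<le> k" "k \<le> n" for k
  proof -
    have "L (\<lambda>x. poly p x * (1 / x ^ k)) =
        L (\<lambda>x. 1 * (poly ([:- a, 1:] * S'.star n) x * (1 / x ^ k))
            + (- e) * (poly (\<phi> n) x * (1 / x ^ (k - 1))))"
    proof (intro S.L_cong)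
      fix x :: complex assume "x \<in> sphere 0 1"
      then have *: "x * (1 / x ^ k) = 1 / x ^ (k - 1)"
        using that sphere_nonzero by (cases k) auto
      show "poly p x * (1 / x ^ k) =
          1 * (poly ([:- a, 1:] * S'.star n) x * (1 / x ^ k))
              + (- e) * (poly (\<phi> n) x * (1 / x ^ (k - 1)))"
        by (simp add: p_def *[symmetric] algebra_simps diff_divide_distrib del: One_nat_def)
    qed
    also have "\<dots> = 0"
      using that S'.orth_star[of k n] S.orth_monom[of "k - 1" n] L'_poly[of "S'.star n" k]
      by (subst S.L_lincomb) (auto intro!: continuous_intros)
    finally show ?thesis .
  qed
  ultimately have c: "p = Polynomial.smult (poly p 0 / \<kappa> n) (S.star n)"
    by (rule S.unique_star)
  have p0: "poly p 0 = - a * \<kappa>' n"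
    by (simp add: p_def S'.lead_psi S'.degree_psi)
  have "e * poly (\<phi> n) a = \<kappa>' n / \<kappa> n * poly (S.star n) a"
    using arg_cong[OF c, of "\<lambda>p. poly p a"] a_nonzero S.kappa_nonzero[of n]
    by (simp add: p0, simp add: p_def field_simps)
  then have e: "e = \<kappa>' n / \<kappa> n * poly (S.star n) a / poly (\<phi> n) a"
    using assms by (metis nonzero_mult_div_cancel_right)
  have "poly p z = - a * \<kappa>' n / \<kappa> n * poly (S.star n) z"
    using arg_cong[OF c, of "\<lambda>p. poly p z"] by (simp only: p0 poly_smult)
  then show ?thesis
    by (simp add: p_def e algebra_simps diff_divide_distrib)
qed

text \<open>In \<open>up_phi\<close> under the integral, split x - c = (x - z) + (z - c) and x = (x
  - z) + z. The part freed from the kernel is x \<phi>_n + d \<open>phi*_n\<close>, by the Szego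
  recurrence a multiple of \<phi>_{n+1}, and its mean is 0.\<close>

lemma up_cauchy_phi:
  assumes "poly (\<phi> n) a \<noteq> 0" "norm z \<noteq> 1"
  shows "S'.cauchy_phi n z = \<kappa>' n / \<kappa> n *
    ((z - \<kappa> n * poly (\<phi> (Suc n)) a / (\<kappa> (Suc n) * poly (\<phi> n) a)) * S.cauchy_phi n z
      - poly (\<phi> (Suc n)) 0 / \<kappa> (Suc n) * S.cauchy_star n z)"
proof -
  define c where "c = \<kappa> n * poly (\<phi> (Suc n)) a / (\<kappa> (Suc n) * poly (\<phi> n) a)"
  define d where "d = poly (\<phi> (Suc n)) 0 / \<kappa> (Suc n)"
  have "\<kappa> n * poly (\<phi> (Suc n)) x = \<kappa> (Suc n) * (x * poly (\<phi> n) x + d * poly (S.star n) x)" for x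
    using arg_cong[OF S.szego[of n], of "\<lambda>p. poly p x"] S.kappa_nonzero[of "Suc n"]
    by (simp add: d_def field_simps)
  then have sz: "x * poly (\<phi> n) x + d * poly (S.star n) x = \<kappa> n / \<kappa> (Suc n) * poly (\<phi> (Suc n)) x"
      for x
    using S.kappa_nonzero[of "Suc n"] by (simp add: field_simps)
  have "S'.cauchy_phi n z = 2 * L (\<lambda>x. (x - a) * (poly (\<phi>' n) x * (x / (x - z))))"
    unfolding S'.cauchy_phi_def using assms by (subst L'_eq) (auto intro!: continuous_intros)
  also have "L (\<lambda>x. (x - a) * (poly (\<phi>' n) x * (x / (x - z)))) =
    L (\<lambda>x. (\<kappa>' n / \<kappa> n * (\<kappa> n / \<kappa> (Suc n))) * poly (\<phi> (Suc n)) x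
       + (\<kappa>' n / \<kappa> n * (z - c)) * (poly (\<phi> n) x * (x / (x - z)))
       + (\<kappa>' n / \<kappa> n * (d * z)) * (poly (S.star n) x * (1 / (x - z))))"
  proof (rule S.L_cong)
    fix x :: complex assume "x \<in> sphere 0 1"
    then have nz: "x - z \<noteq> 0" using assms by auto
    have "(x - a) * (poly (\<phi>' n) x * (x / (x - z))) =
        \<kappa>' n / \<kappa> n * (((x - c) * poly (\<phi> n) x + d * poly (S.star n) x) * (x / (x - z)))"
      using up_phi[OF assms(1), of x, folded c_def d_def] by (simp only: mult.assoc[symmetric])
    also have "((x - c) * poly (\<phi> n) x + d * poly (S.star n) x) * (x / (x - z)) =
      x * poly (\<phi> n) x + d * poly (S.star n) x + (z - c) * (poly (\<phi> n) x * (x / (x - z)))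
       + d * z * (poly (S.star n) x * (1 / (x - z)))"
      using nz by (simp add: divide_simps) (simp add: algebra_simps)
    finally show "(x - a) * (poly (\<phi>' n) x * (x / (x - z))) =
      (\<kappa>' n / \<kappa> n * (\<kappa> n / \<kappa> (Suc n))) * poly (\<phi> (Suc n)) x
       + (\<kappa>' n / \<kappa> n * (z - c)) * (poly (\<phi> n) x * (x / (x - z)))
       + (\<kappa>' n / \<kappa> n * (d * z)) * (poly (S.star n) x * (1 / (x - z)))"
      unfolding sz by (simp only: distrib_left mult.assoc)
  qed
  also have "\<dots> = (\<kappa>' n / \<kappa> n * (\<kappa> n / \<kappa> (Suc n))) * L (poly (\<phi> (Suc n)))
       + (\<kappa>' n / \<kappa> n * (z - c)) * L (\<lambda>x. poly (\<phi> n) x * (x / (x - z)))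
       + (\<kappa>' n / \<kappa> n * (d * z)) * L (\<lambda>x. poly (S.star n) x * (1 / (x - z)))"
    using assms(2) by (subst S.L_lincomb3) (auto intro!: continuous_intros)
  finally show ?thesis
    unfolding S.cauchy_phi_def S.cauchy_star_def c_def[symmetric] d_def[symmetric]
    using S.L_phi_eq_0[of "Suc n"] by (simp add: algebra_simps diff_divide_distrib)
qed

lemma up_cauchy_star:
  assumes "poly (\<phi> n) a \<noteq> 0" "norm z \<noteq> 1"
  shows "- S'.cauchy_star n z = \<kappa>' n / \<kappa> n *
    (poly (S.star n) a / poly (\<phi> n) a * z * S.cauchy_phi n z + a * S.cauchy_star n z)"
proof -
  define e where "e = poly (S.star n) a / poly (\<phi> n) a"
  have "- S'.cauchy_star n z = 2 * z * L (\<lambda>x. (x - a) * (poly (S'.star n) x * (1 / (x - z))))"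
    unfolding S'.cauchy_star_def using assms by (subst L'_eq) (auto intro!: continuous_intros)
  also have "L (\<lambda>x. (x - a) * (poly (S'.star n) x * (1 / (x - z)))) =
    L (\<lambda>x. (\<kappa>' n / \<kappa> n * e) * (poly (\<phi> n) x * (x / (x - z)))
        + (- \<kappa>' n / \<kappa> n * a) * (poly (S.star n) x * (1 / (x - z))))"
  proof (rule S.L_cong)
    fix x :: complex
    have "(x - a) * (poly (S'.star n) x * (1 / (x - z))) =
        (\<kappa>' n / \<kappa> n * (e * x * poly (\<phi> n) x - a * poly (S.star n) x)) * (1 / (x - z))"
      using up_star[OF assms(1), of x, folded e_def] by (simp add: mult.assoc[symmetric])
    then show "(x - a) * (poly (S'.star n) x * (1 / (x - z))) =
      (\<kappa>' n / \<kappa> n * e) * (poly (\<phi> n) x * (x / (x - z)))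
          + (- \<kappa>' n / \<kappa> n * a) * (poly (S.star n) x * (1 / (x - z)))"
      by (simp add: algebra_simps)
  qed
  also have "\<dots> = (\<kappa>' n / \<kappa> n * e) * L (\<lambda>x. poly (\<phi> n) x * (x / (x - z)))
      + (- \<kappa>' n / \<kappa> n * a) * L (\<lambda>x. poly (S.star n) x * (1 / (x - z)))"
    using assms(2) by (subst S.L_lincomb) (auto intro!: continuous_intros)
  finally show ?thesis
    by (simp add: S.cauchy_phi_def S.cauchy_star_def e_def algebra_simps)
qed

text \<open>
  From here on \<open>L'\<close> is the given functional and \<open>L\<close> the one divided by \<open>x - a\<close>. The numbers
  \<open>\<xi> n\<close>, \<open>\<xi>s n\<close> below are \<open>\<xi>\<^sub>n(a)\<close>, \<open>\<xi>\<^sup>*\<^sub>n(a)\<close>; expressed by \<open>L\<close> they make sense on the circle too.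
\<close>

lemma L_shift:
  assumes "L' (\<lambda>x. poly p x * (1 / x ^ Suc k)) = 0"
  shows "L (\<lambda>x. poly p x * (1 / x ^ k)) = a * L (\<lambda>x. poly p x * (1 / x ^ Suc k))"
proof -
  have "L' (\<lambda>x. poly p x * (1 / x ^ Suc k)) =
      L (\<lambda>x. 1 * (poly p x * (1 / x ^ k)) + (- a) * (poly p x * (1 / x ^ Suc k)))"
    unfolding L'_poly by (intro S.L_cong)
        (auto dest!: sphere_nonzero simp: field_simps diff_divide_distrib)
  also have "\<dots> = L (\<lambda>x. poly p x * (1 / x ^ k)) - a * L (\<lambda>x. poly p x * (1 / x ^ Suc k))"
    by (subst S.L_lincomb) (auto intro!: continuous_intros simp del: power_Suc)
  finally show ?thesis using assms by simp
qed

context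
  fixes \<xi> \<xi>s :: "nat \<Rightarrow> complex"
  assumes xi: "\<And>n. n \<ge> 1 \<Longrightarrow> \<xi> n = 2 * a * L (poly (\<phi>' n))"
    and xis: "\<And>n. \<xi>s n = - 2 * a * L (poly (S'.star n))"
    and xis_nonzero: "\<And>n. \<xi>s n \<noteq> 0"
begin

text \<open>The image of \<open>szego_inverse\<close> under \<open>L\<close>. It identifies the
  denominators in the coefficients of \<open>down_phi\<close>.\<close>

lemma xi_szego:
  assumes "1 \<le> n"
  shows "\<kappa>' (n - 1) * \<xi>s (n - 1) = \<kappa>' n * \<xi>s n + poly (\<psi>' n) 0 * \<xi> n"
proof -
  have scale: "k * (- 2 * t * X) = l * (- 2 * t * Y) + m * (2 * t * Z)"
    if "k * X = l * Y + - m * Z" for k l m t X Y Z :: complex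
  proof -
    have "k * (- 2 * t * X) = - 2 * t * (k * X)" by simp
    then show ?thesis unfolding that by (simp add: algebra_simps)
  qed
  obtain m where m: "n = Suc m" using assms by (cases n) auto
  have "\<kappa>' m * L (poly (S'.star m)) = L (\<lambda>x. \<kappa>' m * poly (S'.star m) x)"
    by (subst S.L_scale) (auto intro!: continuous_intros)
  also have "\<dots> = L (\<lambda>x. \<kappa>' n * poly (S'.star n) x + (- poly (\<psi>' n) 0) * poly (\<phi>' n) x)"
  proof (rule S.L_cong)
    show "\<kappa>' m * poly (S'.star m) x = \<kappa>' n * poly (S'.star n) x
        + (- poly (\<psi>' n) 0) * poly (\<phi>' n) x" for x
      using arg_cong[OF S'.szego_inverse[of m], of "\<lambda>p. poly p x"] by (simp add: m)
  qed
  also have "\<dots> = \<kappa>' n * L (poly (S'.star n)) + (- poly (\<psi>' n) 0) * L (poly (\<phi>' n))"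
    by (subst S.L_lincomb) (auto intro!: continuous_intros)
  finally show ?thesis
    unfolding xi[OF assms, unfolded m] xis m diff_Suc_1 by (rule scale)
qed

text \<open>Every combination of \<open>\<phi>' n\<close> and \<open>S'.star n\<close> is
  \<open>L'\<close>-orthogonal to the powers 1 to \<open>n - 1\<close>. Taking the coefficients
  proportional to \<open>\<xi>s n\<close> and \<open>\<xi> n\<close> adds \<open>L p = 0\<close>,
  whence \<open>L_shift\<close> gives all \<open>n\<close> relations for \<open>L\<close>. The
  common denominator makes the leading coefficient equal to \<open>\<kappa>' n\<close>, by
  \<open>xi_szego\<close>.\<close>

lemma down_phi:
  assumes "1 \<le> n"
  shows "poly (\<phi> n) z = \<kappa> n / \<kappa>' n *
    (\<kappa>' n * \<xi>s n / (\<kappa>' (n - 1) * \<xi>s (n - 1)) * poly (\<phi>' n) z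
     + \<kappa>' n * \<xi> n / (\<kappa>' (n - 1) * \<xi>s (n - 1)) * poly (S'.star n) z)"
proof -
  define A where "A = \<kappa>' n * \<xi>s n / (\<kappa>' (n - 1) * \<xi>s (n - 1))"
  define B where "B = \<kappa>' n * \<xi> n / (\<kappa>' (n - 1) * \<xi>s (n - 1))"
  define p where "p = Polynomial.smult A (\<phi>' n) + Polynomial.smult B (S'.star n)"
  have "L' (\<lambda>x. poly p x * (1 / x ^ Suc k)) = 0" if "Suc k < n" for k
  proof -
    have "L' (\<lambda>x. poly p x * (1 / x ^ Suc k)) =
        L' (\<lambda>x. A * (poly (\<phi>' n) x * (1 / x ^ Suc k)) + B * (poly (S'.star n) x * (1 / x ^ Suc k)))"
      by (intro S'.L_cong) (simp add: p_def algebra_simps)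
    also have "\<dots> = 0"
      using that S'.orth_monom[of "Suc k" n] S'.orth_star[of "Suc k" n]
      by (subst S'.L_lincomb) (auto intro!: continuous_intros simp del: power_Suc)
    finally show ?thesis .
  qed
  moreover have "L (poly p) = 0"
  proof -
    have "L (poly p) = L (\<lambda>x. A * poly (\<phi>' n) x + B * poly (S'.star n) x)"
      by (intro S.L_cong) (simp add: p_def)
    also have "\<dots> = A * L (poly (\<phi>' n)) + B * L (poly (S'.star n))"
      by (subst S.L_lincomb) (auto intro!: continuous_intros)
    finally have "2 * a * L (poly p) = A * \<xi> n - B * \<xi>s n"
      using assms by (simp add: xi xis algebra_simps)
    then show ?thesis using a_nonzero by (simp add: A_def B_def)
  qed
  ultimately have "L (\<lambda>x. poly p x * (1 / x ^ k)) = 0" if "k < n" for k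
    using that
  proof (induction k)
    case (Suc k)
    then show ?case using L_shift[of p k] a_nonzero by simp
  qed simp
  moreover have "degree p \<le> n"
    unfolding p_def
    by (intro degree_add_le) (auto intro: order.trans[OF degree_smult_le] simp: S'.degree_phi
        S'.degree_star)
  ultimately have "p = Polynomial.smult (coeff p n / \<kappa> n) (\<phi> n)"
    by (intro S.unique_phi)
  moreover have "coeff p n = \<kappa>' n"
  proof -
    have "coeff p n = \<kappa>' n * (\<kappa>' n * \<xi>s n + poly (\<psi>' n) 0 * \<xi> n) / (\<kappa>' (n - 1) * \<xi>s (n - 1))"
      by (simp add: p_def S'.lead_phi S'.coeff_star A_def B_def add_divide_distrib algebra_simps)
    then show ?thesis
      unfolding xi_szego[OF assms, symmetric]
      using S'.kappa_nonzero[of "n - 1"] xis_nonzero[of "n - 1"] by simp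
  qed
  ultimately have "poly p z = \<kappa>' n / \<kappa> n * poly (\<phi> n) z"
    by (metis poly_smult)
  then show ?thesis
    unfolding A_def[symmetric] B_def[symmetric]
    using S.kappa_nonzero[of n] S'.kappa_nonzero[of n]
    by (simp add: p_def field_simps)
qed

text \<open>Here the extra relation must sit at exponent 1, because \<open>L\<close> does not
  annihilate the reversed polynomial itself. The pair \<open>S'.star n\<close> and
  \<open>x * S'.star (n - 1)\<close> is \<open>L'\<close>-orthogonal to the powers 2 to
  \<open>n\<close>, and adding a multiple of the latter leaves the constant coefficient
  \<open>\<kappa>' n\<close> untouched.\<close>

lemma down_star_aux:
  assumes "1 \<le> n"
  shows "poly (S.star n) z = \<kappa> n / \<kappa>' n *
    (poly (S'.star n) z - \<xi>s n / \<xi>s (n - 1) / a * (z * poly (S'.star (n - 1)) z))"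
proof -
  define e where "e = \<xi>s n / \<xi>s (n - 1) / a"
  define p where "p = S'.star n - Polynomial.smult e (pCons 0 (S'.star (n - 1)))"
  have p_shift: "poly p x * (1 / x ^ Suc k) =
      1 * (poly (S'.star n) x * (1 / x ^ Suc k)) + (- e) * (poly (S'.star (n - 1)) x * (1 / x ^ k))"
    if "x \<in> sphere 0 1" for x k
    using sphere_nonzero[OF that] by (simp add: p_def divide_simps)
  have "L' (\<lambda>x. poly p x * (1 / x ^ Suc k)) = 0" if "1 \<le> k" "Suc k \<le> n" for k
  proof -
    have "L' (\<lambda>x. poly p x * (1 / x ^ Suc k)) =
        L' (\<lambda>x. 1 * (poly (S'.star n) x * (1 / x ^ Suc k))
            + (- e) * (poly (S'.star (n - 1)) x * (1 / x ^ k)))"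
      using p_shift by (rule S'.L_cong)
    also have "\<dots> = 0"
      using that S'.orth_star[of "Suc k" n] S'.orth_star[of k "n - 1"]
      by (subst S'.L_lincomb) (auto intro!: continuous_intros simp del: power_Suc)
    finally show ?thesis .
  qed
  moreover have "L (\<lambda>x. poly p x * (1 / x ^ 1)) = 0"
  proof -
    have "L (\<lambda>x. poly p x * (1 / x ^ Suc 0)) =
        L (\<lambda>x. 1 * (poly (S'.star n) x * (1 / x ^ Suc 0))
            + (- e) * (poly (S'.star (n - 1)) x * (1 / x ^ 0)))"
      using p_shift by (rule S.L_cong)
    also have "\<dots> = L (\<lambda>x. poly (S'.star n) x * (1 / x ^ Suc 0)) - e * L (poly (S'.star (n - 1)))"
      by (subst S.L_lincomb) (auto intro!: continuous_intros)
    finally have "a * L (\<lambda>x. poly p x * (1 / x ^ Suc 0)) =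
        L (poly (S'.star n)) - a * e * L (poly (S'.star (n - 1)))"
      \<comment> \<open>Since \<open>L'\<close> kills \<open>S'.star n / x\<close>, its
        \<open>L\<close>-moment at exponent 1 is expressed by the one at exponent 0, which is
        \<open>\<xi>s n\<close> up to a factor. This is the origin of the division by
        \<open>a\<close> in \<open>e\<close>.\<close>
      using L_shift[of "S'.star n" 0] S'.orth_star[of 1 n] assms by (simp add: right_diff_distrib)
    then have "(- 2 * a) * (a * L (\<lambda>x. poly p x * (1 / x ^ Suc 0))) =
        (- 2 * a) * (L (poly (S'.star n)) - a * e * L (poly (S'.star (n - 1))))"
      by (simp only:)
    also have "\<dots> = \<xi>s n - a * e * \<xi>s (n - 1)"
      unfolding xis by (simp add: algebra_simps)
    also have "\<dots> = 0"
      using a_nonzero xis_nonzero[of "n - 1"] by (simp add: e_def)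
    finally show ?thesis using a_nonzero by simp
  qed
  ultimately have "L (\<lambda>x. poly p x * (1 / x ^ k)) = 0" if "1 \<le> k" "k \<le> n" for k
    using that
  proof (induction k)
    case (Suc k)
    then show ?case
      using L_shift[of p k] a_nonzero by (cases "k = 0") auto
  qed simp
  moreover have "degree p \<le> n"
  proof (rule degree_le, intro allI impI)
    fix i assume "n < i"
    then show "coeff p i = 0"
      using S'.degree_star[of n] S'.degree_star[of "n - 1"] assms
      by (auto simp: p_def coeff_eq_0 coeff_pCons split: nat.splits)
  qed
  ultimately have "p = Polynomial.smult (poly p 0 / \<kappa> n) (S.star n)"
    by (intro S.unique_star)
  moreover have "poly p 0 = \<kappa>' n"
    by (simp add: p_def S'.lead_psi S'.degree_psi)
  ultimately have "poly p z = \<kappa>' n / \<kappa> n * poly (S.star n) z"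
    by (metis poly_smult)
  then show ?thesis
    unfolding e_def[symmetric]
    using S.kappa_nonzero[of n] S'.kappa_nonzero[of n]
    by (simp add: p_def field_simps)
qed

text \<open>From (x - a)/(x - z) = 1 + (z - a)/(x - z). The resulting factor \<open>z - a\<close> is
  the one by which the two weights differ in the second column of Y_n.\<close>

lemma L'_resolvent:
  assumes "norm z \<noteq> 1" "continuous_on (sphere 0 1) f" "L f = 0"
  shows "(z - a) * L (\<lambda>x. f x * (1 / (x - z))) = L' (\<lambda>x. f x * (1 / (x - z)))"
proof -
  have "L' (\<lambda>x. f x * (1 / (x - z))) = L (\<lambda>x. 1 * f x + (z - a) * (f x * (1 / (x - z))))"
  proof (subst L'_eq)
    show "continuous_on (sphere 0 1) (\<lambda>x. f x * (1 / (x - z)))"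
      using assms by (auto intro!: continuous_intros)
    show "L (\<lambda>x. (x - a) * (f x * (1 / (x - z)))) =
        L (\<lambda>x. 1 * f x + (z - a) * (f x * (1 / (x - z))))"
    proof (rule S.L_cong)
      fix x :: complex assume "x \<in> sphere 0 1"
      then have "x - z \<noteq> 0" using assms by auto
      then show "(x - a) * (f x * (1 / (x - z))) = 1 * f x + (z - a) * (f x * (1 / (x - z)))"
        by (simp add: divide_simps) (simp add: algebra_simps)
    qed
  qed
  also have "\<dots> = (z - a) * L (\<lambda>x. f x * (1 / (x - z)))"
    using assms by (subst S.L_lincomb) (auto intro!: continuous_intros)
  finally show ?thesis by simp
qed

lemma down_cauchy_phi:
  assumes "1 \<le> n" "norm z \<noteq> 1"
  shows "(z - a) * S.cauchy_phi n z = \<kappa> n / \<kappa>' n *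
    (\<kappa>' n * \<xi>s n / (\<kappa>' (n - 1) * \<xi>s (n - 1)) * S'.cauchy_phi n z
     - \<kappa>' n * \<xi> n / (\<kappa>' (n - 1) * \<xi>s (n - 1)) * S'.cauchy_star n z)"
proof -
  have scale: "k * (2 * z * X) = r * (A * (2 * z * Y) - B * (- 2 * z * Z))"
    if "k * X = r * A * Y + r * B * Z" for k r A B X Y Z :: complex
  proof -
    have "k * (2 * z * X) = 2 * z * (k * X)" by simp
    then show ?thesis unfolding that by (simp add: algebra_simps)
  qed
  define r where "r = \<kappa> n / \<kappa>' n"
  define A where "A = \<kappa>' n * \<xi>s n / (\<kappa>' (n - 1) * \<xi>s (n - 1))"
  define B where "B = \<kappa>' n * \<xi> n / (\<kappa>' (n - 1) * \<xi>s (n - 1))"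
  have "(z - a) * L (\<lambda>x. poly (\<phi> n) x * (1 / (x - z))) = L' (\<lambda>x. poly (\<phi> n) x * (1 / (x - z)))"
    using assms S.L_phi_eq_0 by (intro L'_resolvent) (auto intro!: continuous_intros)
  also have "\<dots> = L' (\<lambda>x. (r * A) * (poly (\<phi>' n) x * (1 / (x - z)))
      + (r * B) * (poly (S'.star n) x * (1 / (x - z))))"
    unfolding down_phi[OF assms(1)] A_def[symmetric] B_def[symmetric] r_def[symmetric]
    by (intro S'.L_cong) (simp add: algebra_simps add_divide_distrib)
  also have "\<dots> = (r * A) * L' (\<lambda>x. poly (\<phi>' n) x * (1 / (x - z)))
      + (r * B) * L' (\<lambda>x. poly (S'.star n) x * (1 / (x - z)))"
    using assms(2) by (subst S'.L_lincomb) (auto intro!: continuous_intros)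
  finally show ?thesis
    unfolding A_def[symmetric] B_def[symmetric] r_def[symmetric] S.cauchy_phi_altdef[OF assms(2,1)]
      S'.cauchy_phi_altdef[OF assms(2,1)] S'.cauchy_star_def
    by (rule scale)
qed

text \<open>The counterpart of \<open>xi_szego\<close> at a general point \<open>z\<close>, now
  under \<open>L'\<close>; it removes the index \<open>n - 1\<close> from the second column.\<close>

lemma cauchy_star_szego:
  assumes "1 \<le> n" "norm z \<noteq> 1"
  shows "\<kappa>' (n - 1) * S'.cauchy_star (n - 1) z =
      \<kappa>' n * S'.cauchy_star n z + poly (\<psi>' n) 0 * S'.cauchy_phi n z"
proof -
  have scale: "k * (- 2 * t * X) = l * (- 2 * t * Y) + m * (2 * t * Z)"
    if "k * X = l * Y + - m * Z" for k l m t X Y Z :: complex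
  proof -
    have "k * (- 2 * t * X) = - 2 * t * (k * X)" by simp
    then show ?thesis unfolding that by (simp add: algebra_simps)
  qed
  obtain m where m: "n = Suc m" using assms by (cases n) auto
  have "\<kappa>' m * L' (\<lambda>x. poly (S'.star m) x * (1 / (x - z))) =
      L' (\<lambda>x. \<kappa>' m * (poly (S'.star m) x * (1 / (x - z))))"
    using assms(2) by (subst S'.L_scale) (auto intro!: continuous_intros)
  also have "\<dots> = L' (\<lambda>x. \<kappa>' n * (poly (S'.star n) x * (1 / (x - z)))
      + (- poly (\<psi>' n) 0) * (poly (\<phi>' n) x * (1 / (x - z))))"
  proof (rule S'.L_cong)
    fix x
    have "\<kappa>' m * poly (S'.star m) x = \<kappa>' n * poly (S'.star n) x + (- poly (\<psi>' n) 0) * poly (\<phi>' n) x"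
      using arg_cong[OF S'.szego_inverse[of m], of "\<lambda>p. poly p x"] by (simp add: m)
    then show "\<kappa>' m * (poly (S'.star m) x * (1 / (x - z))) =
      \<kappa>' n * (poly (S'.star n) x * (1 / (x - z)))
          + (- poly (\<psi>' n) 0) * (poly (\<phi>' n) x * (1 / (x - z)))"
      by (metis distrib_right mult.assoc)
  qed
  also have "\<dots> = \<kappa>' n * L' (\<lambda>x. poly (S'.star n) x * (1 / (x - z)))
      + (- poly (\<psi>' n) 0) * L' (\<lambda>x. poly (\<phi>' n) x * (1 / (x - z)))"
    using assms(2) by (subst S'.L_lincomb) (auto intro!: continuous_intros)
  finally show ?thesis
    unfolding S'.cauchy_phi_altdef[OF assms(2,1), unfolded m] S'.cauchy_star_def m diff_Suc_1
    by (rule scale)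
qed

text \<open>\<open>szego_inverse\<close> trades \<open>S'.star (n - 1)\<close> for the two
  polynomials of index \<open>n\<close>, the only ones occurring in Y_n.\<close>

lemma down_star:
  assumes "1 \<le> n"
  shows "poly (S.star n) z = \<kappa> n / \<kappa>' n *
    (poly (\<psi>' n) 0 * \<xi>s n / (\<kappa>' (n - 1) * \<xi>s (n - 1)) * (z / a) * poly (\<phi>' n) z
     + (1 - \<kappa>' n * \<xi>s n / (\<kappa>' (n - 1) * \<xi>s (n - 1)) * (z / a)) * poly (S'.star n) z)"
proof -
  have "\<kappa>' (n - 1) * poly (S'.star (n - 1)) z =
      \<kappa>' n * poly (S'.star n) z - poly (\<psi>' n) 0 * poly (\<phi>' n) z"
    using arg_cong[OF S'.szego_inverse[of "n - 1"], of "\<lambda>p. poly p z"] assms by simp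
  then have *: "poly (S'.star (n - 1)) z =
      (\<kappa>' n * poly (S'.star n) z - poly (\<psi>' n) 0 * poly (\<phi>' n) z) / \<kappa>' (n - 1)"
    using S'.kappa_nonzero[of "n - 1"] by (simp add: field_simps)
  show ?thesis
    unfolding down_star_aux[OF assms] *
    using S'.kappa_nonzero[of "n - 1"] xis_nonzero[of "n - 1"] a_nonzero
    by (simp add: field_simps)
qed

text \<open>
  As \<open>L\<close> does not annihilate \<open>\<phi>\<^sup>*\<^sub>n\<close> but \<open>\<phi>\<^sup>*\<^sub>n / x\<close>, both Cauchy transforms are first rewritten
  in terms of the latter.
\<close>

lemma down_cauchy_star:
  assumes "1 \<le> n" "norm z \<noteq> 1"
  shows "- (z - a) * S.cauchy_star n z = \<kappa> n / \<kappa>' n *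
    (poly (\<psi>' n) 0 * \<xi>s n / (\<kappa>' (n - 1) * \<xi>s (n - 1)) * (z / a) * S'.cauchy_phi n z
     - (1 - \<kappa>' n * \<xi>s n / (\<kappa>' (n - 1) * \<xi>s (n - 1)) * (z / a)) * S'.cauchy_star n z)"
proof -
  have scale: "- (z - a) * (- 2 * z * P) = r * (e * z * (- 2 * z * Y) - - 2 * z * Q)"
    if "(z - a) * X = r * Z + - r * e * Y" "P = z * X" "Q = z * Z" for r e P Q X Y Z :: complex
  proof -
    have "- (z - a) * (- 2 * z * P) = 2 * z * z * ((z - a) * X)"
      unfolding that(2) by (simp add: algebra_simps)
    then show ?thesis
      unfolding that(1,3) by (simp add: algebra_simps)
  qed
  define r where "r = \<kappa> n / \<kappa>' n"
  define e where "e = \<xi>s n / \<xi>s (n - 1) / a"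
  have "(z - a) * L (\<lambda>x. poly (S.star n) x * (1 / x) * (1 / (x - z))) =
      L' (\<lambda>x. poly (S.star n) x * (1 / x) * (1 / (x - z)))"
    using assms S.orth_star[of 1 n] continuous_on_circle_monomials[of 1]
    by (intro L'_resolvent) (auto intro!: continuous_intros)
  also have "\<dots> = L' (\<lambda>x. r * (poly (S'.star n) x * (1 / x) * (1 / (x - z)))
      + (- r * e) * (poly (S'.star (n - 1)) x * (1 / (x - z))))"
  proof (rule S'.L_cong)
    fix x :: complex assume "x \<in> sphere 0 1"
    then have "x \<noteq> 0" by (rule sphere_nonzero)
    then have "poly (S.star n) x * (1 / x) = r *
        (poly (S'.star n) x * (1 / x) - e * poly (S'.star (n - 1)) x)"
      unfolding down_star_aux[OF assms(1)] e_def[symmetric] r_def[symmetric]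
          by (simp add: field_simps)
    then show "poly (S.star n) x * (1 / x) * (1 / (x - z)) =
        r * (poly (S'.star n) x * (1 / x) * (1 / (x - z)))
      + (- r * e) * (poly (S'.star (n - 1)) x * (1 / (x - z)))"
      by (simp only:) (simp add: algebra_simps)
  qed
  also have "\<dots> = r * L' (\<lambda>x. poly (S'.star n) x * (1 / x) * (1 / (x - z)))
      + (- r * e) * L' (\<lambda>x. poly (S'.star (n - 1)) x * (1 / (x - z)))"
    using assms(2) continuous_on_circle_monomials[of 1]
    by (subst S'.L_lincomb) (auto intro!: continuous_intros)
  finally have "- (z - a) * S.cauchy_star n z =
      r * (e * z * S'.cauchy_star (n - 1) z - S'.cauchy_star n z)"
    unfolding S.cauchy_star_def S'.cauchy_star_def
    using S.resolvent_star[OF assms(2,1)] S'.resolvent_star[OF assms(2,1)]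
    unfolding power_one_right by (rule scale)
  moreover have "S'.cauchy_star (n - 1) z =
      (\<kappa>' n * S'.cauchy_star n z + poly (\<psi>' n) 0 * S'.cauchy_phi n z) / \<kappa>' (n - 1)"
    using cauchy_star_szego[OF assms] S'.kappa_nonzero[of "n - 1"] by (simp add: field_simps)
  ultimately show ?thesis
    using S'.kappa_nonzero[of "n - 1"] xis_nonzero[of "n - 1"] a_nonzero
    by (simp add: e_def r_def field_simps)
qed

end

end

text \<open>With q = c + x p one has q/(x - z) = c/(x - z) + p + z p/(x - z), and \<open>L\<close>
  obeys the matching identity at z = a. So the boundary limit for every polynomial follows from the
  one for the constant 1.\<close>

lemma (in christoffel_step) tendsto_resolvent:
  assumes "((\<lambda>z. L' (\<lambda>x. 1 / (x - z))) \<longlongrightarrow> L (\<lambda>x. 1)) (at a within - sphere 0 1)"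
  shows "((\<lambda>z. L' (\<lambda>x. poly p x * (1 / (x - z)))) \<longlongrightarrow> L (poly p)) (at a within - sphere 0 1)"
proof (induction p)
  case 0
  show ?case by (simp add: S.L_zero S'.L_zero)
next
  case (pCons c p)
  have 1: "L (poly (pCons c p)) = c * L (\<lambda>x. 1) + L' (poly p) + a * L (poly p)"
  proof -
    have "L (poly (pCons c p)) = L (\<lambda>x. c * 1 + 1 * ((x - a) * poly p x) + a * poly p x)"
      by (intro S.L_cong) (simp add: algebra_simps)
    also have "\<dots> = c * L (\<lambda>x. 1) + 1 * L (\<lambda>x. (x - a) * poly p x) + a * L (poly p)"
      by (subst S.L_lincomb3) (auto intro!: continuous_intros)
    also have "L (\<lambda>x. (x - a) * poly p x) = L' (poly p)"
      by (subst L'_eq) (auto intro!: continuous_intros)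
    finally show ?thesis by (simp only: mult_1)
  qed
  have 2: "L' (\<lambda>x. poly (pCons c p) x * (1 / (x - z))) =
      c * L' (\<lambda>x. 1 / (x - z)) + L' (poly p) + z * L' (\<lambda>x. poly p x * (1 / (x - z)))"
          if "norm z \<noteq> 1" for z
  proof -
    have "L' (\<lambda>x. poly (pCons c p) x * (1 / (x - z))) =
        L' (\<lambda>x. c * (1 / (x - z)) + 1 * poly p x + z * (poly p x * (1 / (x - z))))"
    proof (rule S'.L_cong)
      fix x :: complex assume "x \<in> sphere 0 1"
      then have "x - z \<noteq> 0" using that by auto
      then show "poly (pCons c p) x * (1 / (x - z)) =
          c * (1 / (x - z)) + 1 * poly p x + z * (poly p x * (1 / (x - z)))"
        by (simp add: divide_simps) (simp add: algebra_simps)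
    qed
    also have "\<dots> = c * L' (\<lambda>x. 1 / (x - z)) + 1 * L' (poly p)
        + z * L' (\<lambda>x. poly p x * (1 / (x - z)))"
      using that by (subst S'.L_lincomb3) (auto intro!: continuous_intros)
    finally show ?thesis by simp
  qed
  have lim: "((\<lambda>z. c * L' (\<lambda>x. 1 / (x - z)) + L' (poly p) + z * L' (\<lambda>x. poly p x * (1 / (x - z)))) \<longlongrightarrow>
      c * L (\<lambda>x. 1) + L' (poly p) + a * L (poly p)) (at a within - sphere 0 1)"
    by (intro tendsto_intros assms pCons.IH)
  show ?case
    unfolding 1
  proof (rule Lim_transform_eventually[OF lim])
    show "\<forall>\<^sub>F z in at a within - sphere 0 1. c * L' (\<lambda>x. 1 / (x - z)) + L' (poly p)
        + z * L' (\<lambda>x. poly p x * (1 / (x - z))) = L' (\<lambda>x. poly (pCons c p) x * (1 / (x - z)))"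
      unfolding eventually_at_filter by (rule always_eventually) (intro allI impI, subst 2, auto)
  qed
qed

section \<open>Means over the unit circle\<close>

definition circle_integrable :: "(complex \<Rightarrow> complex) \<Rightarrow> bool" where
  "circle_integrable f \<longleftrightarrow> set_integrable lborel {0..2*pi} (\<lambda>\<theta>. f (cis \<theta>))"

lemma circle_mean_cong:
  assumes "\<And>x. x \<in> sphere 0 1 \<Longrightarrow> f x = g x"
  shows "circle_mean f = circle_mean g"
  using assms by (simp add: circle_mean_def)

lemma null_set_cis_eq: "{\<theta>. cis \<theta> = a} \<in> null_sets lborel"
proof (cases "\<exists>t. cis t = a")
  case True
  then obtain t where t: "cis t = a" by blast
  have "{\<theta>. cis \<theta> = a} \<subseteq> range (\<lambda>n::int. t + 2 * of_int n * pi)"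
  proof
    fix \<theta> assume "\<theta> \<in> {\<theta>. cis \<theta> = a}"
    then have "exp (\<i> * of_real \<theta>) = exp (\<i> * of_real t)"
      using t by (simp add: cis_conv_exp)
    then obtain n :: int where "\<i> * of_real \<theta> = \<i> * of_real t + of_int (2 * n) * of_real pi * \<i>"
      by (auto simp: exp_eq)
    then have "\<theta> = t + 2 * of_int n * pi"
      by (simp add: complex_eq_iff)
    then show "\<theta> \<in> range (\<lambda>n::int. t + 2 * of_int n * pi)" by blast
  qed
  then show ?thesis
    by (intro countable_imp_null_set_lborel) (auto intro: countable_subset)
qed simp

lemma AE_cis_neq: "AE \<theta> in lborel. cis \<theta> \<noteq> a"
  using null_set_cis_eq[of a] by (auto intro: AE_I' simp: null_sets_def)

text \<open>Needed because division by 0 yields 0: at a singular point on the circle,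
  \<open>w / (x - a) * (x - a)\<close> need not return \<open>w\<close>, and the value of
  \<open>w\<close> there is arbitrary. A single point of the circle corresponds to a null set of
  angles.\<close>

lemma circle_integrable_cong_except:
  assumes "circle_integrable f" "\<And>x. x \<in> sphere 0 1 \<Longrightarrow> x \<noteq> a \<Longrightarrow> f x = g x"
  shows "circle_integrable g" and "circle_mean f = circle_mean g"
proof -
  have ae: "AE \<theta> in lborel. indicat_real {0..2*pi} \<theta> *\<^sub>R f (cis \<theta>) =
      indicat_real {0..2*pi} \<theta> *\<^sub>R g (cis \<theta>)"
    using AE_cis_neq[of a] by eventually_elim (simp add: assms(2))
  have 1: "integrable lborel (\<lambda>\<theta>. indicat_real {0..2*pi} \<theta> *\<^sub>R f (cis \<theta>))"
    using assms(1) by (simp add: circle_integrable_def set_integrable_def)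
  have [measurable]: "(\<lambda>\<theta>. indicat_real {0..2*pi} \<theta> *\<^sub>R f (cis \<theta>)) \<in> borel_measurable lborel"
    using 1 by (rule borel_measurable_integrable)
  have [measurable]: "{\<theta>. cis \<theta> = a} \<in> sets borel"
    using null_set_cis_eq[of a] by (simp add: null_sets_def)
  have 2: "(\<lambda>\<theta>. indicat_real {0..2*pi} \<theta> *\<^sub>R g (cis \<theta>)) \<in> borel_measurable lborel"
  proof -
    have "(\<lambda>\<theta>. if \<theta> \<in> {\<theta>. cis \<theta> = a} then indicat_real {0..2*pi} \<theta> *\<^sub>R g a
        else indicat_real {0..2*pi} \<theta> *\<^sub>R f (cis \<theta>)) \<in> borel_measurable lborel"
      by (intro measurable_If_set) auto
    also have "(\<lambda>\<theta>. if \<theta> \<in> {\<theta>. cis \<theta> = a} then indicat_real {0..2*pi} \<theta> *\<^sub>R g a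
        else indicat_real {0..2*pi} \<theta> *\<^sub>R f (cis \<theta>)) = (\<lambda>\<theta>. indicat_real {0..2*pi} \<theta> *\<^sub>R g (cis \<theta>))"
      using assms(2) by fastforce
    finally show ?thesis .
  qed
  show "circle_integrable g"
    unfolding circle_integrable_def set_integrable_def
    by (rule integrable_cong_AE_imp[OF 1 2]) (use ae in \<open>simp only:\<close>)
  show "circle_mean f = circle_mean g"
    unfolding circle_mean_def set_lebesgue_integral_def
    using integral_cong_AE[OF borel_measurable_integrable[OF 1] 2 ae] by simp
qed

lemma circle_integrable_bounded_mult:
  assumes "circle_integrable f" "continuous_on (sphere 0 1) h"
  shows "circle_integrable (\<lambda>x. f x * h x)"
proof -
  have "compact (h ` sphere 0 1)"
    using assms(2) by (intro compact_continuous_image) auto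
  then obtain B where "\<forall>y\<in>h ` sphere 0 1. norm y \<le> B"
    using compact_imp_bounded bounded_iff by blast
  then have B: "\<And>x. x \<in> sphere 0 1 \<Longrightarrow> norm (h x) \<le> B"
    by blast
  have cont: "continuous_on UNIV (\<lambda>\<theta>. h (cis \<theta>))"
    by (intro continuous_on_compose2[OF assms(2)] continuous_intros) auto
  then have [measurable]: "(\<lambda>\<theta>. h (cis \<theta>)) \<in> borel_measurable borel"
    by (rule borel_measurable_continuous_onI)
  have 1: "integrable lborel (\<lambda>\<theta>. indicat_real {0..2*pi} \<theta> *\<^sub>R f (cis \<theta>))"
    using assms(1) by (simp add: circle_integrable_def set_integrable_def)
  have [measurable]: "(\<lambda>\<theta>. indicat_real {0..2*pi} \<theta> *\<^sub>R f (cis \<theta>)) \<in> borel_measurable lborel"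
    using 1 by (rule borel_measurable_integrable)
  have "integrable lborel (\<lambda>\<theta>. (indicat_real {0..2*pi} \<theta> *\<^sub>R f (cis \<theta>)) * h (cis \<theta>))"
  proof (rule Bochner_Integration.integrable_bound)
    show "integrable lborel (\<lambda>\<theta>. norm (indicat_real {0..2*pi} \<theta> *\<^sub>R f (cis \<theta>)) * B)"
      using 1 by (intro integrable_mult_left integrable_norm)
    show "AE \<theta> in lborel. norm (indicat_real {0..2*pi} \<theta> *\<^sub>R f (cis \<theta>) * h (cis \<theta>))
        \<le> norm (norm (indicat_real {0..2*pi} \<theta> *\<^sub>R f (cis \<theta>)) * B)"
    proof (rule AE_I2)
      fix \<theta>
      have "norm (h (cis \<theta>)) \<le> \<bar>B\<bar>" using B[of "cis \<theta>"] by simp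
      then show "norm (indicat_real {0..2*pi} \<theta> *\<^sub>R f (cis \<theta>) * h (cis \<theta>))
        \<le> norm (norm (indicat_real {0..2*pi} \<theta> *\<^sub>R f (cis \<theta>)) * B)"
        by (auto simp: norm_mult indicator_def abs_mult intro: mult_left_mono)
    qed
  qed measurable
  then show ?thesis
    by (simp add: circle_integrable_def set_integrable_def mult.assoc)
qed

lemma circle_integrable_const: "circle_integrable (\<lambda>x. c)"
  unfolding circle_integrable_def by (rule borel_integrable_atLeastAtMost')
      (intro continuous_intros)

lemma circle_integrable_continuous:
  "continuous_on (sphere 0 1) h \<Longrightarrow> circle_integrable h"
  using circle_integrable_bounded_mult[OF circle_integrable_const[of 1]] by simp

lemma circle_integrable_diff:
  "circle_integrable f \<Longrightarrow> circle_integrable g \<Longrightarrow> circle_integrable (\<lambda>x. f x - g x)"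
  unfolding circle_integrable_def by (rule set_integral_diff)

lemma circle_mean_add:
  "circle_integrable f \<Longrightarrow> circle_integrable g \<Longrightarrow>
      circle_mean (\<lambda>x. f x + g x) = circle_mean f + circle_mean g"
  unfolding circle_integrable_def circle_mean_def by (simp add: set_integral_add add_divide_distrib)

lemma circle_mean_diff:
  "circle_integrable f \<Longrightarrow> circle_integrable g \<Longrightarrow>
      circle_mean (\<lambda>x. f x - g x) = circle_mean f - circle_mean g"
  unfolding circle_integrable_def circle_mean_def
      by (simp add: set_integral_diff diff_divide_distrib)

lemma circle_mean_mult: "circle_mean (\<lambda>x. c * f x) = c * circle_mean f"
  unfolding circle_mean_def by simp

lemma norm_circle_mean_le:
  assumes "circle_integrable f" "circle_integrable g" "\<And>x. x \<in> sphere 0 1 \<Longrightarrow>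
      norm (f x) \<le> B * norm (g x)"
  shows "norm (circle_mean f) \<le> B * Re (circle_mean (\<lambda>x. of_real (norm (g x))))"
proof -
  have 1: "integrable lborel (\<lambda>\<theta>. indicat_real {0..2*pi} \<theta> *\<^sub>R f (cis \<theta>))"
    and 2: "integrable lborel (\<lambda>\<theta>. indicat_real {0..2*pi} \<theta> *\<^sub>R g (cis \<theta>))"
    using assms(1,2) by (simp_all add: circle_integrable_def set_integrable_def)
  have "norm (LINT \<theta>:{0..2*pi}|lborel. f (cis \<theta>)) \<le>
      (LINT \<theta>|lborel. norm (indicat_real {0..2*pi} \<theta> *\<^sub>R f (cis \<theta>)))"
    unfolding set_lebesgue_integral_def by (rule integral_norm_bound)
  also have "\<dots> \<le> (LINT \<theta>|lborel. B * norm (indicat_real {0..2*pi} \<theta> *\<^sub>R g (cis \<theta>)))"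
    using assms(3) by (intro integral_mono integrable_mult_right integrable_norm 1 2)
        (simp add: indicator_def)
  also have "\<dots> = B * (LINT \<theta>|lborel. indicat_real {0..2*pi} \<theta> *\<^sub>R norm (g (cis \<theta>)))"
    by simp
  also have "(LINT \<theta>|lborel. indicat_real {0..2*pi} \<theta> *\<^sub>R norm (g (cis \<theta>))) =
     Re (LINT \<theta>:{0..2*pi}|lborel. of_real (norm (g (cis \<theta>))))"
    unfolding set_lebesgue_integral_def
    by (subst Re_complex_of_real[symmetric], subst integral_complex_of_real[symmetric])
        (simp add: scaleR_conv_of_real)
  finally show ?thesis
    by (simp add: circle_mean_def norm_divide norm_mult Re_divide_of_real[of _ "2
        * pi", simplified] divide_right_mono)
qed

lemma integrable_affine_indicator:
  fixes F :: "real \<Rightarrow> complex"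
  assumes "integrable lborel (\<lambda>x. indicat_real A x *\<^sub>R F x)" "\<And>x. t + x \<in> A \<longleftrightarrow> x \<in> B"
  shows "integrable lborel (\<lambda>x. indicat_real B x *\<^sub>R F (t + x))"
    and "(LINT x|lborel. indicat_real B x *\<^sub>R F (t + x)) =
        (LINT x|lborel. indicat_real A x *\<^sub>R F x)"
proof -
  have *: "(\<lambda>x. indicat_real A (t + 1 * x) *\<^sub>R F (t + 1 * x)) =
      (\<lambda>x. indicat_real B x *\<^sub>R F (t + x))"
    using assms(2) by (auto simp: indicator_def)
  show "integrable lborel (\<lambda>x. indicat_real B x *\<^sub>R F (t + x))"
    using lborel_integrable_real_affine[OF assms(1), of 1 t] unfolding * by simp
  show "(LINT x|lborel. indicat_real B x *\<^sub>R F (t + x)) = (LINT x|lborel. indicat_real A x *\<^sub>R F x)"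
    using lborel_integral_real_affine[of 1 "\<lambda>x. indicat_real A x *\<^sub>R F x" t] unfolding * by simp
qed

text \<open>The interval of angles is not invariant under translation, so it is cut at
  \<open>2 * pi - \<tau>\<close> and the second piece is moved back by a full period.\<close>

lemma circle_rotate:
  assumes "circle_integrable f" "norm c = 1"
  shows "circle_integrable (\<lambda>x. f (c * x))" and "circle_mean (\<lambda>x. f (c * x)) = circle_mean f"
proof -
  define \<tau> where "\<tau> = Arg2pi c"
  have \<tau>: "0 \<le> \<tau>" "\<tau> < 2 * pi" "c = cis \<tau>"
    using Arg2pi[of c] assms(2) by (auto simp: \<tau>_def cis_conv_exp is_Arg_def)
  define F where "F = (\<lambda>\<theta>. f (cis \<theta>))"
  have F: "F (\<tau> - 2 * pi + x) = f (c * cis x)" "F (\<tau> + x) = f (c * cis x)" for x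
  proof -
    show *: "F (\<tau> + x) = f (c * cis x)" by (simp add: F_def \<tau>(3) cis_mult)
    have "cis (\<tau> - 2 * pi + x) = cis (\<tau> + x) / cis (2 * pi)"
      by (simp only: cis_divide) (simp add: algebra_simps)
    then show "F (\<tau> - 2 * pi + x) = f (c * cis x)"
      using * by (simp add: F_def)
  qed
  have int: "set_integrable lborel {0..2*pi} F"
    using assms(1) by (simp add: circle_integrable_def F_def)
  have A: "integrable lborel (\<lambda>x. indicat_real {\<tau>..2*pi} x *\<^sub>R F x)"
      "integrable lborel (\<lambda>x. indicat_real {0<..\<tau>} x *\<^sub>R F x)"
    unfolding set_integrable_def[symmetric] using \<tau> by (auto intro: set_integrable_subset[OF int])
  have B: "integrable lborel (\<lambda>x. indicat_real {0..2*pi-\<tau>} x *\<^sub>R f (c * cis x))"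
    "(LINT x|lborel. indicat_real {0..2*pi-\<tau>} x *\<^sub>R f (c * cis x)) =
        (LINT x|lborel. indicat_real {\<tau>..2*pi} x *\<^sub>R F x)"
  proof -
    have "\<tau> + x \<in> {\<tau>..2*pi} \<longleftrightarrow> x \<in> {0..2*pi-\<tau>}" for x by auto
    note * = integrable_affine_indicator[OF A(1) this, unfolded F]
    show "integrable lborel (\<lambda>x. indicat_real {0..2*pi-\<tau>} x *\<^sub>R f (c * cis x))" by (rule *)
    show "(LINT x|lborel. indicat_real {0..2*pi-\<tau>} x *\<^sub>R f (c * cis x)) =
        (LINT x|lborel. indicat_real {\<tau>..2*pi} x *\<^sub>R F x)"
      by (rule *)
  qed
  have C: "integrable lborel (\<lambda>x. indicat_real {2*pi-\<tau><..2*pi} x *\<^sub>R f (c * cis x))"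
    "(LINT x|lborel. indicat_real {2*pi-\<tau><..2*pi} x *\<^sub>R f (c * cis x)) =
        (LINT x|lborel. indicat_real {0<..\<tau>} x *\<^sub>R F x)"
  proof -
    have "\<tau> - 2 * pi + x \<in> {0<..\<tau>} \<longleftrightarrow> x \<in> {2*pi-\<tau><..2*pi}" for x by auto
    note * = integrable_affine_indicator[OF A(2) this, unfolded F]
    show "integrable lborel (\<lambda>x. indicat_real {2*pi-\<tau><..2*pi} x *\<^sub>R f (c * cis x))" by (rule *)
    show "(LINT x|lborel. indicat_real {2*pi-\<tau><..2*pi} x *\<^sub>R f (c * cis x)) =
        (LINT x|lborel. indicat_real {0<..\<tau>} x *\<^sub>R F x)"
      by (rule *)
  qed
  have eq: "indicat_real {0..2*pi} x *\<^sub>R f (c * cis x) =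
      indicat_real {0..2*pi-\<tau>} x *\<^sub>R f (c * cis x)
          + indicat_real {2*pi-\<tau><..2*pi} x *\<^sub>R f (c * cis x)" for x
    using \<tau> by (auto simp: indicator_def)
  show "circle_integrable (\<lambda>x. f (c * x))"
    unfolding circle_integrable_def set_integrable_def eq
    using B(1) C(1) by (rule Bochner_Integration.integrable_add)
  have "(LINT x|lborel. indicat_real {0..2*pi} x *\<^sub>R f (c * cis x)) =
      (LINT x|lborel. indicat_real {\<tau>..2*pi} x *\<^sub>R F x)
          + (LINT x|lborel. indicat_real {0<..\<tau>} x *\<^sub>R F x)"
    unfolding eq Bochner_Integration.integral_add[OF B(1) C(1)] B(2) C(2) ..
  also have "\<dots> = (LINT x|lborel. indicat_real {\<tau>..2*pi} x *\<^sub>R F x + indicat_real {0<..\<tau>} x *\<^sub>R F x)"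
    using Bochner_Integration.integral_add[OF A] by simp
  also have "\<dots> = (LINT x|lborel. indicat_real {0..2*pi} x *\<^sub>R F x)"
  \<comment> \<open>The translated pieces miss the angle 0 and, for \<open>\<tau> > 0\<close>, count
    \<open>\<tau>\<close> twice; both are null sets.\<close>
  proof (rule integral_cong_AE)
    show "AE x in lborel. indicat_real {\<tau>..2*pi} x *\<^sub>R F x + indicat_real {0<..\<tau>} x *\<^sub>R F x =
        indicat_real {0..2*pi} x *\<^sub>R F x"
      using AE_lborel_singleton[of 0] AE_lborel_singleton[of \<tau>]
      by eventually_elim (use \<tau> in \<open>auto simp: indicator_def\<close>)
    show "(\<lambda>x. indicat_real {\<tau>..2*pi} x *\<^sub>R F x
        + indicat_real {0<..\<tau>} x *\<^sub>R F x) \<in> borel_measurable lborel"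
      using A by (intro borel_measurable_add borel_measurable_integrable)
    show "(\<lambda>x. indicat_real {0..2*pi} x *\<^sub>R F x) \<in> borel_measurable lborel"
      using int unfolding set_integrable_def by (rule borel_measurable_integrable)
  qed
  finally show "circle_mean (\<lambda>x. f (c * x)) = circle_mean f"
    by (simp add: circle_mean_def set_lebesgue_integral_def F_def)
qed

lemma circle_integrable_inverse:
  assumes "circle_integrable f"
  shows "circle_integrable (\<lambda>x. f (1 / x))"
proof -
  have "integrable lborel (\<lambda>x. indicat_real {0..2*pi} (2 * pi
      + (- 1) * x) *\<^sub>R f (cis (2 * pi + (- 1) * x)))"
    using assms unfolding circle_integrable_def set_integrable_def
    by (intro lborel_integrable_real_affine) auto
  also have "(\<lambda>x. indicat_real {0..2*pi} (2 * pi + (- 1) * x) *\<^sub>R f (cis (2 * pi + (- 1) * x))) =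
      (\<lambda>x. indicat_real {0..2*pi} x *\<^sub>R f (1 / cis x))"
  proof -
    have "cis (2 * pi + (- 1) * x) = 1 / cis x" for x
      using cis_divide[of "2 * pi" x] by simp
    then show ?thesis by (auto simp: indicator_def)
  qed
  finally show ?thesis
    by (simp add: circle_integrable_def set_integrable_def)
qed

section \<open>Chord lengths and the mean of the Cauchy kernel\<close>

lemma norm_cis_diff_one: "norm (cis t - 1) = 2 * \<bar>sin (t / 2)\<bar>"
  using dist_exp_i_1[of t] by (simp add: cis_conv_exp)

text \<open>With s = t/2, the mean value theorem gives sin s >= s cos s, and (cos s)^2 >= 1/2 since
  s is at most pi/4; then sin t = 2 sin s cos s.\<close>

lemma sin_ge_half:
  assumes "0 \<le> t" "t \<le> pi / 2"
  shows "t / 2 \<le> sin (t::real)"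
proof (cases "t = 0")
  case False
  define s where "s = t / 2"
  have s: "0 < s" "s \<le> pi / 4" using assms False by (auto simp: s_def)
  obtain \<xi> where \<xi>: "0 < \<xi>" "\<xi> < s" "sin s - sin 0 = (s - 0) * cos \<xi>"
    using MVT2[of 0 s sin cos] s by auto
  have "cos s \<le> cos \<xi>" using \<xi> s by (intro cos_monotone_0_pi_le) auto
  then have 1: "s * cos s \<le> sin s" using \<xi> s by simp
  have "cos (pi / 4) \<le> cos s" using s by (intro cos_monotone_0_pi_le) auto
  then have c: "sqrt 2 / 2 \<le> cos s" by (simp add: cos_45)
  have "1 / 2 = (sqrt 2 / 2)\<^sup>2" by (simp add: power_divide)
  also have "\<dots> \<le> (cos s)\<^sup>2" using c by (intro power_mono) auto
  finally have "s * (1 / 2) \<le> s * (cos s)\<^sup>2" using s by (intro mult_left_mono) auto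
  also have "\<dots> = s * cos s * cos s" by (simp add: power2_eq_square)
  also have "\<dots> \<le> sin s * cos s" using 1 c by (intro mult_right_mono order.trans[OF _ c]) auto
  also have "\<dots> = sin t / 2" using sin_double[of s] by (simp add: s_def)
  finally show ?thesis by (simp add: s_def)
qed simp

lemma norm_cis_diff_one_ge:
  assumes "\<bar>t\<bar> \<le> pi"
  shows "\<bar>t\<bar> / 2 \<le> norm (cis t - 1)"
proof -
  have "\<bar>sin (t / 2)\<bar> = \<bar>sin (\<bar>t\<bar> / 2)\<bar>" by (cases "t \<ge> 0") auto
  then show ?thesis
    using sin_ge_half[of "\<bar>t\<bar> / 2"] assms unfolding norm_cis_diff_one by linarith
qed

text \<open>By Cauchy the mean is 1 for \<open>z\<close> inside and 0 outside the circle. Only a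
  bound independent of \<open>z\<close> is wanted, as it multiplies values of the density that tend
  to 0.\<close>

lemma circle_mean_kernel_le:
  assumes "norm z \<noteq> 1"
  shows "norm (circle_mean (\<lambda>x. x / (x - z))) \<le> 1"
proof -
  have nz: "x - z \<noteq> 0" if "norm x = 1" for x using that assms by auto
  have "\<exists>I. ((\<lambda>x. 1 / (x - z)) has_contour_integral I) (circlepath 0 1) \<and> norm I \<le> 2 * pi"
  proof (cases "norm z < 1")
    case True
    have "((\<lambda>x. 1 / (x - z)) has_contour_integral (2 * of_real pi * \<i> * 1)) (circlepath 0 1)"
      using True by (intro Cauchy_integral_circlepath_simple) auto
    then show ?thesis by (auto simp: norm_mult)
  next
    case False
    then have "norm z > 1" using assms by simp
    have "((\<lambda>x. 1 / (x - z)) has_contour_integral 0) (circlepath 0 1)"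
    proof (rule Cauchy_theorem_disc_simple)
      show "(\<lambda>x. 1 / (x - z)) holomorphic_on ball 0 (norm z)"
        by (intro holomorphic_intros) auto
      show "path_image (circlepath 0 1) \<subseteq> ball 0 (norm z)"
        using \<open>norm z > 1\<close> by auto
    qed auto
    then show ?thesis by auto
  qed
  then obtain I where I: "((\<lambda>x. 1 / (x - z)) has_contour_integral I) (circlepath 0 1)" "norm I \<le>
      2 * pi"
    by blast
  have "((\<lambda>t. 1 / (0 + of_real 1 * cis t - z) * of_real 1 * \<i> * cis t) has_integral I) {0..2*pi}"
    using I(1) unfolding circlepath_def
    by (subst (asm) has_contour_integral_part_circlepath_iff) auto
  then have 1: "((\<lambda>t. \<i> * (cis t / (cis t - z))) has_integral I) {0..2*pi}"
    by (simp add: mult.commute)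
  have "set_integrable lborel {0..2*pi} (\<lambda>t. \<i> * (cis t / (cis t - z)))"
    using nz by (intro borel_integrable_atLeastAtMost' continuous_intros) auto
  then have "\<i> * (LINT t:{0..2*pi}|lborel. cis t / (cis t - z)) = I"
    using 1 by (metis set_borel_integral_eq_integral(2) integral_unique set_integral_mult_right)
  then have "(LINT t:{0..2*pi}|lborel. cis t / (cis t - z)) = I / \<i>"
    by auto
  then have "circle_mean (\<lambda>x. x / (x - z)) = I / \<i> / (2 * of_real pi)"
    by (simp add: circle_mean_def)
  then show ?thesis
    using I(2) by (simp add: norm_divide norm_mult divide_le_eq)
qed

lemma circle_functional_mean:
  assumes "circle_integrable w"
  shows "circle_functional (\<lambda>f. circle_mean (\<lambda>x. w x * f x))"
proof
  show "circle_mean (\<lambda>x. w x * (f x + g x)) =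
      circle_mean (\<lambda>x. w x * f x) + circle_mean (\<lambda>x. w x * g x)"
    if "continuous_on (sphere 0 1) f" "continuous_on (sphere 0 1) g" for f g
    using circle_mean_add[OF circle_integrable_bounded_mult[OF assms that(1)]
        circle_integrable_bounded_mult[OF assms that(2)]]
    by (simp add: algebra_simps)
  show "circle_mean (\<lambda>x. w x * (c * f x)) = c * circle_mean (\<lambda>x. w x * f x)" for f c
    using circle_mean_mult[of c "\<lambda>x. w x * f x"] by (simp add: algebra_simps)
qed (auto intro: circle_mean_cong)

section \<open>Cauchy integrals of functions Hoelder continuous at a point\<close>

lemma tendsto_powr_0:
  fixes f :: "'b \<Rightarrow> real"
  assumes "(f \<longlongrightarrow> 0) F" "\<And>x. f x \<ge> 0" "\<alpha> > 0"
  shows "((\<lambda>x. f x powr \<alpha>) \<longlongrightarrow> 0) F"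
proof -
  have "((\<lambda>x. f x powr \<alpha>) \<longlongrightarrow> 0 powr \<alpha>) F"
    using assms by (intro tendsto_powr' tendsto_const) auto
  then show ?thesis by simp
qed

lemma set_integrable_powr:
  assumes "b > -1" "c \<ge> 0"
  shows "set_integrable lborel {0..c} (\<lambda>x::real. x powr b)"
proof -
  have "(\<lambda>x. x powr b) absolutely_integrable_on {0..c}"
    using assms by (intro nonnegative_absolutely_integrable_1 integrable_on_powr_from_0) auto
  then show ?thesis
    unfolding set_integrable_def by (subst (asm) integrable_completion) auto
qed

text \<open>The chord vanishes at both ends of the interval, hence the majorant consists of a power
  of \<theta> and its reflection. The exponent is at most 0, so the lower bound for the chord
  becomes an upper bound for its power.\<close>

lemma set_integrable_chord_powr:
  assumes "0 < \<alpha>" "\<alpha> \<le> 1"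
  shows "set_integrable lborel {0..2*pi} (\<lambda>\<theta>. norm (cis \<theta> - 1) powr (\<alpha> - 1))"
proof -
  define b where "b = \<alpha> - 1"
  have b: "b > -1" "b \<le> 0" using assms by (auto simp: b_def)
  define G where "G = (\<lambda>\<theta>::real. indicat_real {0..2*pi} \<theta> *\<^sub>R \<theta> powr b)"
  have G1: "integrable lborel G"
    using set_integrable_powr[of b "2 * pi"] b by (simp add: G_def set_integrable_def)
  have G2: "integrable lborel (\<lambda>\<theta>. G (2 * pi + (- 1) * \<theta>))"
    by (rule lborel_integrable_real_affine[OF G1]) simp
  have "integrable lborel (\<lambda>\<theta>. indicat_real {0..2*pi} \<theta> *\<^sub>R norm (cis \<theta> - 1) powr b)"
  proof (rule Bochner_Integration.integrable_bound)
    show "integrable lborel (\<lambda>\<theta>. (1 / 2) powr b * (G \<theta> + G (2 * pi + (- 1) * \<theta>)))"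
      using G1 G2 by (intro integrable_mult_right Bochner_Integration.integrable_add)
    have "(\<lambda>\<theta>. norm (cis \<theta> - 1)) \<in> borel_measurable borel"
      by (intro borel_measurable_continuous_onI continuous_intros)
    then show "(\<lambda>\<theta>. indicat_real {0..2*pi} \<theta> *\<^sub>R norm (cis \<theta> - 1) powr b) \<in> borel_measurable lborel"
      by measurable
    have "norm (cis \<theta> - 1) powr b \<le> (1 / 2) powr b * (\<theta> powr b + (2 * pi - \<theta>) powr b)"
      if "0 \<le> \<theta>" "\<theta> \<le> 2 * pi" for \<theta>
    proof (cases "norm (cis \<theta> - 1) = 0")
      case False
      then have nz: "\<theta> \<noteq> 0" "\<theta> \<noteq> 2 * pi" by auto
      show ?thesis
      proof (cases "\<theta> \<le> pi")
        case True
        then have "\<theta> / 2 \<le> norm (cis \<theta> - 1)"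
          using norm_cis_diff_one_ge[of \<theta>] that by simp
        then have "norm (cis \<theta> - 1) powr b \<le> (1 / 2 * \<theta>) powr b"
          using b nz that by (intro powr_mono2') auto
        also have "\<dots> = (1 / 2) powr b * \<theta> powr b"
          by (rule powr_mult)
        also have "\<dots> \<le> (1 / 2) powr b * (\<theta> powr b + (2 * pi - \<theta>) powr b)"
          by (intro mult_left_mono) auto
        finally show ?thesis .
      next
        case False
        have "cis (\<theta> - 2 * pi) = cis \<theta>"
          using cis_divide[of \<theta> "2 * pi"] by simp
        then have "(2 * pi - \<theta>) / 2 \<le> norm (cis \<theta> - 1)"
          using norm_cis_diff_one_ge[of "\<theta> - 2 * pi"] that False by simp
        then have "norm (cis \<theta> - 1) powr b \<le> (1 / 2 * (2 * pi - \<theta>)) powr b"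
          using b nz that by (intro powr_mono2') auto
        also have "\<dots> = (1 / 2) powr b * (2 * pi - \<theta>) powr b"
          by (rule powr_mult)
        also have "\<dots> \<le> (1 / 2) powr b * (\<theta> powr b + (2 * pi - \<theta>) powr b)"
          by (intro mult_left_mono) auto
        finally show ?thesis .
      qed
    qed simp
    then show "AE \<theta> in lborel. norm (indicat_real {0..2*pi} \<theta> *\<^sub>R norm (cis \<theta> - 1) powr b)
        \<le> norm ((1 / 2) powr b * (G \<theta> + G (2 * pi + (- 1) * \<theta>)))"
      by (intro AE_I2) (auto simp: G_def indicator_def)
  qed
  then show ?thesis by (simp add: set_integrable_def b_def)
qed

lemma hoelder_continuous:
  fixes u :: "complex \<Rightarrow> complex"
  assumes "\<And>x y. x \<in> S \<Longrightarrow> y \<in> S \<Longrightarrow> norm (u x - u y) \<le> K * norm (x - y) powr \<alpha>" "\<alpha> > 0"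
  shows "continuous_on S u"
  unfolding continuous_on_def
proof
  fix x assume x: "x \<in> S"
  have "((\<lambda>y. u y - u x) \<longlongrightarrow> 0) (at x within S)"
  proof (rule Lim_null_comparison)
    show "\<forall>\<^sub>F y in at x within S. norm (u y - u x) \<le> K * norm (y - x) powr \<alpha>"
      using assms(1)[OF _ x] by (auto simp: eventually_at_filter)
    have "((\<lambda>y. norm (y - x)) \<longlongrightarrow> 0) (at x within S)"
      by (intro tendsto_norm_zero) (auto intro!: tendsto_eq_intros)
    then have "((\<lambda>y. norm (y - x) powr \<alpha>) \<longlongrightarrow> 0) (at x within S)"
      using assms(2) by (intro tendsto_powr_0) auto
    then show "((\<lambda>y. K * norm (y - x) powr \<alpha>) \<longlongrightarrow> 0) (at x within S)"
      by (rule tendsto_mult_right_zero)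
  qed
  then show "(u \<longlongrightarrow> u x) (at x within S)"
    by (simp add: LIM_zero_iff)
qed

text \<open>
  After rotating \<open>z / \<bar>z\<bar>\<close> to 1 the kernel depends on \<open>\<bar>z\<bar>\<close> only, and subtracting the value of
  \<open>u\<close> at \<open>z / \<bar>z\<bar>\<close> leaves an integrand dominated by a multiple of \<open>\<bar>x - 1\<bar> powr (\<alpha> - 1)\<close>, whatever the
  direction of approach.
\<close>

lemma cauchy_limit_hoelder:
  fixes u :: "complex \<Rightarrow> complex"
  assumes hol: "\<And>x y. x \<in> sphere 0 1 \<Longrightarrow> y \<in> sphere 0 1 \<Longrightarrow> norm (u x - u y) \<le> K * norm (x - y) powr \<alpha>"
    and \<alpha>: "0 < \<alpha>" "\<alpha> \<le> 1" and a: "norm a = 1" and ua: "u a = 0"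
  shows "((\<lambda>z. circle_mean (\<lambda>x. u x * (x / (x - z)))) \<longlongrightarrow> circle_mean (\<lambda>x. u x * (x / (x - a))))
    (at a within - sphere 0 1)"
  \<comment> \<open>Sequences are needed for dominated convergence.\<close>
  unfolding tendsto_at_iff_sequentially comp_def
proof (intro allI impI)
  fix X :: "nat \<Rightarrow> complex"
  assume X: "\<forall>i. X i \<in> - sphere 0 1 - {a}" and lim: "X \<longlonglongrightarrow> a"
  have nX: "norm (X i) \<noteq> 1" for i using X by auto
  have cont: "continuous_on (sphere 0 1) u"
    using hol \<alpha>(1) by (rule hoelder_continuous)
  \<comment> \<open>The radial projection of \<open>X i\<close> to the circle; the value 1 at the
    origin is an arbitrary unit number that keeps \<open>Xc\<close> valid there.\<close>
  define c where "c = (\<lambda>i. if X i = 0 then 1 else sgn (X i))"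
  have c1: "norm (c i) = 1" for i by (simp add: c_def norm_sgn)
  have Xc: "X i = c i * of_real (norm (X i))" for i
    by (simp add: c_def sgn_eq)
  have "a \<noteq> 0" using a by auto
  have c_lim: "c \<longlonglongrightarrow> a"
  proof (rule Lim_transform_eventually)
    show "(\<lambda>i. sgn (X i)) \<longlonglongrightarrow> a"
      using tendsto_sgn[OF lim \<open>a \<noteq> 0\<close>] a by (simp add: sgn_eq)
    show "\<forall>\<^sub>F i in sequentially. sgn (X i) = c i"
      using tendsto_imp_eventually_ne[OF lim \<open>a \<noteq> 0\<close>] by eventually_elim (simp add: c_def)
  qed
  have u_lim: "(\<lambda>i. u (c i * x)) \<longlonglongrightarrow> u (a * x)" if "norm x = 1" for x
    using cont[unfolded continuous_on_sequentially, rule_format, of "a * x" "\<lambda>i. c i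
        * x"] that c1 a c_lim
    using tendsto_mult_right[OF c_lim, of x] by (auto simp: comp_def norm_mult)
  define r where "r = (\<lambda>i. norm (X i))"
  have r1: "r i \<noteq> 1" "r i \<ge> 0" "norm (complex_of_real (r i)) \<noteq> 1" for i
    using nX[of i] by (auto simp: r_def)
  have r_lim: "r \<longlonglongrightarrow> 1" using tendsto_norm[OF lim] a by (simp add: r_def)
  have kcont: "continuous_on (sphere 0 1) (\<lambda>x::complex. x / (x - of_real (r i)))" for i
    using r1(3)[of i] by (intro continuous_intros) auto
  have ucont: "continuous_on (sphere 0 1) (\<lambda>x. u (c i * x))"
      if "norm (c i) = 1" for c :: "nat \<Rightarrow> complex" and i
    using that by (intro continuous_on_compose2[OF cont] continuous_intros) (auto simp: norm_mult)
  define J where "J = (\<lambda>i. circle_mean (\<lambda>x. (u (c i * x) - u (c i)) * (x / (x - of_real (r i)))))"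
  have split: "circle_mean (\<lambda>x. u x * (x / (x - X i))) =
      J i + u (c i) * circle_mean (\<lambda>x. x / (x - of_real (r i)))" for i
  proof -
    have "x - X i \<noteq> 0" if "norm x = 1" for x using that nX[of i] by auto
    then have "continuous_on (sphere 0 1) (\<lambda>x. u x * (x / (x - X i)))"
      by (intro continuous_intros cont) auto
    then have "circle_mean (\<lambda>x. u x * (x / (x - X i))) =
        circle_mean (\<lambda>x. u (c i * x) * (c i * x / (c i * x - X i)))"
      using circle_rotate(2)[of "\<lambda>x. u x * (x / (x - X i))" "c i"] c1[of i]
      by (simp add: circle_integrable_continuous)
    also have "\<dots> = circle_mean (\<lambda>x. (u (c i * x) - u (c i)) * (x / (x - of_real (r i)))
        + u (c i) * (x / (x - of_real (r i))))"
    proof (rule circle_mean_cong)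
      fix x :: complex
      have "c i \<noteq> 0" using c1[of i] by auto
      then have "c i * x / (c i * x - X i) = x / (x - of_real (r i))"
        unfolding r_def by (subst Xc) (simp flip: right_diff_distrib)
      then show "u (c i * x) * (c i * x / (c i * x - X i)) =
          (u (c i * x) - u (c i)) * (x / (x - of_real (r i)))
        + u (c i) * (x / (x - of_real (r i)))"
        by (simp add: algebra_simps diff_divide_distrib)
    qed
    also have "\<dots> = J i + circle_mean (\<lambda>x. u (c i) * (x / (x - of_real (r i))))"
      unfolding J_def
      by (intro circle_mean_add circle_integrable_continuous continuous_on_mult continuous_on_diff
          continuous_on_const kcont ucont c1)
    finally show ?thesis by (simp only: circle_mean_mult)
  qed
  have "(\<lambda>i. J i + u (c i) * circle_mean (\<lambda>x. x / (x - of_real (r i)))) \<longlonglongrightarrow>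
      circle_mean (\<lambda>x. u (a * x) * (x / (x - 1))) + 0"
  \<comment> \<open>The subtracted values \<open>u (c i)\<close> tend to \<open>u a = 0\<close> and
    their kernel means are at most 1 in norm, whether \<open>X i\<close> is inside or outside. The
    rest converges by dominated convergence.\<close>
  proof (rule tendsto_add)
    have "(\<lambda>i. u (c i)) \<longlonglongrightarrow> 0" using u_lim[of 1] ua by simp
    then show "(\<lambda>i. u (c i) * circle_mean (\<lambda>x. x / (x - of_real (r i)))) \<longlonglongrightarrow> 0"
      by (rule lim_null_mult_right_bounded[where B = 1])
         (use circle_mean_kernel_le[OF r1(3)] in \<open>auto intro!: always_eventually\<close>)
    have "(\<lambda>i. LINT \<theta>|lborel. indicat_real {0..2*pi} \<theta> *\<^sub>R
        ((u (c i * cis \<theta>) - u (c i)) * (cis \<theta> / (cis \<theta> - of_real (r i))))) \<longlonglongrightarrow>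
      (LINT \<theta>|lborel. indicat_real {0..2*pi} \<theta> *\<^sub>R (u (a * cis \<theta>) * (cis \<theta> / (cis \<theta> - 1))))"
    proof (rule integral_dominated_convergence)
      show "integrable lborel (\<lambda>\<theta>. 2 * \<bar>K\<bar>
          * (indicat_real {0..2*pi} \<theta> *\<^sub>R norm (cis \<theta> - 1) powr (\<alpha> - 1)))"
        using set_integrable_chord_powr[OF \<alpha>] unfolding set_integrable_def
            by (intro integrable_mult_right)
      have um: "(\<lambda>\<theta>. u (b * cis \<theta>)) \<in> borel_measurable borel" if "norm b = 1" for b
        using that
        by (intro borel_measurable_continuous_onI continuous_on_compose2[OF cont] continuous_intros)
           (auto simp: norm_mult)
      have cm: "cis \<in> borel_measurable borel"
        by (intro borel_measurable_continuous_onI continuous_intros)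
      show "(\<lambda>\<theta>. indicat_real {0..2*pi} \<theta> *\<^sub>R (u (a * cis \<theta>) * (cis \<theta> / (cis \<theta> - 1)))) \<in>
          borel_measurable lborel"
        using um[OF a] cm by measurable
      show "(\<lambda>\<theta>. indicat_real {0..2*pi} \<theta> *\<^sub>R
        ((u (c i * cis \<theta>) - u (c i)) * (cis \<theta> / (cis \<theta> - of_real (r i))))) \<in> borel_measurable
            lborel" for i
        using um[OF c1[of i]] cm by measurable
      show "AE \<theta> in lborel. (\<lambda>i. indicat_real {0..2*pi} \<theta> *\<^sub>R
        ((u (c i * cis \<theta>) - u (c i)) * (cis \<theta> / (cis \<theta> - of_real (r i))))) \<longlonglongrightarrow>
        indicat_real {0..2*pi} \<theta> *\<^sub>R (u (a * cis \<theta>) * (cis \<theta> / (cis \<theta> - 1)))"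
        using AE_cis_neq[of 1]
      proof eventually_elim
        case (elim \<theta>)
        have "(\<lambda>i. (u (c i * cis \<theta>) - u (c i * 1)) * (cis \<theta> / (cis \<theta> - of_real (r i)))) \<longlonglongrightarrow>
            (u (a * cis \<theta>) - u (a * 1)) * (cis \<theta> / (cis \<theta> - of_real 1))"
          using elim by (intro tendsto_intros u_lim r_lim) auto
        then show ?case
          using ua by (intro tendsto_scaleR tendsto_const) simp
      qed
      show "AE \<theta> in lborel. norm (indicat_real {0..2*pi} \<theta> *\<^sub>R
        ((u (c i * cis \<theta>) - u (c i)) * (cis \<theta> / (cis \<theta> - of_real (r i)))))
        \<le> 2 * \<bar>K\<bar> * (indicat_real {0..2*pi} \<theta> *\<^sub>R norm (cis \<theta> - 1) powr (\<alpha> - 1))" for i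
        using AE_cis_neq[of 1]
      proof eventually_elim
        case (elim \<theta>)
        have 1: "norm (u (c i * cis \<theta>) - u (c i)) \<le> \<bar>K\<bar> * norm (cis \<theta> - 1) powr \<alpha>"
        proof -
          have "norm (u (c i * cis \<theta>) - u (c i)) \<le> K * norm (c i * cis \<theta> - c i) powr \<alpha>"
            using c1 by (intro hol) (auto simp: norm_mult)
          also have "norm (c i * cis \<theta> - c i) = norm (cis \<theta> - 1)"
            using c1[of i] norm_mult[of "c i" "cis \<theta> - 1"] by (simp add: algebra_simps)
          also have "K * norm (cis \<theta> - 1) powr \<alpha> \<le> \<bar>K\<bar> * norm (cis \<theta> - 1) powr \<alpha>"
            by (intro mult_right_mono) auto
          finally show ?thesis .
        qed
        \<comment> \<open>The distance of \<open>r i\<close> to 1 is its distance to the circle,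
          hence at most that to \<open>cis \<theta>\<close>. This gives the constant 2 uniformly in
          \<open>i\<close>.\<close>
        have 2: "norm (cis \<theta> / (cis \<theta> - of_real (r i))) \<le> 2 / norm (cis \<theta> - 1)"
        proof -
          have "norm (cis \<theta> - 1) \<le> norm (cis \<theta> - of_real (r i))
              + norm (of_real (r i) - 1 :: complex)"
            using norm_triangle_ineq[of "cis \<theta> - of_real (r i)" "of_real (r i) - 1"] by simp
          also have "norm (of_real (r i) - 1 :: complex) = \<bar>r i - 1\<bar>"
            by (metis norm_of_real of_real_1 of_real_diff)
          also have "\<bar>r i - 1\<bar> \<le> norm (cis \<theta> - of_real (r i))"
            using norm_triangle_ineq3[of "cis \<theta>" "of_real (r i)"] r1(2)[of i] by simp
          finally have "norm (cis \<theta> - 1) \<le> 2 * norm (cis \<theta> - of_real (r i))" by simp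
          moreover have "norm (cis \<theta> - 1) > 0" using elim by simp
          ultimately show ?thesis
            by (simp add: norm_divide divide_simps)
        qed
        have "norm ((u (c i * cis \<theta>) - u (c i)) * (cis \<theta> / (cis \<theta> - of_real (r i))))
            \<le> (\<bar>K\<bar> * norm (cis \<theta> - 1) powr \<alpha>) * (2 / norm (cis \<theta> - 1))"
          unfolding norm_mult by (intro mult_mono 1 2) auto
        also have "\<dots> = 2 * \<bar>K\<bar> * norm (cis \<theta> - 1) powr (\<alpha> - 1)"
          using elim by (simp add: powr_diff)
        finally show ?case by (auto simp: indicator_def)
      qed
    qed
    then show "J \<longlonglongrightarrow> circle_mean (\<lambda>x. u (a * x) * (x / (x - 1)))"
      unfolding J_def circle_mean_def set_lebesgue_integral_def
          by (intro tendsto_divide tendsto_const) auto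
  qed
  also have "circle_mean (\<lambda>x. u (a * x) * (x / (x - 1))) = circle_mean (\<lambda>x. u x * (x / (x - a)))"
  proof -
    \<comment> \<open>Rotating 1 back to \<open>a\<close> by \<open>circle_rotate\<close> requires
      integrability first; it follows from the same majorant.\<close>
    have "circle_integrable (\<lambda>x. u (a * x) * (x / (x - 1)))"
      unfolding circle_integrable_def set_integrable_def
    proof (rule Bochner_Integration.integrable_bound)
      show "integrable lborel (\<lambda>\<theta>. \<bar>K\<bar> * (indicat_real {0..2*pi} \<theta> *\<^sub>R norm (cis \<theta> - 1) powr (\<alpha>
          - 1)))"
        using set_integrable_chord_powr[OF \<alpha>] unfolding set_integrable_def
            by (intro integrable_mult_right)
      have um: "(\<lambda>\<theta>. u (a * cis \<theta>)) \<in> borel_measurable borel"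
        using a
        by (intro borel_measurable_continuous_onI continuous_on_compose2[OF cont] continuous_intros)
           (auto simp: norm_mult)
      have cm: "cis \<in> borel_measurable borel"
        by (intro borel_measurable_continuous_onI continuous_intros)
      show "(\<lambda>\<theta>. indicat_real {0..2*pi} \<theta> *\<^sub>R (u (a * cis \<theta>) * (cis \<theta> / (cis \<theta> - 1)))) \<in>
          borel_measurable lborel"
        using um cm by measurable
      show "AE \<theta> in lborel. norm (indicat_real {0..2*pi} \<theta> *\<^sub>R (u (a * cis \<theta>)
          * (cis \<theta> / (cis \<theta> - 1))))
        \<le> norm (\<bar>K\<bar> * (indicat_real {0..2*pi} \<theta> *\<^sub>R norm (cis \<theta> - 1) powr (\<alpha> - 1)))"
        using AE_cis_neq[of 1]
      proof eventually_elim
        case (elim \<theta>)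
        have "norm (u (a * cis \<theta>)) \<le> K * norm (a * cis \<theta> - a) powr \<alpha>"
          using hol[of "a * cis \<theta>" a] ua a by (auto simp: norm_mult)
        also have "norm (a * cis \<theta> - a) = norm (cis \<theta> - 1)"
          using a norm_mult[of a "cis \<theta> - 1"] by (simp add: algebra_simps)
        also have "K * norm (cis \<theta> - 1) powr \<alpha> \<le> \<bar>K\<bar> * norm (cis \<theta> - 1) powr \<alpha>"
          by (intro mult_right_mono) auto
        finally have "norm (u (a * cis \<theta>) * (cis \<theta> / (cis \<theta> - 1))) \<le>
            \<bar>K\<bar> * norm (cis \<theta> - 1) powr \<alpha> * (1 / norm (cis \<theta> - 1))"
          unfolding norm_mult norm_divide norm_cis by (intro mult_right_mono) auto
        also have "\<dots> = \<bar>K\<bar> * norm (cis \<theta> - 1) powr (\<alpha> - 1)"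
          using elim by (simp add: powr_diff)
        finally show ?case by (auto simp: indicator_def)
      qed
    qed
    then have "circle_mean (\<lambda>x. u (a * (1 / a * x)) * (1 / a * x / (1 / a * x - 1))) =
        circle_mean (\<lambda>x. u (a * x) * (x / (x - 1)))"
      using a by (intro circle_rotate(2)) (simp_all add: norm_divide)
    moreover have "u (a * (1 / a * x)) * (1 / a * x / (1 / a * x - 1)) = u x * (x / (x - a))" for x
      using \<open>a \<noteq> 0\<close> by (simp add: divide_simps)
    ultimately show ?thesis by simp
  qed
  finally show "(\<lambda>i. circle_mean (\<lambda>x. u x * (x / (x - X i)))) \<longlonglongrightarrow>
      circle_mean (\<lambda>x. u x * (x / (x - a)))"
    unfolding split by simp
qed

lemma min_max_lipschitz: "\<bar>min 1 (max 0 s) - min 1 (max 0 t)\<bar> \<le> \<bar>s - t\<bar>" for s t :: real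
  by (simp add: min_def max_def abs_if)

lemma le_powr_of_le_2:
  fixes t :: real
  assumes "0 \<le> t" "t \<le> 2" "0 < \<alpha>" "\<alpha> \<le> 1"
  shows "t \<le> 2 * t powr \<alpha>"
proof (cases "t = 0")
  case False
  have "t = t powr (1 - \<alpha>) * t powr \<alpha>"
    using False assms by (simp flip: powr_add)
  also have "t powr (1 - \<alpha>) \<le> 2 powr (1 - \<alpha>)"
    using assms by (intro powr_mono2) auto
  also have "2 powr (1 - \<alpha>) \<le> (2::real) powr 1"
    using assms by (intro powr_mono) auto
  finally show ?thesis by (simp add: mult_right_mono)
qed simp

text \<open>A Lipschitz cut-off splits \<open>u\<close> into a part that is Hoelder on the whole
  circle and a part vanishing near \<open>a\<close>, for which the kernel stays bounded as
  \<open>z\<close> tends to \<open>a\<close>.\<close>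

lemma cauchy_limit_local:
  fixes u :: "complex \<Rightarrow> complex"
  assumes int: "circle_integrable u" and int_a: "circle_integrable (\<lambda>x. u x * (x / (x - a)))"
    and hol: "\<And>x y. x \<in> sphere 0 1 \<Longrightarrow> y \<in> sphere 0 1 \<Longrightarrow> norm (x - a) < \<eta> \<Longrightarrow> norm (y - a) < \<eta> \<Longrightarrow>
      norm (u x - u y) \<le> K * norm (x - y) powr \<alpha>"
    and \<eta>: "\<eta> > 0" and K: "K \<ge> 0" and \<alpha>: "0 < \<alpha>" "\<alpha> \<le> 1" and a: "norm a = 1" and ua: "u a = 0"
  shows "((\<lambda>z. circle_mean (\<lambda>x. u x * (x / (x - z)))) \<longlongrightarrow> circle_mean (\<lambda>x. u x * (x / (x - a))))
    (at a within - sphere 0 1)"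
proof -
  define cut where "cut = (\<lambda>x. min 1 (max 0 (2 - 2 / \<eta> * norm (x - a))))"
  have cut01: "0 \<le> cut x" "cut x \<le> 1" for x by (auto simp: cut_def)
  have cut_lip: "\<bar>cut x - cut y\<bar> \<le> 2 / \<eta> * norm (x - y)" for x y
  proof -
    have "\<bar>cut x - cut y\<bar> \<le> \<bar>(2 - 2 / \<eta> * norm (x - a)) - (2 - 2 / \<eta> * norm (y - a))\<bar>"
      unfolding cut_def by (rule min_max_lipschitz)
    also have "\<dots> = 2 / \<eta> * \<bar>norm (x - a) - norm (y - a)\<bar>"
    proof -
      have "(2 - 2 / \<eta> * norm (x - a)) - (2 - 2 / \<eta> * norm (y - a)) =
          - (2 / \<eta> * (norm (x - a) - norm (y - a)))"
        by (simp add: algebra_simps)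
      then show ?thesis
        unfolding abs_minus_cancel abs_mult using \<eta> by (simp only: abs_minus_cancel abs_mult) simp
    qed
    also have "\<dots> \<le> 2 / \<eta> * norm (x - y)"
      using \<eta> norm_triangle_ineq3[of "x - a" "y - a"] by (intro mult_left_mono) auto
    finally show ?thesis .
  qed
  have cut0: "cut x = 0" if "norm (x - a) \<ge> \<eta>" for x
  proof -
    have "2 / \<eta> * norm (x - a) \<ge> 2" using that \<eta> by (simp add: field_simps)
    then show ?thesis by (simp add: cut_def)
  qed
  have cut1: "cut x = 1" if "norm (x - a) \<le> \<eta> / 2" for x
  proof -
    have "2 / \<eta> * norm (x - a) \<le> 1" using that \<eta> by (simp add: field_simps)
    then show ?thesis by (simp add: cut_def)
  qed
  have cut_cont: "continuous_on A (\<lambda>x. complex_of_real (cut x))" for A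
    unfolding cut_def by (intro continuous_intros)

  define v where "v = (\<lambda>x. cut x * u x)"
  have u_bound: "norm (u x) \<le> 2 * K" if "x \<in> sphere 0 1" "norm (x - a) < \<eta>" for x
  proof -
    have "norm (u x) \<le> K * norm (x - a) powr \<alpha>"
      using hol[of x a] that \<eta> a ua by simp
    also have "norm (x - a) powr \<alpha> \<le> 2 powr \<alpha>"
      using norm_triangle_ineq4[of x a] that a \<alpha> by (intro powr_mono2) auto
    also have "2 powr \<alpha> \<le> (2::real) powr 1" using \<alpha> by (intro powr_mono) auto
    finally show ?thesis using K by (simp add: mult_left_mono mult.commute[of 2])
  qed
  \<comment> \<open>The constant: Lipschitz bound 2/\<eta> of \<open>cut\<close>, times 2 for
    passing from distance to its power \<alpha>, times the bound \<open>2 * K\<close> on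
    \<open>u\<close>; the remaining \<open>K\<close> comes from \<open>u\<close> itself.\<close>
  have near: "norm (v x - v y) \<le> (8 * K / \<eta> + K) * norm (x - y) powr \<alpha>"
    if x: "x \<in> sphere 0 1" "norm (x - a) < \<eta>" and y: "y \<in> sphere 0 1" for x y
  proof -
    have t: "norm (x - y) \<le> 2 * norm (x - y) powr \<alpha>"
      using norm_triangle_ineq4[of x y] x y \<alpha> by (intro le_powr_of_le_2) auto
    have "v x - v y = (cut x - cut y) * u x + cut y * (u x - u y)"
      by (simp add: v_def algebra_simps)
    then have "norm (v x - v y) \<le> \<bar>cut x - cut y\<bar> * norm (u x) + cut y * norm (u x - u y)"
      using norm_triangle_ineq[of "(cut x - cut y) * u x" "cut y * (u x - u y)"] cut01[of y]
      by (simp add: norm_mult flip: of_real_diff)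
    also have "\<bar>cut x - cut y\<bar> * norm (u x) \<le> (2 / \<eta> * norm (x - y)) * (2 * K)"
      using cut_lip u_bound x \<eta> by (intro mult_mono) auto
    also have "\<dots> \<le> (2 / \<eta> * (2 * norm (x - y) powr \<alpha>)) * (2 * K)"
      using t \<eta> K by (intro mult_right_mono mult_left_mono) auto
    also have "cut y * norm (u x - u y) \<le> K * norm (x - y) powr \<alpha>"
    proof (cases "norm (y - a) < \<eta>")
      case True
      have "cut y * norm (u x - u y) \<le> 1 * norm (u x - u y)"
        using cut01[of y] by (intro mult_right_mono) auto
      also have "\<dots> \<le> K * norm (x - y) powr \<alpha>"
        using hol[OF x(1) y x(2) True] by simp
      finally show ?thesis .
    next
      case False
      then show ?thesis using cut0[of y] K by simp
    qed
    finally show ?thesis using \<eta> by (simp add: field_simps)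
  qed
  have v_hol: "norm (v x - v y) \<le> (8 * K / \<eta> + K) * norm (x - y) powr \<alpha>"
    if "x \<in> sphere 0 1" "y \<in> sphere 0 1" for x y
  proof (cases "norm (x - a) < \<eta> \<or> norm (y - a) < \<eta>")
    case True
    then show ?thesis using near that by (metis norm_minus_commute)
  next
    case False
    then have "v x - v y = 0" by (simp add: v_def cut0)
    then show ?thesis using K \<eta> by simp
  qed
  have v_lim: "((\<lambda>z. circle_mean (\<lambda>x. v x * (x / (x - z)))) \<longlongrightarrow> circle_mean (\<lambda>x. v x * (x / (x - a))))
      (at a within - sphere 0 1)"
    by (rule cauchy_limit_hoelder[OF v_hol \<alpha> a]) (simp_all add: v_def ua)

  define h where "h = (\<lambda>z x. (1 - complex_of_real (cut x)) * (x / (x - z)))"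
  have h_cont: "continuous_on (sphere 0 1) (h z)" if z: "norm (z - a) < \<eta> / 4" for z
  proof -
    \<comment> \<open>Near \<open>a\<close> the factor \<open>1 - cut\<close> is 0, even where
      \<open>x = z\<close>; away from \<open>a\<close> the denominator cannot vanish. The two closed
      sets cover the plane.\<close>
    have "continuous_on {x. norm (x - a) \<le> \<eta> / 2} (h z) \<longleftrightarrow> continuous_on {x. norm (x - a) \<le>
        \<eta> / 2} (\<lambda>x. 0 :: complex)"
      by (rule continuous_on_cong) (auto simp: h_def cut1)
    moreover have "continuous_on {x. norm (x - a) \<ge> \<eta> / 2} (h z)"
      unfolding h_def by (intro continuous_intros cut_cont) (use z \<eta> in auto)
    moreover have "closed {x. norm (x - a) \<le> \<eta> / 2}" "closed {x. norm (x - a) \<ge> \<eta> / 2}"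
      by (intro closed_Collect_le continuous_intros)+
    ultimately have "continuous_on ({x. norm (x - a) \<le> \<eta> / 2} \<union> {x. norm (x - a) \<ge> \<eta> / 2}) (h z)"
      by (intro continuous_on_closed_Un) auto
    then show ?thesis by (rule continuous_on_subset) auto
  qed
  have h_int: "circle_integrable (\<lambda>x. u x * h z x)" if "norm (z - a) < \<eta> / 4" for z
    using int h_cont[OF that] by (rule circle_integrable_bounded_mult)
  define B where "B = Re (circle_mean (\<lambda>x. of_real (norm (u x))))"
  have h_diff: "norm (circle_mean (\<lambda>x. u x * h z x) - circle_mean (\<lambda>x. u x * h a x)) \<le>
      8 / \<eta>\<^sup>2 * norm (z - a) * B"
    if z: "norm (z - a) < \<eta> / 4" for z
  proof -
    have a4: "norm (a - a) < \<eta> / 4" using \<eta> by simp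
    have "circle_mean (\<lambda>x. u x * h z x) - circle_mean (\<lambda>x. u x * h a x) =
        circle_mean (\<lambda>x. u x * h z x - u x * h a x)"
      using h_int[OF z] h_int[OF a4] by (simp add: circle_mean_diff)
    also have "norm \<dots> \<le> 8 / \<eta>\<^sup>2 * norm (z - a) * B"
      unfolding B_def
    proof (rule norm_circle_mean_le)
      show "circle_integrable (\<lambda>x. u x * h z x - u x * h a x)"
        using h_int[OF z] h_int[OF a4] by (rule circle_integrable_diff)
      show "norm (u x * h z x - u x * h a x) \<le>
          8 / \<eta>\<^sup>2 * norm (z - a) * norm (u x)" if x: "x \<in> sphere 0 1" for x
      proof (cases "norm (x - a) \<le> \<eta> / 2")
        case True
        then show ?thesis by (simp add: h_def cut1)
      next
        case False
        have xz: "norm (x - z) \<ge> \<eta> / 4"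
          using False z norm_triangle_ineq4[of "x - z" "a - z"] by (simp add: norm_minus_commute)
        then have nz: "x - z \<noteq> 0" "x - a \<noteq> 0" using \<eta> False by auto
        have "x / (x - z) - x / (x - a) = x * (z - a) / ((x - z) * (x - a))"
          using nz by (simp add: divide_simps) (simp add: algebra_simps)
        moreover have "u x * h z x - u x * h a x =
            u x * (1 - complex_of_real (cut x)) * (x / (x - z) - x / (x - a))"
          by (simp only: h_def mult.assoc[symmetric] right_diff_distrib[symmetric])
        ultimately have "u x * h z x - u x * h a x =
            u x * (1 - complex_of_real (cut x)) * (x * (z - a) / ((x - z) * (x - a)))"
          by (simp only:)
        also have "norm \<dots> = norm (u x) * norm (1 - complex_of_real (cut x))
            * (norm (z - a) / (norm (x - z) * norm (x - a)))"
          using x by (simp add: norm_mult norm_divide)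
        \<comment> \<open>Here \<open>x\<close> is farther than \<eta>/2 from \<open>a\<close> and
          at least \<eta>/4 from \<open>z\<close>, which yields the factor 8/\<eta>^2.\<close>
        also have "\<dots> \<le> norm (u x) * 1 * (norm (z - a) / (\<eta> / 4 * (\<eta> / 2)))"
        proof (intro mult_mono divide_left_mono)
          have "norm (1 - complex_of_real (cut x)) = 1 - cut x"
            using cut01[of x] by (metis abs_of_nonneg diff_ge_0_iff_ge norm_of_real of_real_1
                of_real_diff)
          then show "norm (1 - complex_of_real (cut x)) \<le> 1" using cut01[of x] by simp
        qed (use xz False \<eta> nz in auto)
        also have "\<dots> = 8 / \<eta>\<^sup>2 * norm (z - a) * norm (u x)"
          by (simp add: power2_eq_square)
        finally show ?thesis .
      qed
    qed (rule int)
    finally show ?thesis .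
  qed
  have h_lim: "((\<lambda>z. circle_mean (\<lambda>x. u x * h z x)) \<longlongrightarrow>
      circle_mean (\<lambda>x. u x * h a x)) (at a within - sphere 0 1)"
  proof -
    have "((\<lambda>z. circle_mean (\<lambda>x. u x * h z x) - circle_mean (\<lambda>x. u x * h a x)) \<longlongrightarrow>
        0) (at a within - sphere 0 1)"
    proof (rule Lim_null_comparison)
      show "\<forall>\<^sub>F z in at a within - sphere 0 1.
          norm (circle_mean (\<lambda>x. u x * h z x) - circle_mean (\<lambda>x. u x * h a x)) \<le>
              8 / \<eta>\<^sup>2 * norm (z - a) * B"
        unfolding eventually_at using h_diff \<eta> by (intro exI[of _ "\<eta> / 4"]) (auto simp: dist_norm)
      show "((\<lambda>z. 8 / \<eta>\<^sup>2 * norm (z - a) * B) \<longlongrightarrow> 0) (at a within - sphere 0 1)"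
        using \<eta> by (auto intro!: tendsto_eq_intros)
    qed
    then show ?thesis by (simp add: LIM_zero_iff)
  qed

  have sum: "circle_mean (\<lambda>x. u x * (x / (x - z))) =
      circle_mean (\<lambda>x. v x * (x / (x - z))) + circle_mean (\<lambda>x. u x * h z x)"
    if z: "norm (z - a) < \<eta> / 4" and i: "circle_integrable (\<lambda>x. u x * (x / (x - z)))" for z
  proof -
    have eq: "v x * (x / (x - z)) = u x * (x / (x - z)) - u x * h z x" for x
      by (simp add: v_def h_def algebra_simps diff_divide_distrib)
    then show ?thesis
      using circle_mean_diff[OF i h_int[OF z]] by simp
  qed
  have "((\<lambda>z. circle_mean (\<lambda>x. v x * (x / (x - z))) + circle_mean (\<lambda>x. u x * h z x)) \<longlongrightarrow>
      circle_mean (\<lambda>x. v x * (x / (x - a))) + circle_mean (\<lambda>x. u x * h a x)) (at a within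
          - sphere 0 1)"
    using v_lim h_lim by (rule tendsto_add)
  also have "circle_mean (\<lambda>x. v x * (x / (x - a))) + circle_mean (\<lambda>x. u x * h a x) =
      circle_mean (\<lambda>x. u x * (x / (x - a)))"
    using sum[OF _ int_a] \<eta> by simp
  finally show ?thesis
  proof (rule Lim_transform_eventually)
    show "\<forall>\<^sub>F z in at a within - sphere 0 1. circle_mean (\<lambda>x. v x * (x / (x - z)))
        + circle_mean (\<lambda>x. u x * h z x) =
       circle_mean (\<lambda>x. u x * (x / (x - z)))"
      unfolding eventually_at
    proof (intro exI[of _ "\<eta> / 4"] conjI ballI impI)
      fix z assume z: "z \<in> - sphere 0 1" "z \<noteq> a \<and> dist z a < \<eta> / 4"
      have "continuous_on (sphere 0 1) (\<lambda>x. x / (x - z))"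
        using z by (intro continuous_intros) auto
      then have "circle_integrable (\<lambda>x. u x * (x / (x - z)))"
        by (rule circle_integrable_bounded_mult[OF int])
      then show "circle_mean (\<lambda>x. v x * (x / (x - z))) + circle_mean (\<lambda>x. u x * h z x) =
         circle_mean (\<lambda>x. u x * (x / (x - z)))"
        using sum z by (simp add: dist_norm)
    qed (use \<eta> in auto)
  qed
qed

section \<open>Semi-classical weights near a singularity on the circle\<close>

text \<open>Subadditivity of the power: s/t and (t - s)/t add up to 1, and each is at most its own
  power with exponent \<alpha>.\<close>

lemma powr_diff_le:
  fixes s t :: real
  assumes "0 \<le> s" "s \<le> t" "0 < \<alpha>" "\<alpha> \<le> 1"
  shows "t powr \<alpha> - s powr \<alpha> \<le> (t - s) powr \<alpha>"
proof (cases "t = 0")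
  case False
  then have t: "t > 0" using assms by simp
  have ge: "x \<le> x powr \<alpha>" if "0 \<le> x" "x \<le> 1" for x :: real
    using powr_mono'[of \<alpha> 1 x] assms that by simp
  have "1 = s / t + (t - s) / t" using t by (simp add: field_simps)
  also have "\<dots> \<le> (s / t) powr \<alpha> + ((t - s) / t) powr \<alpha>"
    using assms t by (intro add_mono ge) auto
  also have "\<dots> = (s powr \<alpha> + (t - s) powr \<alpha>) / t powr \<alpha>"
    using assms t by (simp add: powr_divide add_divide_distrib)
  finally show ?thesis using t by (simp add: field_simps)
qed (use assms in auto)

lemma half_chord_bounds:
  assumes "0 < s" "s < (1::real)"
  shows "s / 2 \<le> 2 * sin (s / 2)" "2 * sin (s / 2) \<le> s" "0 < sin (s / 2)"
  using sin_ge_half[of "s / 2"] sin_x_le_x[of "s / 2"] pi_gt3 assms by auto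

lemma not_set_integrable_inverse:
  assumes "\<delta> > 0"
  shows "\<not> set_integrable lborel {0<..<\<delta>} (\<lambda>s::real. 1 / s)"
proof
  assume int: "set_integrable lborel {0<..<\<delta>} (\<lambda>s. 1 / s)"
  define I where "I = (LINT s|lborel. indicat_real {0<..<\<delta>} s *\<^sub>R (1 / s))"
  \<comment> \<open>Chosen so that the integral of 1/s from \<open>e\<close> to \<delta>/2 is
    exactly \<open>\<bar>I\<bar> + 1\<close>, more than the integral \<open>I\<close> over the whole
    interval.\<close>
  define e where "e = \<delta> / 2 * exp (- (\<bar>I\<bar> + 1))"
  have e: "0 < e" "e \<le> \<delta> / 2" using assms by (auto simp: e_def)
  have "(LINT s|lborel. indicat_real {e..\<delta>/2} s *\<^sub>R (1 / s)) = ln (\<delta> / 2) - ln e"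
    using e by (intro integral_FTC_atLeastAtMost)
      (auto intro!: continuous_intros derivative_eq_intros simp flip:
          has_real_derivative_iff_has_vector_derivative)
  also have "\<dots> = \<bar>I\<bar> + 1"
    unfolding e_def using assms by (subst ln_mult) auto
  finally have 1: "(LINT s|lborel. indicat_real {e..\<delta>/2} s *\<^sub>R (1 / s)) = \<bar>I\<bar> + 1" .
  have "(LINT s|lborel. indicat_real {e..\<delta>/2} s *\<^sub>R (1 / s)) \<le> I"
    unfolding I_def
  proof (rule integral_mono)
    show "integrable lborel (\<lambda>s. indicat_real {0<..<\<delta>} s *\<^sub>R (1 / s))"
      using int by (simp add: set_integrable_def)
    have "set_integrable lborel {e..\<delta>/2} (\<lambda>s. 1 / s)"
      using int e assms by (rule_tac set_integrable_subset) auto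
    then show "integrable lborel (\<lambda>s. indicat_real {e..\<delta>/2} s *\<^sub>R (1 / s))"
      by (simp add: set_integrable_def)
  qed (use e assms in \<open>auto simp: indicator_def\<close>)
  with 1 show False by simp
qed

text \<open>
  Here \<open>2 * sin (s / 2)\<close> is the length of the chord from 1 to \<open>cis s\<close>, and \<open>cot (s / 2) / 2\<close> its
  logarithmic derivative.
\<close>

lemma ode_power_solution:
  fixes g b :: "real \<Rightarrow> complex" and \<rho> :: complex
  assumes \<delta>: "0 < \<delta>" "\<delta> \<le> 1"
    and der: "\<And>s. s \<in> {0<..<\<delta>} \<Longrightarrow>
      (g has_vector_derivative (\<rho> * of_real (cot (s / 2) / 2) + b s) * g s) (at s)"
    and b: "continuous_on {0..\<delta>} b"
  obtains c h where "continuous_on {0..\<delta>} h"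
    "\<And>s. s \<in> {0<..<\<delta>} \<Longrightarrow> g s = c * exp (\<rho> * of_real (ln (2 * sin (s / 2))) + h s)"
proof -
  define h where "h = (\<lambda>s. integral {0..s} b)"
  have h: "(h has_vector_derivative b s) (at s)" if "s \<in> {0<..<\<delta>}" for s
  proof -
    have "(h has_vector_derivative b s) (at s within {0..\<delta>})"
      unfolding h_def using that b by (intro integral_has_vector_derivative) auto
    then show ?thesis using that by (simp add: at_within_Icc_at)
  qed
  have h_cont: "continuous_on {0..\<delta>} h"
    unfolding h_def using b by (intro indefinite_integral_continuous_1 integrable_continuous_real)
  define E where "E = (\<lambda>s. \<rho> * of_real (ln (2 * sin (s / 2))) + h s)"
  have E: "(E has_vector_derivative \<rho> * of_real (cot (s / 2) / 2)
      + b s) (at s)" if s: "s \<in> {0<..<\<delta>}" for s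
  proof -
    have "sin (s / 2) > 0" using half_chord_bounds(3)[of s] s \<delta> by simp
    then have "((\<lambda>s. ln (2 * sin (s / 2))) has_real_derivative cot (s / 2) / 2) (at s)"
      by (auto intro!: derivative_eq_intros simp: cot_def field_simps)
    then have "((\<lambda>s. complex_of_real (ln (2 * sin (s / 2)))) has_vector_derivative of_real
        (cot (s / 2) / 2)) (at s)"
      by (rule has_vector_derivative_of_real)
    then show ?thesis
      unfolding E_def using h[OF s]
      by (intro has_vector_derivative_add has_vector_derivative_mult_right)
  qed
  \<comment> \<open>Integrating factor: \<open>G\<close> has derivative 0 on an interval, hence is
    constant.\<close>
  define G where "G = (\<lambda>s. g s * exp (- E s))"
  have "(G has_derivative (\<lambda>h. 0)) (at s within {0<..<\<delta>})" if s: "s \<in> {0<..<\<delta>}" for s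
  proof -
    define q where "q = \<rho> * of_real (cot (s / 2) / 2) + b s"
    have "((\<lambda>s. - E s) has_vector_derivative - q) (at s)"
      using E[OF s] unfolding q_def by (rule has_vector_derivative_minus)
    then have "(exp \<circ> (\<lambda>s. - E s) has_vector_derivative - q * exp (- E s)) (at s)"
      by (rule field_vector_diff_chain_at) (rule DERIV_exp)
    then have "((\<lambda>s. exp (- E s)) has_vector_derivative - q * exp (- E s)) (at s)"
      by (simp add: comp_def)
    from has_vector_derivative_mult[OF der[OF s] this]
    have "(G has_vector_derivative 0) (at s)"
      by (simp add: G_def q_def algebra_simps)
    then show ?thesis
      by (auto simp: has_vector_derivative_def intro: has_derivative_at_withinI)
  qed
  then obtain c where c: "\<And>s. s \<in> {0<..<\<delta>} \<Longrightarrow> G s = c"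
    using has_derivative_zero_constant[of "{0<..<\<delta>}" G] by auto
  show ?thesis
  proof (rule that[of h c])
    fix s assume "s \<in> {0<..<\<delta>}"
    then have "g s * exp (- E s) = c" using c by (simp add: G_def)
    then have "g s * (exp (- E s) * exp (E s)) = c * exp (E s)"
        by (simp only: mult.assoc[symmetric])
    then have "g s = c * exp (E s)" by (simp flip: exp_add)
    then show "g s = c * exp (\<rho> * of_real (ln (2 * sin (s / 2))) + h s)" by (simp only: E_def)
  qed (rule h_cont)
qed

text \<open>The explicit solution shows that the size of \<open>g\<close> is that of
  \<open>s powr Re \<rho>\<close>. If \<open>Re \<rho> \<le> 0\<close>, it is bounded below and
  \<open>norm (g s) / s\<close> dominates a multiple of 1/s, which is not integrable. Otherwise the
  equation bounds the derivative by a multiple of \<open>s powr (\<alpha> - 1)\<close>; integration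
  and \<open>powr_diff_le\<close> give the Hoelder bound.\<close>

lemma ode_hoelder:
  fixes g b :: "real \<Rightarrow> complex" and \<rho> :: complex
  assumes \<delta>: "0 < \<delta>" "\<delta> \<le> 1"
    and der: "\<And>s. s \<in> {0<..<\<delta>} \<Longrightarrow>
      (g has_vector_derivative (\<rho> * of_real (cot (s / 2) / 2) + b s) * g s) (at s)"
    and b: "continuous_on {0..\<delta>} b"
    and nz: "\<exists>s\<in>{0<..<\<delta>}. g s \<noteq> 0"
    and int: "set_integrable lborel {0<..<\<delta>} (\<lambda>s. norm (g s) / s)"
    and \<alpha>_def: "\<alpha> = min 1 (Re \<rho>)"
  shows "Re \<rho> > 0"
    and "\<exists>K\<ge>0. \<forall>s\<in>{0<..<\<delta>}. norm (g s) \<le> K * s powr \<alpha> \<and>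
      (\<forall>t\<in>{0<..<\<delta>}. norm (g s - g t) \<le> K * \<bar>s - t\<bar> powr \<alpha>)"
proof -
  obtain c h where h: "continuous_on {0..\<delta>} h"
    and g: "\<And>s. s \<in> {0<..<\<delta>} \<Longrightarrow> g s = c * exp (\<rho> * of_real (ln (2 * sin (s / 2))) + h s)"
    using ode_power_solution[OF \<delta> der b] by blast
  have "c \<noteq> 0" using nz g by auto
  have "bounded (h ` {0..\<delta>})" "bounded (b ` {0..\<delta>})"
    using h b by (auto intro!: compact_imp_bounded compact_continuous_image)
  then obtain H B where "\<forall>x\<in>h ` {0..\<delta>}. norm x \<le> H" and "\<forall>x\<in>b ` {0..\<delta>}. norm x \<le> B"
    unfolding bounded_iff by blast
  then have H: "\<And>s. s \<in> {0..\<delta>} \<Longrightarrow> norm (h s) \<le> H" and B: "\<And>s. s \<in> {0..\<delta>} \<Longrightarrow> norm (b s) \<le> B"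
    by blast+
  have "B \<ge> 0" using B[of 0] \<delta> order.trans[OF norm_ge_zero[of "b 0"]] by simp
  have norm_g: "norm (g s) = norm c * ((2 * sin (s / 2)) powr Re \<rho> * exp (Re (h s)))"
      if "s \<in> {0<..<\<delta>}" for s
    using g[OF that] half_chord_bounds(3)[of s] that \<delta>
    by (simp add: norm_mult exp_add powr_def)
  have Re_h: "- H \<le> Re (h s)" "Re (h s) \<le> H" if "s \<in> {0<..<\<delta>}" for s
    using H[of s] abs_Re_le_cmod[of "h s"] that by auto
  show pos: "Re \<rho> > 0"
  proof (rule ccontr)
    assume neg: "\<not> Re \<rho> > 0"
    define C where "C = norm c * exp (- H)"
    have "C > 0" using \<open>c \<noteq> 0\<close> by (simp add: C_def)
    have ge: "C \<le> norm (g s)" if s: "s \<in> {0<..<\<delta>}" for s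
    proof -
      \<comment> \<open>The chord is shorter than 1 and the exponent is at most 0, so the power is
        at least 1.\<close>
      have "1 powr Re \<rho> \<le> (2 * sin (s / 2)) powr Re \<rho>"
        using half_chord_bounds[of s] s \<delta> neg by (intro powr_mono2') auto
      then have "1 * exp (- H) \<le> (2 * sin (s / 2)) powr Re \<rho> * exp (Re (h s))"
        using Re_h[OF s] by (intro mult_mono) auto
      then show ?thesis unfolding norm_g[OF s] C_def by (intro mult_left_mono) auto
    qed
    have "set_integrable lborel {0<..<\<delta>} (\<lambda>s. 1 / s)"
      unfolding set_integrable_def
    proof (rule Bochner_Integration.integrable_bound)
      show "integrable lborel (\<lambda>s. (1 / C) * (indicat_real {0<..<\<delta>} s *\<^sub>R (norm (g s) / s)))"
        using int unfolding set_integrable_def by (intro integrable_mult_right)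
      show "AE s in lborel. norm (indicat_real {0<..<\<delta>} s *\<^sub>R (1 / s)) \<le>
          norm ((1 / C) * (indicat_real {0<..<\<delta>} s *\<^sub>R (norm (g s) / s)))"
      proof (rule AE_I2)
        fix s
        show "norm (indicat_real {0<..<\<delta>} s *\<^sub>R (1 / s)) \<le>
          norm ((1 / C) * (indicat_real {0<..<\<delta>} s *\<^sub>R (norm (g s) / s)))"
        proof (cases "s \<in> {0<..<\<delta>}")
          case True
          then have "1 \<le> norm (g s) / C" using ge \<open>C > 0\<close> by simp
          then have "1 / s \<le> norm (g s) / C / s" using True by (intro divide_right_mono) auto
          then show ?thesis using True \<open>C > 0\<close> by (simp add: field_simps)
        qed simp
      qed
    qed measurable
    then show False using not_set_integrable_inverse[OF \<delta>(1)] by contradiction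
  qed
  have \<alpha>: "0 < \<alpha>" "\<alpha> \<le> 1" "\<alpha> \<le> Re \<rho>" using pos by (auto simp: \<alpha>_def)
  define C where "C = norm c * exp H"
  have "C \<ge> 0" by (simp add: C_def)
  have g_le: "norm (g s) \<le> C * s powr \<alpha>" if s: "s \<in> {0<..<\<delta>}" for s
  proof -
    have "(2 * sin (s / 2)) powr Re \<rho> \<le> s powr Re \<rho>"
      using half_chord_bounds[of s] s \<delta> pos by (intro powr_mono2) auto
    also have "\<dots> \<le> s powr \<alpha>"
      using \<alpha> s \<delta> by (intro powr_mono') auto
    finally have "(2 * sin (s / 2)) powr Re \<rho> * exp (Re (h s)) \<le> s powr \<alpha> * exp H"
      using Re_h[OF s] by (intro mult_mono) auto
    then have "norm c * ((2 * sin (s / 2)) powr Re \<rho> * exp (Re (h s))) \<le>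
        norm c * (s powr \<alpha> * exp H)"
      by (intro mult_left_mono) auto
    then show ?thesis by (simp add: norm_g[OF s] C_def mult_ac)
  qed
  \<comment> \<open>The cotangent term is at most 2/s in norm and \<open>B\<close> is at most B/s
    because s < 1; \<open>C\<close> is the constant for \<open>g\<close> itself.\<close>
  define K where "K = (2 * norm \<rho> + B) * C"
  have "K \<ge> 0" using \<open>C \<ge> 0\<close> \<open>B \<ge> 0\<close> by (simp add: K_def)
  have der_le: "norm ((\<rho> * of_real (cot (s / 2) / 2) + b s) * g s) \<le>
      K * s powr (\<alpha> - 1)" if s: "s \<in> {0<..<\<delta>}" for s
  proof -
    note m = half_chord_bounds[of s]
    have s01: "0 < s" "s < 1" using s \<delta> by auto
    have cos: "0 \<le> cos (s / 2)" using s01 pi_gt3 by (intro cos_ge_zero) auto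
    have "norm (complex_of_real (cot (s / 2) / 2)) = \<bar>cot (s / 2) / 2\<bar>"
      by (rule norm_of_real)
    also have "\<dots> = cos (s / 2) / (2 * sin (s / 2))"
      using m s01 cos by (simp add: cot_def)
    also have "\<dots> \<le> 1 / (s / 2)"
      using m s01 cos by (intro frac_le) auto
    finally have c: "norm (complex_of_real (cot (s / 2) / 2)) \<le> 2 / s" by simp
    have "norm (\<rho> * of_real (cot (s / 2) / 2) + b s) \<le>
        norm \<rho> * norm (complex_of_real (cot (s / 2) / 2)) + norm (b s)"
      using norm_triangle_ineq[of "\<rho> * of_real (cot (s / 2) / 2)" "b s"] by (simp only: norm_mult)
    also have "\<dots> \<le> norm \<rho> * (2 / s) + B * (1 / s)"
    proof (intro add_mono mult_left_mono c)
      have "norm (b s) \<le> B * 1" using B[of s] s by simp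
      also have "\<dots> \<le> B * (1 / s)" using \<open>B \<ge> 0\<close> s01 by (intro mult_left_mono) auto
      finally show "norm (b s) \<le> B * (1 / s)" .
    qed auto
    also have "\<dots> = (2 * norm \<rho> + B) / s" by (simp add: add_divide_distrib)
    finally have "norm ((\<rho> * of_real (cot (s / 2) / 2) + b s) * g s) \<le>
        (2 * norm \<rho> + B) / s * (C * s powr \<alpha>)"
      unfolding norm_mult[of _ "g s"] using g_le[OF s] \<open>B \<ge> 0\<close> s01 by (intro mult_mono) auto
    also have "\<dots> = K * s powr (\<alpha> - 1)"
      using s01 by (simp add: K_def powr_diff)
    finally show ?thesis .
  qed
  have less: "norm (g t - g s) \<le> K / \<alpha> * (t
      - s) powr \<alpha>" if s: "s \<in> {0<..<\<delta>}" and t: "t \<in> {0<..<\<delta>}" and "s < t" for s t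
  proof -
    have "norm (g t - g s) \<le> K / \<alpha> * t powr \<alpha> - K / \<alpha> * s powr \<alpha>"
    proof (rule differentiable_bound_general[OF \<open>s < t\<close>])
      have "isCont g x" if "x \<in> {s..t}" for x
        using has_vector_derivative_continuous[OF der[of x]] s t that by simp
      then show "continuous_on {s..t} g" by (intro continuous_at_imp_continuous_on) auto
      show "continuous_on {s..t} (\<lambda>x. K / \<alpha> * x powr \<alpha>)"
        using s by (intro continuous_intros) auto
      show "(g has_vector_derivative (\<rho> * of_real (cot (x / 2) / 2) + b x) * g x) (at x)"
          if "s < x" "x < t" for x
        using der s t that by simp
      show "((\<lambda>x. K / \<alpha> * x powr \<alpha>) has_vector_derivative K * x powr (\<alpha> - 1)) (at x)"
          if "s < x" "x < t" for x
        using s that \<alpha> unfolding has_real_derivative_iff_has_vector_derivative[symmetric]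
        by (auto intro!: derivative_eq_intros)
      show "norm ((\<rho> * of_real (cot (x / 2) / 2) + b x) * g x) \<le> K * x powr (\<alpha> - 1)"
          if "s < x" "x < t" for x
        using der_le s t that by simp
    qed
    also have "\<dots> = K / \<alpha> * (t powr \<alpha> - s powr \<alpha>)" by (simp add: algebra_simps)
    also have "\<dots> \<le> K / \<alpha> * (t - s) powr \<alpha>"
      using s \<open>s < t\<close> \<alpha> \<open>K \<ge> 0\<close> by (intro mult_left_mono powr_diff_le) auto
    finally show ?thesis .
  qed
  have K': "norm (g s - g t) \<le> K / \<alpha> * \<bar>s - t\<bar> powr \<alpha>" if s: "s \<in> {0<..<\<delta>}" and t: "t \<in> {0<..<\<delta>}"
      for s t
    using less[OF s t] less[OF t s] by (cases s t rule: linorder_cases)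
        (auto simp: norm_minus_commute)
  show "\<exists>K\<ge>0. \<forall>s\<in>{0<..<\<delta>}. norm (g s) \<le> K * s powr \<alpha> \<and>
      (\<forall>t\<in>{0<..<\<delta>}. norm (g s - g t) \<le> K * \<bar>s - t\<bar> powr \<alpha>)"
  proof (intro exI[of _ "max C (K / \<alpha>)"] conjI ballI)
    show "norm (g s) \<le> max C (K / \<alpha>) * s powr \<alpha>" if "s \<in> {0<..<\<delta>}" for s
      using g_le[OF that] mult_right_mono[of C "max C (K / \<alpha>)" "s powr \<alpha>"] by simp
    show "norm (g s - g t) \<le> max C (K / \<alpha>) * \<bar>s - t\<bar> powr \<alpha>"
        if "s \<in> {0<..<\<delta>}" "t \<in> {0<..<\<delta>}" for s t
      using K'[OF that] mult_right_mono[of "K / \<alpha>" "max C (K / \<alpha>)" "\<bar>s - t\<bar> powr \<alpha>"] by simp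
  qed (use \<open>C \<ge> 0\<close> in auto)
qed

text \<open>The logarithmic derivative of \<open>cis t - 1\<close> in \<open>t\<close>: the real
  part belongs to the chord length, the constant imaginary part to its direction, which turns at
  half speed.\<close>

lemma cis_div_cis_minus_one:
  assumes "sin (t / 2) \<noteq> 0"
  shows "\<i> * cis t / (cis t - 1) = of_real (cot (t / 2) / 2) + \<i> / 2"
proof -
  have t: "cis t = cis (t / 2) * cis (t / 2)" by (simp add: cis_mult)
  have "cis t - 1 = cis (t / 2) * (cis (t / 2) - cis (- (t / 2)))"
    unfolding t by (simp add: right_diff_distrib cis_mult)
  also have "cis (t / 2) - cis (- (t / 2)) = 2 * \<i> * of_real (sin (t / 2))"
    by (simp add: complex_eq_iff)
  finally have d: "cis t - 1 = cis (t / 2) * (2 * \<i> * of_real (sin (t / 2)))" .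
  have "\<i> * cis t / (cis t - 1) = cis (t / 2) / (2 * of_real (sin (t / 2)))"
    unfolding d by (subst t) (use assms in simp)
  also have "\<dots> = of_real (cot (t / 2) / 2) + \<i> / 2"
    using assms by (simp add: complex_eq_iff cot_def Re_divide_of_real[of _ "2
        * sin (t/2)", simplified] Im_divide_of_real[of _ "2 * sin (t/2)", simplified])
  finally show ?thesis .
qed

text \<open>The sign \<open>\<sigma>\<close> selects one of the two arcs that end at
  \<open>a\<close>; pulling \<open>w\<close> back to the angle turns its differential equation into
  that of \<open>ode_hoelder\<close>. The exponent is set to 1 if \<open>Re \<rho> \<le> 0\<close>,
  where only the zero arc survives and any exponent serves; thus both arcs have the same
  \<alpha>.\<close>

lemma semiclassical_arc_hoelder:
  fixes w :: "complex \<Rightarrow> complex" and \<sigma> :: real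
  assumes D: "open D" "w holomorphic_on D" "\<And>x. x \<in> D \<Longrightarrow> w x \<noteq> 0"
    and der: "\<And>x. x \<in> D \<Longrightarrow> deriv w x = w x * (\<rho> / (x - a) + B x)"
    and \<sigma>: "\<sigma> = 1 \<or> \<sigma> = -1"
    and \<delta>: "0 < \<delta>" "\<delta> \<le> 1"
    and B: "continuous_on ((\<lambda>s. a * cis (\<sigma> * s)) ` {0..\<delta>}) B"
    and arc: "\<And>s. s \<in> {0<..<\<delta>} \<Longrightarrow> a * cis (\<sigma> * s) \<in> D \<or>
      (\<forall>\<^sub>F x in nhds (a * cis (\<sigma> * s)). x \<in> sphere 0 1 \<longrightarrow> w x = 0)"
    and a: "norm a = 1"
    and int: "circle_integrable (\<lambda>x. w x / (x - a))"
    and \<alpha>: "\<alpha> = (if Re \<rho> > 0 then min 1 (Re \<rho>) else 1)"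
  shows "\<exists>K\<ge>0. \<forall>s\<in>{0<..<\<delta>}. norm (w (a * cis (\<sigma> * s))) \<le> K * s powr \<alpha> \<and>
      (\<forall>t\<in>{0<..<\<delta>}. norm (w (a * cis (\<sigma> * s)) - w (a * cis (\<sigma> * t))) \<le> K * \<bar>s - t\<bar> powr \<alpha>)"
proof -
  define e where "e = (\<lambda>s. a * cis (\<sigma> * s))"
  define g where "g = (\<lambda>s. w (e s))"
  have \<sigma>2: "complex_of_real \<sigma> * of_real \<sigma> = 1" using \<sigma> by auto
  have "a \<noteq> 0" using a by auto
  have e_cont: "continuous_on A e" for A
    unfolding e_def by (intro continuous_intros)
  have e_der: "(e has_vector_derivative \<i> * of_real \<sigma> * e s) (at s)" for s
  proof -
    have "((\<lambda>s. \<i> * of_real (\<sigma> * s)) has_vector_derivative \<i> * of_real \<sigma>) (at s)"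
      by (auto intro!: derivative_eq_intros has_vector_derivative_of_real
          has_vector_derivative_mult_right)
    then have "(exp \<circ> (\<lambda>s. \<i> * of_real (\<sigma> * s)) has_vector_derivative \<i> * of_real \<sigma>
        * exp (\<i> * of_real (\<sigma> * s))) (at s)"
      by (rule field_vector_diff_chain_at) (rule DERIV_exp)
    then have "((\<lambda>s. a * cis (\<sigma> * s)) has_vector_derivative a * (\<i> * of_real \<sigma> * cis (\<sigma> * s)))
        (at s)"
      unfolding cis_conv_exp comp_def by (rule has_vector_derivative_mult_right)
    then show ?thesis by (simp add: e_def mult_ac)
  qed
  have sin_nz: "sin (\<sigma> * s / 2) \<noteq> 0" if "s \<in> {0<..<\<delta>}" for s
    using half_chord_bounds(3)[of s] that \<delta> \<sigma> by auto
  have e_sphere: "e s \<in> sphere 0 1" for s using a by (simp add: e_def norm_mult)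
  \<comment> \<open>\<open>U\<close> and \<open>Z\<close> are open, cover the parameter interval and
    are disjoint, since \<open>w\<close> has no zeros in \<open>D\<close>. By connectedness
    \<open>w\<close> either vanishes on the whole arc or the arc lies in \<open>D\<close>.\<close>
  define U where "U = {s \<in> {0<..<\<delta>}. e s \<in> D}"
  define Z where "Z = {s \<in> {0<..<\<delta>}. \<forall>\<^sub>F x in nhds (e s). x \<in> sphere 0 1 \<longrightarrow> w x = 0}"
  have "open U"
  proof -
    have "open ({0<..<\<delta>} \<inter> e -` D)"
      using e_cont D(1) by (intro open_Int open_vimage) auto
    then show ?thesis by (simp add: U_def vimage_def Int_def)
  qed
  moreover have "open Z"
  proof -
    have "open {x. \<forall>\<^sub>F y in nhds x. y \<in> sphere 0 1 \<longrightarrow> w y = 0}"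
      unfolding open_subopen[of "{x. \<forall>\<^sub>F y in nhds x. y \<in> sphere 0 1 \<longrightarrow> w y = 0}"]
      by (auto simp: eventually_nhds)
    then have "open ({0<..<\<delta>} \<inter> e -` {x. \<forall>\<^sub>F y in nhds x. y \<in> sphere 0 1 \<longrightarrow> w y = 0})"
      using e_cont by (intro open_Int open_vimage) auto
    then show ?thesis by (simp add: Z_def vimage_def Int_def)
  qed
  moreover have "{0<..<\<delta>} \<subseteq> U \<union> Z" using arc unfolding U_def Z_def e_def by blast
  moreover have "U \<inter> Z \<inter> {0<..<\<delta>} = {}"
    using D(3) e_sphere by (auto simp: U_def Z_def dest!: eventually_nhds_x_imp_x)
  moreover have "connected {0<..<\<delta>}" by (rule connected_Ioo)
  ultimately consider "U \<inter> {0<..<\<delta>} = {}" | "Z \<inter> {0<..<\<delta>} = {}"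
    using connectedD[of "{0<..<\<delta>}" U Z] by blast
  then show ?thesis
  proof cases
    case 1
    have "w (a * cis (\<sigma> * s)) = 0" if "s \<in> {0<..<\<delta>}" for s
    proof -
      have "s \<in> Z" using 1 that \<open>{0<..<\<delta>} \<subseteq> U \<union> Z\<close> by blast
      then have "\<forall>\<^sub>F x in nhds (e s). x \<in> sphere 0 1 \<longrightarrow> w x = 0" by (simp add: Z_def)
      then have "w (e s) = 0" using eventually_nhds_x_imp_x e_sphere by blast
      then show ?thesis by (simp add: e_def)
    qed
    then show ?thesis by (intro exI[of _ 0]) auto
  next
    case 2
    have eD: "e s \<in> D" if "s \<in> {0<..<\<delta>}" for s
    proof -
      have "s \<in> U" using 2 that \<open>{0<..<\<delta>} \<subseteq> U \<union> Z\<close> by blast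
      then show ?thesis by (simp add: U_def)
    qed
    \<comment> \<open>All that is regular at \<open>a\<close>: the direction term of the chord and
      the contribution of the other singularities.\<close>
    define b where "b = (\<lambda>s. \<i> * of_real \<sigma> * (\<rho> / 2 + e s * B (e s)))"
    have b': "b s = \<i> * of_real \<sigma> * \<rho> / 2 + \<i> * of_real \<sigma> * (e s * B (e s))" for s
      by (simp add: b_def algebra_simps)
    have g_der: "(g has_vector_derivative (\<rho> * of_real (cot (s / 2) / 2) + b s) * g s) (at s)"
      if s: "s \<in> {0<..<\<delta>}" for s
    proof -
      have "(w has_field_derivative deriv w (e s)) (at (e s))"
        using D eD[OF s] by (metis holomorphic_derivI)
      with e_der[of s] have "(w \<circ> e has_vector_derivative \<i> * of_real \<sigma> * e s * deriv w (e s))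
          (at s)"
        by (rule field_vector_diff_chain_at)
      moreover have "\<i> * of_real \<sigma> * e s * deriv w (e s) =
          (\<rho> * of_real (cot (s / 2) / 2) + b s) * g s"
      proof -
        have "\<i> * e s / (e s - a) = \<i> * cis (\<sigma> * s) / (cis (\<sigma> * s) - 1)"
        proof -
          have "e s - a = a * (cis (\<sigma> * s) - 1)" by (simp add: e_def algebra_simps)
          then show ?thesis using \<open>a \<noteq> 0\<close> by (simp add: e_def)
        qed
        also have "\<dots> = of_real (cot (\<sigma> * s / 2) / 2) + \<i> / 2"
          using sin_nz[OF s] by (rule cis_div_cis_minus_one)
        also have "cot (\<sigma> * s / 2) = \<sigma> * cot (s / 2)"
          using \<sigma> by (auto simp: cot_def)
        finally have k: "\<i> * e s / (e s - a) = of_real (\<sigma> * cot (s / 2) / 2) + \<i> / 2" .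
        have "\<i> * of_real \<sigma> * e s * deriv w (e s) =
            (\<rho> * (of_real \<sigma> * (\<i> * e s / (e s - a))) + \<i> * of_real \<sigma> * (e s * B (e s))) * g s"
          unfolding der[OF eD[OF s]] g_def by (simp add: algebra_simps)
        also have "of_real \<sigma> * (\<i> * e s / (e s - a)) =
            (of_real \<sigma> * of_real \<sigma>) * of_real (cot (s / 2) / 2) + \<i> * of_real \<sigma> / 2"
          unfolding k by (simp add: algebra_simps)
        finally show ?thesis
          unfolding \<sigma>2 b' by (simp add: algebra_simps)
      qed
      ultimately show ?thesis by (simp add: g_def comp_def)
    qed
    have b_cont: "continuous_on {0..\<delta>} b"
      unfolding b_def using B
      by (intro continuous_intros e_cont continuous_on_compose2[OF B e_cont]) (auto simp: e_def)
    have "g (\<delta> / 2) \<noteq> 0" using D(3) eD[of "\<delta> / 2"] \<delta> by (simp add: g_def)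
    then have nz: "\<exists>s\<in>{0<..<\<delta>}. g s \<noteq> 0" using \<delta> by (intro bexI[of _ "\<delta> / 2"]) auto
    \<comment> \<open>After rotation, and reflection for \<open>\<sigma> = -1\<close>, integrability
      of \<open>w / (x - a)\<close> carries over because the chord is at most the angle
      \<open>s\<close>.\<close>
    have int_g: "set_integrable lborel {0<..<\<delta>} (\<lambda>s. norm (g s) / s)"
    proof -
      have rot: "circle_integrable (\<lambda>x. w (a * x) / (a * x - a))"
        by (rule circle_rotate(1)[OF int a])
      have "set_integrable lborel {0..2*pi} (\<lambda>s. w (e s) / (e s - a))"
      proof (cases "\<sigma> = 1")
        case False
        have inv: "1 / cis s = cis (- s)" for s by (metis cis_inverse inverse_eq_divide)
        have "\<sigma> = -1" using \<sigma> False by simp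
        then show ?thesis
          using circle_integrable_inverse[OF rot] unfolding circle_integrable_def inv e_def by simp
      qed (use rot in \<open>simp add: circle_integrable_def e_def\<close>)
      then have "set_integrable lborel {0<..<\<delta>} (\<lambda>s. w (e s) / (e s - a))"
        by (rule set_integrable_subset) (use \<delta> pi_gt3 in auto)
      then have i: "integrable lborel (\<lambda>s. indicat_real {0<..<\<delta>} s *\<^sub>R (g s / (e s - a)))"
        by (simp add: set_integrable_def g_def)
      have [measurable]: "(\<lambda>s. indicat_real {0<..<\<delta>} s *\<^sub>R (g s / (e s - a))) \<in> borel_measurable
          lborel"
        using i by (rule borel_measurable_integrable)
      have [measurable]: "e \<in> borel_measurable borel"
        by (rule borel_measurable_continuous_onI[OF e_cont])
      have chord: "norm (e s - a) \<le> s" "e s - a \<noteq> 0" if s: "s \<in> {0<..<\<delta>}" for s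
      proof -
        have "e s - a = a * (cis (\<sigma> * s) - 1)" by (simp add: e_def algebra_simps)
        then have "norm (e s - a) = 2 * \<bar>sin (\<sigma> * s / 2)\<bar>" using a
            by (simp add: norm_mult norm_cis_diff_one)
        also have "\<dots> = 2 * sin (s / 2)" using half_chord_bounds(3)[of s] s \<delta> \<sigma> by auto
        finally have *: "norm (e s - a) = 2 * sin (s / 2)" .
        show "norm (e s - a) \<le> s" using half_chord_bounds(2)[of s] s \<delta> * by simp
        show "e s - a \<noteq> 0" using half_chord_bounds(3)[of s] s \<delta> * by auto
      qed
      show ?thesis
        unfolding set_integrable_def
      proof (rule Bochner_Integration.integrable_bound[OF i])
        have "(\<lambda>s. norm ((indicat_real {0<..<\<delta>} s *\<^sub>R (g s / (e s - a))) * (e s - a)) / s) \<in>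
            borel_measurable lborel"
          by measurable
        also have "(\<lambda>s. norm ((indicat_real {0<..<\<delta>} s *\<^sub>R (g s / (e s - a))) * (e s - a)) / s) =
            (\<lambda>s. indicat_real {0<..<\<delta>} s *\<^sub>R (norm (g s) / s))"
        proof
          fix s
          show "norm ((indicat_real {0<..<\<delta>} s *\<^sub>R (g s / (e s - a))) * (e s - a)) / s =
              indicat_real {0<..<\<delta>} s *\<^sub>R (norm (g s) / s)"
            using chord(2)[of s] by (cases "s \<in> {0<..<\<delta>}") auto
        qed
        finally show "(\<lambda>s. indicat_real {0<..<\<delta>} s *\<^sub>R (norm (g s) / s)) \<in> borel_measurable
            lborel" .
        show "AE s in lborel. norm (indicat_real {0<..<\<delta>} s *\<^sub>R (norm (g s) / s)) \<le>
            norm (indicat_real {0<..<\<delta>} s *\<^sub>R (g s / (e s - a)))"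
        proof (rule AE_I2)
          fix s
          show "norm (indicat_real {0<..<\<delta>} s *\<^sub>R (norm (g s) / s)) \<le>
            norm (indicat_real {0<..<\<delta>} s *\<^sub>R (g s / (e s - a)))"
          proof (cases "s \<in> {0<..<\<delta>}")
            case True
            then have "norm (g s) / s \<le> norm (g s) / norm (e s - a)"
              using chord[of s] by (intro divide_left_mono) auto
            then show ?thesis using True by (simp add: norm_divide)
          qed simp
        qed
      qed
    qed
    note * = ode_hoelder[OF \<delta> g_der b_cont nz int_g refl]
    have "\<alpha> = min 1 (Re \<rho>)" using *(1) \<alpha> by simp
    then show ?thesis using *(2) by (simp add: g_def e_def)
  qed
qed

text \<open>The value at the singularity is set to 0, as that of \<open>w\<close> is arbitrary
  there. With it the one-sided estimates fit together across the point, even if the constant factors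
  of the two arcs differ.\<close>

lemma semiclassical_local_hoelder:
  assumes rs: "regular_semiclassical M zs \<rho> D w" and j: "j \<le> M" and a: "norm (zs j) = 1"
    and int: "circle_integrable (\<lambda>x. w x / (x - zs j))"
  obtains \<eta> K \<alpha> where "\<eta> > 0" "K \<ge> 0" "0 < \<alpha>" "\<alpha> \<le> 1"
    "\<And>x y. x \<in> sphere 0 1 \<Longrightarrow> y \<in> sphere 0 1 \<Longrightarrow> norm (x - zs j) < \<eta> \<Longrightarrow> norm (y - zs j) < \<eta> \<Longrightarrow>
      norm ((if x = zs j then 0 else w x) - (if y = zs j then 0 else w y)) \<le>
          K * norm (x - y) powr \<alpha>"
proof -
  define a where "a = zs j"
  have a1: "norm a = 1" and "a \<noteq> 0" using a by (auto simp: a_def)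
  have inj: "inj_on zs {..M}" and D: "open D" "w holomorphic_on D" "\<And>x. x \<in> D \<Longrightarrow> w x \<noteq> 0"
    and disj: "D \<inter> zs ` {..M} = {}"
    using rs by (auto simp: regular_semiclassical_def)
  obtain V where V: "\<And>x. x \<notin> zs ` {..M} \<Longrightarrow>
      2 * poly V x / poly (\<Prod>j\<le>M. [:- zs j, 1:]) x = (\<Sum>j\<le>M. \<rho> j / (x - zs j))"
      "\<And>x. x \<in> D \<Longrightarrow> deriv w x / w x = 2 * poly V x / poly (\<Prod>j\<le>M. [:- zs j, 1:]) x"
    using rs unfolding regular_semiclassical_def Let_def by blast
  obtain S where S: "finite S"
      "\<And>\<zeta>. \<zeta> \<in> sphere 0 1 \<Longrightarrow> \<zeta> \<notin> S \<Longrightarrow> \<zeta> \<in> D \<or> (\<forall>\<^sub>F x in nhds \<zeta>. x \<in> sphere 0 1 \<longrightarrow> w x = 0)"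
    using rs unfolding regular_semiclassical_def by blast
  define B where "B = (\<lambda>x. \<Sum>k\<in>{..M} - {j}. \<rho> k / (x - zs k))"
  have der: "deriv w x = w x * (\<rho> j / (x - a) + B x)" if "x \<in> D" for x
  proof -
    have "x \<notin> zs ` {..M}" using that disj by auto
    then have "deriv w x / w x = (\<Sum>k\<le>M. \<rho> k / (x - zs k))"
      using V that by simp
    also have "\<dots> = \<rho> j / (x - a) + B x"
      using j by (simp add: B_def a_def sum.remove)
    finally show ?thesis using D(3)[OF that] by (simp add: field_simps)
  qed
  \<comment> \<open>The other exceptional points; being finitely many, they keep a positive distance
    from \<open>a\<close>.\<close>
  define T where "T = (S \<union> zs ` {..M}) - {a}"
  have "finite T" using S by (simp add: T_def)
  then have "open (- T)" by (simp add: finite_imp_closed open_Compl)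
  moreover have "a \<in> - T" by (simp add: T_def)
  ultimately obtain e where e: "e > 0" "ball a e \<subseteq> - T"
    using open_contains_ball by blast
  define \<delta> where "\<delta> = min 1 (e / 2)"
  have \<delta>: "0 < \<delta>" "\<delta> \<le> 1" "\<delta> < e" using e by (auto simp: \<delta>_def)
  have norm_diff: "norm (a * cis s - a * cis t) = norm (cis (s - t) - 1)" for s t
  proof -
    have "a * cis s - a * cis t = a * cis t * (cis (s - t) - 1)"
      by (simp add: algebra_simps cis_mult)
    then show ?thesis using a1 by (simp add: norm_mult)
  qed
  have norm_diff0: "norm (a * cis s - a) = norm (cis s - 1)" for s
    using norm_diff[of s 0] by simp
  have notT: "a * cis s \<notin> T" if "\<bar>s\<bar> \<le> \<delta>" for s
  proof -
    have "norm (a * cis s - a) \<le> \<bar>s\<bar>"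
      unfolding norm_diff0 norm_cis_diff_one using abs_sin_x_le_abs_x[of "s / 2"] by simp
    then have "a * cis s \<in> ball a e"
      using that \<delta> by (simp add: dist_norm norm_minus_commute)
    then show ?thesis using e by auto
  qed
  have neq: "a * cis s \<noteq> a" if "s \<noteq> 0" "\<bar>s\<bar> \<le> \<delta>" for s
    using norm_cis_diff_one_ge[of s] norm_diff0[of s] that \<delta> pi_gt3 by auto
  define \<alpha> where "\<alpha> = (if Re (\<rho> j) > 0 then min 1 (Re (\<rho> j)) else 1)"
  have \<alpha>: "0 < \<alpha>" "\<alpha> \<le> 1" by (auto simp: \<alpha>_def)
  have "\<exists>K\<ge>0. \<forall>s\<in>{0<..<\<delta>}. norm (w (a * cis (\<sigma> * s))) \<le> K * s powr \<alpha> \<and>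
      (\<forall>t\<in>{0<..<\<delta>}. norm (w (a * cis (\<sigma> * s)) - w (a * cis (\<sigma> * t))) \<le> K * \<bar>s - t\<bar> powr \<alpha>)"
    if \<sigma>: "\<sigma> = 1 \<or> \<sigma> = -1" for \<sigma> :: real
  proof (rule semiclassical_arc_hoelder[OF D der \<sigma> \<delta>(1,2) _ _ a1 int[folded a_def] \<alpha>_def])
    have "a * cis (\<sigma> * s) \<noteq> zs k" if "s \<in> {0..\<delta>}" "k \<in> {..M} - {j}" for s k
    proof -
      have "zs k \<in> T" using that inj j by (auto simp: T_def a_def inj_on_def)
      then show ?thesis using notT[of "\<sigma> * s"] that \<sigma> by auto
    qed
    then show "continuous_on ((\<lambda>s. a * cis (\<sigma> * s)) ` {0..\<delta>}) B"
      unfolding B_def by (intro continuous_intros) auto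
    show "a * cis (\<sigma> * s) \<in> D \<or> (\<forall>\<^sub>F x in nhds (a * cis (\<sigma> * s)). x \<in> sphere 0 1 \<longrightarrow> w x = 0)"
      if "s \<in> {0<..<\<delta>}" for s
    proof (rule S(2))
      show "a * cis (\<sigma> * s) \<in> sphere 0 1" using a1 by (simp add: norm_mult)
      have "\<sigma> * s \<noteq> 0" "\<bar>\<sigma> * s\<bar> \<le> \<delta>" using that \<sigma> by auto
      then show "a * cis (\<sigma> * s) \<notin> S" using notT[of "\<sigma> * s"] neq[of "\<sigma> * s"] by (auto simp: T_def)
    qed
  qed
  from this[of 1] this[of "-1"] obtain K1 K2 where
    K1: "K1 \<ge> 0" "\<And>s. s \<in> {0<..<\<delta>} \<Longrightarrow> norm (w (a * cis s)) \<le> K1 * s powr \<alpha>"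
      "\<And>s t. s \<in> {0<..<\<delta>} \<Longrightarrow> t \<in> {0<..<\<delta>} \<Longrightarrow>
          norm (w (a * cis s) - w (a * cis t)) \<le> K1 * \<bar>s - t\<bar> powr \<alpha>" and
    K2: "K2 \<ge> 0" "\<And>s. s \<in> {0<..<\<delta>} \<Longrightarrow> norm (w (a * cis (- s))) \<le> K2 * s powr \<alpha>"
      "\<And>s t. s \<in> {0<..<\<delta>} \<Longrightarrow> t \<in> {0<..<\<delta>} \<Longrightarrow>
          norm (w (a * cis (- s)) - w (a * cis (- t))) \<le> K2 * \<bar>s - t\<bar> powr \<alpha>"
    by auto
  define K where "K = max K1 K2"
  have K: "K \<ge> 0" "K1 \<le> K" "K2 \<le> K" using K1(1) by (auto simp: K_def)
  define U where "U = (\<lambda>t. if a * cis t = a then 0 else w (a * cis t))"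
  have U0: "U 0 = 0" by (simp add: U_def)
  have U: "U t = w (a * cis t)" if "t \<noteq> 0" "\<bar>t\<bar> < \<delta>" for t
    using neq[of t] that by (simp add: U_def)
  have U_le: "norm (U t) \<le> K * \<bar>t\<bar> powr \<alpha>" if t: "\<bar>t\<bar> < \<delta>" for t
  proof (cases t "0 :: real" rule: linorder_cases)
    case less
    then have "norm (U t) \<le> K2 * \<bar>t\<bar> powr \<alpha>" using K2(2)[of "- t"] U[of t] t by simp
    also have "\<dots> \<le> K * \<bar>t\<bar> powr \<alpha>" using K by (intro mult_right_mono) auto
    finally show ?thesis .
  next
    case greater
    then have "norm (U t) \<le> K1 * \<bar>t\<bar> powr \<alpha>" using K1(2)[of t] U[of t] t by simp
    also have "\<dots> \<le> K * \<bar>t\<bar> powr \<alpha>" using K by (intro mult_right_mono) auto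
    finally show ?thesis .
  qed (simp add: U0)
  have U_diff: "norm (U s - U t) \<le> 2 * K * \<bar>s - t\<bar> powr \<alpha>" if s: "\<bar>s\<bar> < \<delta>" and t: "\<bar>t\<bar> < \<delta>" for s t
  proof -
    have mono: "C * \<bar>s - t\<bar> powr \<alpha> \<le> 2 * K * \<bar>s - t\<bar> powr \<alpha>" if "C \<le> K" for C
      using that K by (intro mult_right_mono) auto
    \<comment> \<open>On opposite sides of \<open>a\<close>, or at \<open>a\<close>, both angles are
      at most their distance, so the bounds on the two values suffice; they add up to the factor
      2.\<close>
    consider "s > 0 \<and> t > 0" | "s < 0 \<and> t < 0" | "\<bar>s\<bar> \<le> \<bar>s - t\<bar> \<and> \<bar>t\<bar> \<le> \<bar>s - t\<bar>" by linarith
    then show ?thesis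
    proof cases
      case 1
      then show ?thesis using K1(3)[of s t] U[of s] U[of t] s t mono[OF K(2)] by simp
    next
      case 2
      then show ?thesis using K2(3)[of "- s" "- t"] U[of s] U[of t] s t mono[OF K(3)]
        by (simp add: abs_minus_commute)
    next
      case 3
      have "norm (U s - U t) \<le> norm (U s) + norm (U t)" by (rule norm_triangle_ineq4)
      also have "\<dots> \<le> K * \<bar>s\<bar> powr \<alpha> + K * \<bar>t\<bar> powr \<alpha>" using U_le s t by (intro add_mono)
      also have "\<dots> \<le> K * \<bar>s - t\<bar> powr \<alpha> + K * \<bar>s - t\<bar> powr \<alpha>"
        using 3 K \<alpha> by (intro add_mono mult_left_mono powr_mono2) auto
      finally show ?thesis by simp
    qed
  qed
  have param: "\<exists>t. x = a * cis t \<and> \<bar>t\<bar> < \<delta>" if x: "x \<in> sphere 0 1" "norm (x - a) < \<delta> / 2" for x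
  proof -
    define t where "t = Arg (x / a)"
    have "norm (x / a) = 1" using x a1 by (simp add: norm_divide)
    then have "cis t = x / a" using cis_Arg[of "x / a"]
        by (cases "x / a = 0") (auto simp: t_def sgn_eq)
    then have x_eq: "x = a * cis t" using \<open>a \<noteq> 0\<close> by simp
    have "\<bar>t\<bar> \<le> pi" using mpi_less_Arg[of "x / a"] Arg_le_pi[of "x / a"] by (simp add: t_def)
    then have "\<bar>t\<bar> / 2 \<le> norm (x - a)"
      using norm_cis_diff_one_ge[of t] norm_diff0[of t] x_eq by simp
    then show ?thesis using x_eq x by auto
  qed
  show ?thesis
  \<comment> \<open>Passing from angles to chords costs a factor 2 each time: the radius is halved,
    and the constant \<open>2 * K\<close> is doubled because
    \<open>2 powr \<alpha> \<le> 2\<close>.\<close>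
  proof (rule that[of "\<delta> / 2" "4 * K" \<alpha>])
    fix x y assume xy: "x \<in> sphere 0 1" "y \<in> sphere 0 1" "norm (x - zs j) < \<delta> / 2" "norm (y
        - zs j) < \<delta> / 2"
    obtain s where s: "x = a * cis s" "\<bar>s\<bar> < \<delta>" using param[of x] xy by (auto simp: a_def)
    obtain t where t: "y = a * cis t" "\<bar>t\<bar> < \<delta>" using param[of y] xy by (auto simp: a_def)
    have "\<bar>s - t\<bar> \<le> pi" using s(2) t(2) \<delta> pi_gt3 by linarith
    then have "\<bar>s - t\<bar> \<le> 2 * norm (x - y)"
      using norm_cis_diff_one_ge[of "s - t"] norm_diff[of s t] s(1) t(1) by simp
    then have "\<bar>s - t\<bar> powr \<alpha> \<le> (2 * norm (x - y)) powr \<alpha>"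
      using \<alpha> by (intro powr_mono2) auto
    also have "\<dots> = 2 powr \<alpha> * norm (x - y) powr \<alpha>" by (rule powr_mult)
    also have "\<dots> \<le> 2 powr 1 * norm (x - y) powr \<alpha>"
      using \<alpha> by (intro mult_right_mono powr_mono) auto
    finally have "2 * K * \<bar>s - t\<bar> powr \<alpha> \<le> 2 * K * (2 * norm (x - y) powr \<alpha>)"
      using K by (intro mult_left_mono) auto
    with U_diff[OF s(2) t(2)] have "norm (U s - U t) \<le> 4 * K * norm (x - y) powr \<alpha>" by simp
    then show "norm ((if x = zs j then 0 else w x) - (if y = zs j then 0 else w y)) \<le>
        4 * K * norm (x - y) powr \<alpha>"
      by (simp only: U_def s(1) t(1) a_def)
  qed (use \<delta> K \<alpha> in auto)
qed

section \<open>The associated functions\<close>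

lemma moments_exist_imp_circle_integrable: "moments_exist w \<Longrightarrow> circle_integrable w"
  unfolding moments_exist_def circle_integrable_def by (drule spec[of _ 0]) simp

lemma biorthogonal_mean:
  assumes "regular_system w \<kappa> \<phi> \<psi>" "moments_exist w"
  shows "biorthogonal (\<lambda>f. circle_mean (\<lambda>x. w x * f x)) \<phi> \<psi> \<kappa>"
proof -
  interpret circle_functional "\<lambda>f. circle_mean (\<lambda>x. w x * f x)"
    using assms(2) by (intro circle_functional_mean moments_exist_imp_circle_integrable)
  have d: "degree (\<phi> n) = n" "degree (\<psi> n) = n" "lead_coeff (\<phi> n) = \<kappa> n" "lead_coeff (\<psi> n) = \<kappa> n"
      for n
    using assms(1) unfolding regular_system_def biorthogonal_system_def by blast+
  have "coeff (\<phi> n) n = \<kappa> n" "coeff (\<psi> n) n = \<kappa> n" for n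
    using d(3)[of n] d(4)[of n] unfolding d(1,2) by blast+
  note c = this
  have "circle_mean (\<lambda>x. w x * (poly (\<phi> m) x * poly (\<psi> n) (1 / x))) = (if m = n then 1 else 0)"
      for m n
    using assms(1) by (simp add: regular_system_def biorthogonal_system_def mult.assoc)
  then show ?thesis
    by unfold_locales (rule d c | assumption)+
qed

context
  fixes w :: "complex \<Rightarrow> complex" and \<kappa> \<phi> \<psi>
  assumes sys: "regular_system w \<kappa> \<phi> \<psi>" and mom: "moments_exist w"
begin

interpretation S: biorthogonal "\<lambda>f. circle_mean (\<lambda>x. w x * f x)" \<phi> \<psi> \<kappa>
  using sys mom by (rule biorthogonal_mean)

lemma poly_index_0: "poly (\<phi> 0) x = \<kappa> 0" "poly (\<psi> 0) x = \<kappa> 0" "poly (reflect_poly (\<psi> 0)) x = \<kappa> 0"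
proof -
  have *: "p = [:coeff p 0:]" if "degree p = 0" for p :: "complex poly"
    using that by (auto elim!: degree_eq_zeroE)
  have "\<phi> 0 = [:\<kappa> 0:]" "\<psi> 0 = [:\<kappa> 0:]"
    using *[of "\<phi> 0"] *[of "\<psi> 0"] S.degree_phi S.degree_psi S.lead_phi S.lead_psi by metis+
  then show "poly (\<phi> 0) x = \<kappa> 0" "poly (\<psi> 0) x = \<kappa> 0" "poly (reflect_poly (\<psi> 0)) x = \<kappa> 0"
    by simp_all
qed

lemma moment_0: "moment w 0 = circle_mean (\<lambda>x. w x * 1)"
  by (simp add: moment_def)

text \<open>The two splittings of the kernel (x + z)/(x - z): the first suits \<open>xi\<close>, the
  second \<open>xi_star\<close>. In both, the leftover mean of \<open>w f\<close> vanishes for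
  \<open>n \<ge> 1\<close> and cancels against the added moment for \<open>n = 0\<close>.\<close>

lemma schwarz_kernel:
  assumes z: "norm z \<noteq> 1" and f: "continuous_on (sphere 0 1) f"
  shows "circle_mean (\<lambda>x. (x + z) / (x - z) * w x * f x) =
      2 * circle_mean (\<lambda>x. w x * (f x * (x / (x - z)))) - circle_mean (\<lambda>x. w x * f x)"
    and "circle_mean (\<lambda>x. (x + z) / (x - z) * w x * f x) =
      2 * z * circle_mean (\<lambda>x. w x * (f x * (1 / (x - z)))) + circle_mean (\<lambda>x. w x * f x)"
proof -
  have nz: "x - z \<noteq> 0" if "x \<in> sphere 0 1" for x using that z by auto
  have "circle_mean (\<lambda>x. (x + z) / (x - z) * w x * f x) =
      circle_mean (\<lambda>x. w x * (2 * (f x * (x / (x - z))) + (- 1) * f x))"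
  proof (rule circle_mean_cong)
    fix x :: complex assume "x \<in> sphere 0 1"
    then have "(x + z) / (x - z) = 2 * (x / (x - z)) - 1" using nz by (simp add: divide_simps)
    then show "(x + z) / (x - z) * w x * f x = w x * (2 * (f x * (x / (x - z))) + (- 1) * f x)"
      by (simp only:) (simp add: algebra_simps)
  qed
  also have "\<dots> = 2 * circle_mean (\<lambda>x. w x * (f x * (x / (x - z))))
      + (- 1) * circle_mean (\<lambda>x. w x * f x)"
    using nz f by (intro S.L_lincomb) (auto intro!: continuous_intros)
  finally show "circle_mean (\<lambda>x. (x + z) / (x - z) * w x * f x) =
      2 * circle_mean (\<lambda>x. w x * (f x * (x / (x - z)))) - circle_mean (\<lambda>x. w x * f x)" by simp
  have "circle_mean (\<lambda>x. (x + z) / (x - z) * w x * f x) =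
      circle_mean (\<lambda>x. w x * ((2 * z) * (f x * (1 / (x - z))) + 1 * f x))"
  proof (rule circle_mean_cong)
    fix x :: complex assume "x \<in> sphere 0 1"
    then have "(x + z) / (x - z) = 2 * z * (1 / (x - z)) + 1" using nz by (simp add: divide_simps)
    then show "(x + z) / (x - z) * w x * f x = w x * ((2 * z) * (f x * (1 / (x - z))) + 1 * f x)"
      by (simp only:) (simp add: algebra_simps)
  qed
  also have "\<dots> = (2 * z) * circle_mean (\<lambda>x. w x * (f x * (1 / (x - z))))
      + 1 * circle_mean (\<lambda>x. w x * f x)"
    using nz f by (intro S.L_lincomb) (auto intro!: continuous_intros)
  finally show "circle_mean (\<lambda>x. (x + z) / (x - z) * w x * f x) =
      2 * z * circle_mean (\<lambda>x. w x * (f x * (1 / (x - z)))) + circle_mean (\<lambda>x. w x * f x)" by simp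
qed

lemma xi_eq:
  assumes z: "norm z \<noteq> 1"
  shows "xi w \<kappa> \<phi> n z = S.cauchy_phi n z"
proof (cases "n = 0")
  case True
  have "caratheodory w z = 2 * circle_mean (\<lambda>x. w x * (1 * (x / (x - z))))
      - circle_mean (\<lambda>x. w x * 1)"
    using schwarz_kernel(1)[OF z, of "\<lambda>x. 1"] by (simp add: caratheodory_def continuous_intros)
  moreover have "continuous_on (sphere 0 1) (\<lambda>x. x / (x - z))"
    using z by (intro continuous_intros) auto
  then have "circle_mean (\<lambda>x. w x * (\<kappa> 0 * (x / (x - z)))) =
      \<kappa> 0 * circle_mean (\<lambda>x. w x * (x / (x - z)))"
    by (rule S.L_scale)
  ultimately show ?thesis
    using True by (simp add: xi_def S.cauchy_phi_def moment_0 poly_index_0)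
next
  case False
  then show ?thesis
    using schwarz_kernel(1)[OF z, of "poly (\<phi> n)"] S.L_phi_eq_0[of n]
    by (simp add: xi_def S.cauchy_phi_def continuous_intros)
qed

text \<open>On the circle \<open>\<psi> n\<close> at \<open>1 / x\<close> is the reversed polynomial
  over \<open>x ^ n\<close>; \<open>resolvent_star\<close> with \<open>k = n\<close> cancels that
  power against the factor \<open>z ^ n\<close>.\<close>

lemma xi_star_eq:
  assumes z: "norm z \<noteq> 1"
  shows "xi_star w \<kappa> \<psi> n z = S.cauchy_star n z"
proof (cases "n = 0")
  case True
  have "caratheodory w z = 2 * z * circle_mean (\<lambda>x. w x * (1 * (1 / (x - z))))
      + circle_mean (\<lambda>x. w x * 1)"
    using schwarz_kernel(2)[OF z, of "\<lambda>x. 1"] by (simp add: caratheodory_def continuous_intros)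
  moreover have "circle_mean (\<lambda>x. w x * (\<kappa> 0 * (1 / (x - z)))) =
      \<kappa> 0 * circle_mean (\<lambda>x. w x * (1 / (x - z)))"
    by (rule S.L_scale) (intro continuous_intros z)
  ultimately show ?thesis
    using True by (simp add: xi_star_def S.cauchy_star_def moment_0 poly_index_0)
next
  case False
  have "circle_mean (\<lambda>x. w x * (poly (\<psi> n) (1 / x))) = 0"
    using biorthogonal.L_phi_eq_0[OF S.dual, of n] False by simp
  moreover have "circle_mean (\<lambda>x. w x * (poly (\<psi> n) (1 / x) * (1 / (x - z)))) =
      circle_mean (\<lambda>x. w x * (poly (S.star n) x * (1 / x ^ n) * (1 / (x - z))))"
    by (rule circle_mean_cong) (use sphere_nonzero in \<open>simp add: S.poly_star\<close>)
  moreover have "continuous_on (sphere 0 1) (\<lambda>x. poly (\<psi> n) (1 / x))"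
    by (intro continuous_intros)
  ultimately have "xi_star w \<kappa> \<psi> n z =
      - (z ^ n) * (2 * z * circle_mean (\<lambda>x. w x
          * (poly (S.star n) x * (1 / x ^ n) * (1 / (x - z)))))"
    using schwarz_kernel(2)[OF z, of "\<lambda>x. poly (\<psi> n) (1 / x)"] False by (simp add: xi_star_def)
  also have "\<dots> = - 2 * z * (z ^ n * circle_mean (\<lambda>x. w x
      * (poly (S.star n) x * (1 / x ^ n) * (1 / (x - z)))))"
    by simp
  also have "\<dots> = S.cauchy_star n z"
    unfolding S.cauchy_star_def using S.resolvent_star[OF z, of n n] by (simp only: order_refl)
  finally show ?thesis .
qed

end

text \<open>Makes the filter of approaches off the circle nontrivial, so that \<open>Lim\<close> in
  \<open>off_circle_value\<close> is determined by convergence.\<close>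

lemma islimpt_compl_unit_circle: "norm a = 1 \<Longrightarrow> a islimpt - sphere 0 (1::real)" for a :: complex
  unfolding islimpt_approachable
proof (intro allI impI)
  fix e :: real assume a: "norm a = 1" and "0 < e"
  define x where "x = of_real (1 + e / 2) * a"
  have "x - a = of_real (e / 2) * a" by (simp add: x_def algebra_simps)
  then have "dist x a = e / 2"
    unfolding dist_norm using a \<open>e > 0\<close> by (simp only: norm_mult norm_of_real)
  moreover have "norm x = 1 + e / 2"
    unfolding x_def norm_mult norm_of_real using a \<open>e > 0\<close> by simp
  ultimately show "\<exists>x'\<in>- sphere 0 1. x' \<noteq> a \<and> dist x' a < e"
    using \<open>e > 0\<close> by (intro bexI[of _ x]) auto
qed

lemma mat_2_mult:
  fixes c :: complex
  shows "(c \<cdot>\<^sub>m mat_of_rows_list 2 [[a11, a12], [a21, a22]])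
      * mat_of_rows_list 2 [[b11, b12], [b21, b22]] =
    mat_of_rows_list 2 [[c * (a11 * b11 + a12 * b21), c * (a11 * b12 + a12 * b22)],
      [c * (a21 * b11 + a22 * b21), c * (a21 * b12 + a22 * b22)]]"
  by (rule eq_matI)
     (auto simp: mat_of_rows_list_def scalar_prod_def less_Suc_eq algebra_simps numeral_2_eq_2)

text \<open>\<open>cauchy_limit_local\<close> is formulated for the kernel x/(x - z); the identity
  1/(x - z) = (x/(x - z) - 1)/z, with \<open>z\<close> away from 0 near the singularity, converts
  it. Changing \<open>w\<close> to 0 at the singular point affects no integral.\<close>

lemma circle_limit_weight:
  assumes rs: "regular_semiclassical M zs \<rho> D w" and j: "j \<le> M" and a: "norm (zs j) = 1"
    and mom: "moments_exist w" and int: "circle_integrable (\<lambda>x. w x / (x - zs j))"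
  shows "((\<lambda>z. circle_mean (\<lambda>x. w x * (1 / (x - z)))) \<longlongrightarrow> circle_mean (\<lambda>x. w x / (x - zs j)))
    (at (zs j) within - sphere 0 1)"
proof -
  define a where "a = zs j"
  have a1: "norm a = 1" and "a \<noteq> 0" using a by (auto simp: a_def)
  define u where "u = (\<lambda>x. if x = a then 0 else w x)"
  have int_w: "circle_integrable w" using mom by (rule moments_exist_imp_circle_integrable)
  have int_u: "circle_integrable u"
    by (rule circle_integrable_cong_except(1)[OF int_w, of a]) (simp add: u_def)
  have int_ua: "circle_integrable (\<lambda>x. u x * (x / (x - a)))"
    by (rule circle_integrable_cong_except(1)[OF
        circle_integrable_bounded_mult[OF int continuous_on_id], of a])
       (simp add: u_def a_def)
  obtain \<eta> K \<alpha> where *: "\<eta> > 0" "K \<ge> 0" "0 < \<alpha>" "\<alpha> \<le> 1"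
    "\<And>x y. x \<in> sphere 0 1 \<Longrightarrow> y \<in> sphere 0 1 \<Longrightarrow> norm (x - a) < \<eta> \<Longrightarrow> norm (y - a) < \<eta> \<Longrightarrow>
      norm (u x - u y) \<le> K * norm (x - y) powr \<alpha>"
    using semiclassical_local_hoelder[OF rs j a int] unfolding u_def a_def by metis
  have lim: "((\<lambda>z. circle_mean (\<lambda>x. u x * (x / (x - z)))) \<longlongrightarrow> circle_mean (\<lambda>x. u x * (x / (x - a))))
      (at a within - sphere 0 1)"
    by (rule cauchy_limit_local[OF int_u int_ua *(5,1-4) a1]) (simp_all add: u_def)
  have "((\<lambda>z. (circle_mean (\<lambda>x. u x * (x / (x - z))) - circle_mean u) / z) \<longlongrightarrow>
      (circle_mean (\<lambda>x. u x * (x / (x - a))) - circle_mean u) / a) (at a within - sphere 0 1)"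
    using \<open>a \<noteq> 0\<close> by (intro tendsto_divide tendsto_diff lim tendsto_const tendsto_ident_at)
  also have "(circle_mean (\<lambda>x. u x * (x / (x - a))) - circle_mean u) / a =
      circle_mean (\<lambda>x. w x / (x - a))"
  proof -
    have "circle_mean (\<lambda>x. u x * (x / (x - a))) - circle_mean u =
        circle_mean (\<lambda>x. u x * (x / (x - a)) - u x)"
      using int_ua int_u by (simp add: circle_mean_diff)
    also have "\<dots> = circle_mean (\<lambda>x. a * (w x / (x - a)))"
      by (rule circle_integrable_cong_except(2)[OF circle_integrable_diff[OF int_ua int_u], of a])
         (simp add: u_def field_simps)
    also have "\<dots> = a * circle_mean (\<lambda>x. w x / (x - a))" by (rule circle_mean_mult)
    finally show ?thesis using \<open>a \<noteq> 0\<close> by simp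
  qed
  finally show ?thesis
    unfolding a_def[symmetric]
  proof (rule Lim_transform_eventually)
    have "\<forall>\<^sub>F z in at a within - sphere 0 1. z \<noteq> 0"
      using tendsto_imp_eventually_ne[OF tendsto_ident_at \<open>a \<noteq> 0\<close>] .
    moreover have "\<forall>\<^sub>F z in at a within - sphere 0 1. z \<in> - sphere 0 1"
      by (simp add: eventually_at_filter)
    ultimately show "\<forall>\<^sub>F z in at a within - sphere 0 1. (circle_mean (\<lambda>x. u x * (x / (x - z)))
        - circle_mean u) / z =
        circle_mean (\<lambda>x. w x * (1 / (x - z)))"
    proof eventually_elim
      case (elim z)
      then have nz: "x - z \<noteq> 0" if "norm x = 1" for x using that by auto
      have c: "continuous_on (sphere 0 1) (\<lambda>x. x / (x - z))"
        using nz by (intro continuous_intros) auto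
      note int_uz = circle_integrable_bounded_mult[OF int_u c]
      have "circle_mean (\<lambda>x. u x * (x / (x - z))) - circle_mean u =
          circle_mean (\<lambda>x. u x * (x / (x - z)) - u x)"
        using int_uz int_u by (simp add: circle_mean_diff)
      also have "\<dots> = circle_mean (\<lambda>x. z * (w x * (1 / (x - z))))"
      proof (rule circle_integrable_cong_except(2)[OF circle_integrable_diff[OF int_uz int_u], of
          a])
        fix x :: complex assume "x \<in> sphere 0 1" "x \<noteq> a"
        then show "u x * (x / (x - z)) - u x = z * (w x * (1 / (x - z)))"
          using nz[of x] by (simp add: u_def field_simps)
      qed
      also have "\<dots> = z * circle_mean (\<lambda>x. w x * (1 / (x - z)))" by (rule circle_mean_mult)
      finally show ?case using elim by simp
    qed
  qed
qed

theorem proposition5p1: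
  fixes M j :: nat
    and zs \<rho> :: "nat \<Rightarrow> complex"
    and D :: "complex set"
    and w :: "complex \<Rightarrow> complex"
    and \<kappa> \<kappa>p \<kappa>m :: "nat \<Rightarrow> complex"
    and \<phi> \<phi>b \<phi>p \<phi>bp \<phi>m \<phi>bm :: "nat \<Rightarrow> complex poly"
  defines "\<xi> \<equiv> \<lambda>n. off_circle_value (xi w \<kappa> \<phi> n) (zs j)"
    and "\<xi>s \<equiv> \<lambda>n. off_circle_value (xi_star w \<kappa> \<phi>b n) (zs j)"
    and "wp \<equiv> \<lambda>z. (z - zs j) * w z"
    and "wm \<equiv> \<lambda>z. w z / (z - zs j)"
  assumes "regular_semiclassical M zs \<rho> D w"
    and "moments_exist w"
    and "regular_system w \<kappa> \<phi> \<phi>b"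
    and "j \<le> M" and "zs j \<noteq> 0"
  shows
    "(moments_exist wp \<and> regular_system wp \<kappa>p \<phi>p \<phi>bp \<and> (\<forall>n. poly (\<phi> n) (zs j) \<noteq> 0) \<longrightarrow>
       (\<forall>n. \<forall>z \<in> D - sphere 0 1.
          Y_matrix wp \<kappa>p \<phi>p \<phi>bp n z =
          ((1 / (z - zs j) * (\<kappa>p n / \<kappa> n)) \<cdot>\<^sub>m
             mat_of_rows_list 2
               [[z - \<kappa> n * poly (\<phi> (n + 1)) (zs j) / (\<kappa> (n + 1) * poly (\<phi> n) (zs j)),
                 poly (\<phi> (n + 1)) 0 / \<kappa> (n + 1)],
                [phi_star \<phi>b n (zs j) / poly (\<phi> n) (zs j) * z,
                 - zs j]])
          * Y_matrix w \<kappa> \<phi> \<phi>b n z))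
     \<and>
     (moments_exist wm \<and> regular_system wm \<kappa>m \<phi>m \<phi>bm \<and> (\<forall>n. \<xi>s n \<noteq> 0) \<longrightarrow>
       (\<forall>n\<ge>1. \<forall>z \<in> D - sphere 0 1.
          Y_matrix wm \<kappa>m \<phi>m \<phi>bm n z =
          ((\<kappa>m n / \<kappa> n) \<cdot>\<^sub>m
             mat_of_rows_list 2
               [[\<kappa> n * \<xi>s n / (\<kappa> (n - 1) * \<xi>s (n - 1)),
                 \<kappa> n * \<xi> n / (\<kappa> (n - 1) * \<xi>s (n - 1))],
                [poly (\<phi>b n) 0 * \<xi>s n / (\<kappa> (n - 1) * \<xi>s (n - 1)) * (z / zs j),
                 1 - \<kappa> n * \<xi>s n / (\<kappa> (n - 1) * \<xi>s (n - 1)) * (z / zs j)]])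
          * Y_matrix w \<kappa> \<phi> \<phi>b n z))"
proof -
  define a where "a = zs j"
  have a0: "a \<noteq> 0" using assms(9) by (simp add: a_def)
  note rs = assms(5) and mom = assms(6) and sys = assms(7) and j = assms(8)
  have D: "w z \<noteq> 0" "z - a \<noteq> 0" "norm z \<noteq> 1" if "z \<in> D - sphere 0 1" for z
    using that rs j by (auto simp: regular_semiclassical_def a_def)
  have bw: "biorthogonal (\<lambda>f. circle_mean (\<lambda>x. w x * f x)) \<phi> \<phi>b \<kappa>"
    using sys mom by (rule biorthogonal_mean)
  interpret W: biorthogonal "\<lambda>f. circle_mean (\<lambda>x. w x * f x)" \<phi> \<phi>b \<kappa> by (rule bw)

  have up: "\<forall>n. \<forall>z \<in> D - sphere 0 1.
      Y_matrix wp \<kappa>p \<phi>p \<phi>bp n z =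
      ((1 / (z - zs j) * (\<kappa>p n / \<kappa> n)) \<cdot>\<^sub>m
         mat_of_rows_list 2
           [[z - \<kappa> n * poly (\<phi> (n + 1)) (zs j) / (\<kappa> (n + 1) * poly (\<phi> n) (zs j)),
             poly (\<phi> (n + 1)) 0 / \<kappa> (n + 1)],
            [phi_star \<phi>b n (zs j) / poly (\<phi> n) (zs j) * z,
             - zs j]])
      * Y_matrix w \<kappa> \<phi> \<phi>b n z"
    if momp: "moments_exist wp" and sysp: "regular_system wp \<kappa>p \<phi>p \<phi>bp" and nz: "\<forall>n. poly (\<phi> n)
        (zs j) \<noteq> 0"
  proof (intro allI ballI)
    fix n z assume z: "z \<in> D - sphere 0 1"
    interpret P: biorthogonal "\<lambda>f. circle_mean (\<lambda>x. wp x * f x)" \<phi>p \<phi>bp \<kappa>p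
      using sysp momp by (rule biorthogonal_mean)
    interpret C: christoffel_step "\<lambda>f. circle_mean (\<lambda>x. w x * f x)" \<phi> \<phi>b \<kappa>
      "\<lambda>f. circle_mean (\<lambda>x. wp x * f x)" \<phi>p \<phi>bp \<kappa>p a
      by unfold_locales (use a0 in \<open>auto simp: wp_def a_def mult_ac\<close>)
    have nza: "poly (\<phi> n) a \<noteq> 0" using nz by (simp add: a_def)
    have wp: "wp z = (z - a) * w z" by (simp add: wp_def a_def)
    note z' = D[OF z]
    have scale: "X = 1 / (z - a) * r * (Q + R)" if "(z - a) * X = r * (Q + R)" for X Q R r
      using that z'(2) by (simp add: field_simps)
    define c where "c = \<kappa> n * poly (\<phi> (Suc n)) a / (\<kappa> (Suc n) * poly (\<phi> n) a)"
    define d where "d = poly (\<phi> (Suc n)) 0 / \<kappa> (Suc n)"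
    define f where "f = poly (W.star n) a / poly (\<phi> n) a"
    define r where "r = \<kappa>p n / \<kappa> n"
    have 1: "poly (\<phi>p n) z = 1 / (z - a) * r * ((z - c) * poly (\<phi> n) z + d * poly (W.star n) z)"
      using C.up_phi[OF nza, of z, folded c_def d_def r_def] by (rule scale)
    have 2: "poly (P.star n) z = 1 / (z - a) * r * (f * z * poly (\<phi> n) z
        + (- a) * poly (W.star n) z)"
      using C.up_star[OF nza, of z, folded f_def r_def] by (intro scale) simp
    have 3: "P.cauchy_phi n z / wp z =
        1 / (z - a) * r * ((z - c) * (W.cauchy_phi n z / w z) + d * (- W.cauchy_star n z / w z))"
      unfolding C.up_cauchy_phi[OF nza z'(3), folded c_def d_def r_def] wp
      using z' by (simp add: divide_simps)
    have 4: "- P.cauchy_star n z / wp z =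
        1 / (z - a) * r * (f * z * (W.cauchy_phi n z / w z) + (- a) * (- W.cauchy_star n z / w z))"
      unfolding C.up_cauchy_star[OF nza z'(3), folded f_def r_def] wp
      using z' by (simp add: divide_simps)
    show "Y_matrix wp \<kappa>p \<phi>p \<phi>bp n z =
      ((1 / (z - zs j) * (\<kappa>p n / \<kappa> n)) \<cdot>\<^sub>m
         mat_of_rows_list 2
           [[z - \<kappa> n * poly (\<phi> (n + 1)) (zs j) / (\<kappa> (n + 1) * poly (\<phi> n) (zs j)),
             poly (\<phi> (n + 1)) 0 / \<kappa> (n + 1)],
            [phi_star \<phi>b n (zs j) / poly (\<phi> n) (zs j) * z,
             - zs j]])
      * Y_matrix w \<kappa> \<phi> \<phi>b n z"
      unfolding Y_matrix_def phi_star_def Suc_eq_plus1[symmetric] a_def[symmetric]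
        c_def[symmetric] d_def[symmetric] f_def[symmetric] r_def[symmetric] mat_2_mult
        xi_eq[OF sys mom z'(3)] xi_star_eq[OF sys mom z'(3)] xi_eq[OF sysp momp z'(3)]
            xi_star_eq[OF sysp momp z'(3)]
      by (simp only: 1 2 3 4)
  qed

  have down: "\<forall>n\<ge>1. \<forall>z \<in> D - sphere 0 1.
      Y_matrix wm \<kappa>m \<phi>m \<phi>bm n z =
      ((\<kappa>m n / \<kappa> n) \<cdot>\<^sub>m
         mat_of_rows_list 2
           [[\<kappa> n * \<xi>s n / (\<kappa> (n - 1) * \<xi>s (n - 1)),
             \<kappa> n * \<xi> n / (\<kappa> (n - 1) * \<xi>s (n - 1))],
            [poly (\<phi>b n) 0 * \<xi>s n / (\<kappa> (n - 1) * \<xi>s (n - 1)) * (z / zs j),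
             1 - \<kappa> n * \<xi>s n / (\<kappa> (n - 1) * \<xi>s (n - 1)) * (z / zs j)]])
      * Y_matrix w \<kappa> \<phi> \<phi>b n z"
    if momm: "moments_exist wm" and sysm: "regular_system wm \<kappa>m \<phi>m \<phi>bm" and nz: "\<forall>n. \<xi>s n \<noteq> 0"
  proof (intro allI impI ballI)
    fix n :: nat and z assume n: "1 \<le> n" and z: "z \<in> D - sphere 0 1"
    interpret N: biorthogonal "\<lambda>f. circle_mean (\<lambda>x. wm x * f x)" \<phi>m \<phi>bm \<kappa>m
      using sysm momm by (rule biorthogonal_mean)
    have int_w: "circle_integrable w" using mom by (rule moments_exist_imp_circle_integrable)
    have int_m: "circle_integrable (\<lambda>x. w x / (x - a))"
      using moments_exist_imp_circle_integrable[OF momm] by (simp add: wm_def a_def)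
    \<comment> \<open>The roles are exchanged: \<open>wm\<close> supplies \<open>L\<close> and the
      given weight supplies \<open>L'\<close>. The defining equation may fail at the point
      \<open>a\<close> itself, which does not affect the mean.\<close>
    interpret C: christoffel_step "\<lambda>f. circle_mean (\<lambda>x. wm x * f x)" \<phi>m \<phi>bm \<kappa>m
      "\<lambda>f. circle_mean (\<lambda>x. w x * f x)" \<phi> \<phi>b \<kappa> a
    proof unfold_locales
      show "circle_mean (\<lambda>x. w x * f x) = circle_mean (\<lambda>x. wm x * ((x - a) * f x))"
        if "continuous_on (sphere 0 1) f" for f
        by (rule circle_integrable_cong_except(2)[OF
            circle_integrable_bounded_mult[OF int_w that], of a])
           (simp add: wm_def a_def)
    qed (rule a0)
    have L_poly: "circle_mean (\<lambda>x. w x * (poly p x * (1 / (x - a)))) =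
        circle_mean (\<lambda>x. wm x * poly p x)" for p
      by (rule circle_mean_cong) (simp add: wm_def a_def)
    have base: "((\<lambda>z. circle_mean (\<lambda>x. w x * (1 / (x - z)))) \<longlongrightarrow> circle_mean (\<lambda>x. wm x * 1))
        (at a within - sphere 0 1)" if "norm a = 1"
      using circle_limit_weight[OF rs j _ mom] that int_m by (simp add: a_def wm_def)
    \<comment> \<open>Off the circle this is evaluation at \<open>a\<close>, where the kernel turns
      \<open>w\<close> into \<open>wm\<close>; on the circle it is the limit supplied by
      \<open>tendsto_resolvent\<close>. The factor \<open>k\<close> will be 2z or -2z.\<close>
    have off: "off_circle_value f a = y"
      if "\<And>z. norm z \<noteq> 1 \<Longrightarrow> f z = k z * circle_mean (\<lambda>x. w x * (poly p x * (1 / (x - z))))"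
        "continuous (at a within - sphere 0 1) k" "y = k a * circle_mean (\<lambda>x. wm x * poly p x)"
            for f k p y
    proof (cases "norm a = 1")
      case False
      then show ?thesis using that by (simp add: off_circle_value_def L_poly del:
          times_divide_eq_right)
    next
      case True
      have "((\<lambda>z. k z * circle_mean (\<lambda>x. w x * (poly p x * (1 / (x - z))))) \<longlongrightarrow>
          y) (at a within - sphere 0 1)"
        unfolding that(3)
        using C.tendsto_resolvent[OF base[OF True], of p] that(2)
        by (intro tendsto_mult) (auto simp: continuous_within)
      then have "(f \<longlongrightarrow> y) (at a within - sphere 0 1)"
      proof (rule Lim_transform_eventually)
        show "\<forall>\<^sub>F z in at a within - sphere 0 1. k z
            * circle_mean (\<lambda>x. w x * (poly p x * (1 / (x - z)))) = f z"
          unfolding eventually_at_filter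
          by (rule always_eventually, intro allI impI, rule that(1)[symmetric]) auto
      qed
      then show ?thesis
        using True islimpt_compl_unit_circle[OF True]
        by (auto simp: off_circle_value_def trivial_limit_within intro!: tendsto_Lim)
    qed
    have xi: "\<xi> n = 2 * a * circle_mean (\<lambda>x. wm x * poly (\<phi> n) x)" if "n \<ge> 1" for n
      unfolding \<xi>_def a_def[symmetric]
    proof (rule off[where k = "\<lambda>z. 2 * z"])
      show "xi w \<kappa> \<phi> n z = 2 * z * circle_mean (\<lambda>x. w x * (poly (\<phi> n) x * (1 / (x - z))))"
        if "norm z \<noteq> 1" for z
        using xi_eq[OF sys mom that, of n] W.cauchy_phi_altdef[OF that \<open>n \<ge> 1\<close>] by (simp only:)
    qed (auto intro!: continuous_intros)
    have xis: "\<xi>s n = - 2 * a * circle_mean (\<lambda>x. wm x * poly (W.star n) x)" for n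
      unfolding \<xi>s_def a_def[symmetric]
    proof (rule off[where k = "\<lambda>z. - 2 * z"])
      show "xi_star w \<kappa> \<phi>b n z = - 2 * z * circle_mean (\<lambda>x. w x
          * (poly (W.star n) x * (1 / (x - z))))"
        if "norm z \<noteq> 1" for z
        using xi_star_eq[OF sys mom that, of n] unfolding W.cauchy_star_def .
    qed (auto intro!: continuous_intros)
    note facts = xi xis nz[rule_format] n
    note z' = D[OF z]
    have wm: "wm z = w z / (z - a)" by (simp add: wm_def a_def)
    \<comment> \<open>Dividing by \<open>wm z\<close> supplies precisely the factor
      \<open>z - a\<close> on the left of the identities for the Cauchy transforms, so no
      denominator remains in the matrix.\<close>
    have div: "X / wm z = r * (Q * (P' / w z) + R * (- S / w z))"
        if "(z - a) * X = r * (Q * P' - R * S)" for X P' Q R S r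
    proof -
      have "X / wm z = (z - a) * X / w z" unfolding wm using z' by simp
      then show ?thesis unfolding that by (simp add: algebra_simps diff_divide_distrib)
    qed
    define r where "r = \<kappa>m n / \<kappa> n"
    define A where "A = \<kappa> n * \<xi>s n / (\<kappa> (n - 1) * \<xi>s (n - 1))"
    define B where "B = \<kappa> n * \<xi> n / (\<kappa> (n - 1) * \<xi>s (n - 1))"
    define C where "C = poly (\<phi>b n) 0 * \<xi>s n / (\<kappa> (n - 1) * \<xi>s (n - 1)) * (z / a)"
    define E where "E = 1 - A * (z / a)"
    have 1: "poly (\<phi>m n) z = r * (A * poly (\<phi> n) z + B * poly (W.star n) z)"
      unfolding r_def A_def B_def by (rule C.down_phi[of \<xi> \<xi>s, OF facts])
    have 2: "poly (N.star n) z = r * (C * poly (\<phi> n) z + E * poly (W.star n) z)"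
      unfolding r_def A_def C_def E_def by (rule C.down_star[of \<xi> \<xi>s, OF facts])
    have 3: "N.cauchy_phi n z / wm z = r * (A * (W.cauchy_phi n z / w z)
        + B * (- W.cauchy_star n z / w z))"
      using C.down_cauchy_phi[of \<xi> \<xi>s, OF facts z'(3)] unfolding r_def A_def B_def by (rule div)
    have 4: "- N.cauchy_star n z / wm z =
        r * (C * (W.cauchy_phi n z / w z) + E * (- W.cauchy_star n z / w z))"
    proof (rule div)
      show "(z - a) * - N.cauchy_star n z = r * (C * W.cauchy_phi n z - E * W.cauchy_star n z)"
        using C.down_cauchy_star[of \<xi> \<xi>s, OF facts z'(3)]
        unfolding r_def A_def C_def E_def by (simp only: mult_minus_left mult_minus_right)
    qed
    show "Y_matrix wm \<kappa>m \<phi>m \<phi>bm n z =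
      ((\<kappa>m n / \<kappa> n) \<cdot>\<^sub>m
         mat_of_rows_list 2
           [[\<kappa> n * \<xi>s n / (\<kappa> (n - 1) * \<xi>s (n - 1)),
             \<kappa> n * \<xi> n / (\<kappa> (n - 1) * \<xi>s (n - 1))],
            [poly (\<phi>b n) 0 * \<xi>s n / (\<kappa> (n - 1) * \<xi>s (n - 1)) * (z / zs j),
             1 - \<kappa> n * \<xi>s n / (\<kappa> (n - 1) * \<xi>s (n - 1)) * (z / zs j)]])
      * Y_matrix w \<kappa> \<phi> \<phi>b n z"
      unfolding Y_matrix_def phi_star_def a_def[symmetric]
        r_def[symmetric] A_def[symmetric] B_def[symmetric] C_def[symmetric] E_def[symmetric]
            mat_2_mult
        xi_eq[OF sys mom z'(3)] xi_star_eq[OF sys mom z'(3)] xi_eq[OF sysm momm z'(3)]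
            xi_star_eq[OF sysm momm z'(3)]
      by (simp only: 1 2 3 4)
  qed
  show ?thesis using up down by blast
qed

end
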